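(* Let $\mathcal U$, $\mathcal U'$ be Hopf algebroids over $k$, and let $P$, $P'$ be SAYD modules over $\mathcal U$ and $\mathcal U'$ respectively. Let $C$ be a cocommutative $k$-coalgebra, $(\Psi,\psi):C\longrightarrow V(\mathcal U,\mathcal U')$ a measuring of Hopf algebroids and $\Omega:D\longrightarrow Vect_k(P,P')$ a $(C,\Psi,\psi)$-comodule measuring from $P$ to $P'$. For each $y\in D$, the family of maps ($n\ge0$) $$\underline\Omega_n(y):C_n(\mathcal U;P)\longrightarrow C_n(\mathcal U';P'),\qquad p\otimes u^1\otimes\dots\otimes u^n\mapsto y_{(0)}(p)\otimes y_{(1)}(u^1)\otimes\dots\otimes y_{(n)}(u^n)$$ gives a morphism of cyclic modules. In particular, for each $y\in D$ there are induced morphisms on Hochschild and cyclic homologies $$\underline\Omega_\bullet^{hoc}(y):HH_\bullet(\mathcal U;P)\longrightarrow HH_\bullet(\mathcal U';P'),\qquad\underline\Omega_\bullet^{cy}(y):HC_\bullet(\mathcal U;P)\longrightarrow HC_\bullet(\mathcal U';P').$$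
   Context: $k$ is a field; $Vect_k(V,W)$ denotes the space of $k$-linear maps. Sweedler notation is used with summation suppressed; a right $C$-coaction is written $y\mapsto y_{(0)}\otimes y_{(1)}$, iterated $y_{(0)}\otimes y_{(1)}\otimes\dots\otimes y_{(n)}$. Left bialgebroid $(U,A_L,s_L,t_L,\Delta_L,\epsilon_L)$ over $k$ (write $A=A_L$): unital $k$-algebras $U,A$; $k$-algebra morphisms $s_L:A\to U$, $t_L:A^{op}\to U$ with commuting images; $U$ is an $(A,A)$-bimodule via $a\cdot u\cdot b=s_L(a)t_L(b)u$ and $U\otimes_{A_L}U$ is formed with this structure (so $t_L(a)u\otimes v=u\otimes s_L(a)v$); $(U,\Delta_L:U\to U\otimes_{A_L}U,\epsilon_L:U\to A_L)$ is a coalgebra in $(A,A)$-bimodules such that $\Delta_L$ takes values in $U\times_{A_L}U:=\{\sum u_i\otimes u_i' : \sum u_it_L(a)\otimes u'_i=\sum u_i\otimes u_i's_L(a)\ \forall a\in A\}$ (an algebra under factorwise multiplication), $\Delta_L:U\to U\times_{A_L}U$ is a unital algebra morphism, and $\epsilon_L(us_L(\epsilon_L(u')))=\epsilon_L(uu')=\epsilon_L(ut_L(\epsilon_L(u')))$. Hopf algebroid $\mathcal U=(U,A_L,s_L,t_L,\Delta_L,\epsilon_L,S)$: a left bialgebroid with an involutive ($S^2=\mathrm{id}$) anti-automorphism $S$ of the $k$-algebra $U$ with $S\circ t_L=s_L$ and, in $U\otimes_{A_L}U$ for all $u\in U$, $S(u_{(1)})_{(1)}u_{(2)}\otimes S(u_{(1)})_{(2)}=1_U\otimes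 S(u)$ and $S(u_{(2)})_{(1)}\otimes S(u_{(2)})_{(2)}u_{(1)}=S(u)\otimes 1_U$. Notation: $a\triangleright u\triangleleft b=s_L(a)t_L(b)u$, $a\blacktriangleright u\blacktriangleleft b=us_L(b)t_L(a)$. ${}_\blacktriangleright U\otimes_{A^{op}}U_\triangleleft$ is $U\otimes_kU$ modulo the relations $ut_L(a)\otimes v=u\otimes t_L(a)v$. The map $\beta(\mathcal U):{}_\blacktriangleright U\otimes_{A^{op}}U_\triangleleft\to U_\triangleleft\otimes_A{}_\triangleright U$, $u\otimes v\mapsto u_{(1)}\otimes u_{(2)}v$ is bijective for a Hopf algebroid, and one writes $u_+\otimes u_-:=\beta(\mathcal U)^{-1}(u\otimes_A1)$. SAYD module $P$ over $\mathcal U$: (1) a right $U$-module; (2) a left comodule over the $A$-coring $U$: a left $A$-module $(a,p)\mapsto ap$ with a left $A$-linear, coassociative and counital coaction $\Delta_P:P\to U_\triangleleft\otimes_AP$, $p\mapsto p_{(-1)}\otimes p_{(0)}$ (tensor relation $t_L(a)u\otimes p=u\otimes ap$); (3) $ps_L(a)t_L(b)=b\,\epsilon_L(p_{(-1)}s_L(a))p_{(0)}$ for $a,b\in A$; (4) $\Delta_P(pu)=u_-p_{(-1)}u_{+(1)}\otimes_Ap_{(0)}u_{+(2)}$; and (stability) $p_{(0)}p_{(-1)}=p$. Measuring of algebras: for $k$-algebras $R,R'$ and a $k$-coalgebra $C$ with counit $\epsilon_C$, a linear map $\psi:C\to Vect_k(R,R')$ with $\psi(x)(ab)=\psi(x_{(1)})(a)\psi(x_{(2)})(b)$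 and $\psi(x)(1_R)=\epsilon_C(x)1_{R'}$. Measuring of Hopf algebroids from $\mathcal U$ to $\mathcal U'$ by a cocommutative $k$-coalgebra $C$: a pair of algebra measurings $\Psi:C\to Vect_k(U,U')$, $\psi:C\to Vect_k(A_L,A'_L)$ such that for all $x\in C$: $\Psi(x)s_L=s_L'\psi(x)$, $\Psi(x)t_L=t'_L\psi(x)$, $\Psi(x)S=S'\Psi(x)$, $\psi(x)\epsilon_L=\epsilon_L'\Psi(x)$, and $\Delta'_L(\Psi(x)(u))=\Psi(x_{(1)})(u_{(1)})\otimes\Psi(x_{(2)})(u_{(2)})$ in $U'\otimes_{A'_L}U'$ for all $u\in U$. The map $(\Psi,\psi)$ takes values in $V(\mathcal U,\mathcal U'):=\{(F,f)\in Vect_k(U,U')\times Vect_k(A_L,A_L'): Fs_L=s_L'f,\ Ft_L=t_L'f,\ FS=S'F,\ f\epsilon_L=\epsilon_L'F\}$. $(C,\Psi,\psi)$-comodule measuring from $P$ to $P'$: a right $C$-comodule $D$ and a linear map $\Omega:D\to Vect_k(P,P')$ such that for all $y\in D$, $p\in P$, $u\in U$: $\Omega(y)(pu)=\Omega(y_{(0)})(p)\,\Psi(y_{(1)})(u)$, and $\Delta'_{P'}(\Omega(y)(p))=\Psi(y_{(1)})(p_{(-1)})\otimes_{A'}\Omega(y_{(0)})(p_{(0)})$. One writes $x(u)=\Psi(x)(u)$, $y(p)=\Omega(y)(p)$. Cyclic module $C_\bullet(\mathcal U;P)$: $C_n(\mathcal U;P)=P\otimes_{A^{op}}({}_\blacktriangleright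 U_\triangleleft)^{\otimes_{A^{op}}n}$, with relations $pt_L(a)\otimes u=p\otimes t_L(a)u$ and $ut_L(a)\otimes v=u\otimes t_L(a)v$. Operators: $d_0(p\otimes u^1\otimes\dots\otimes u^n)=p\otimes u^1\otimes\dots\otimes u^{n-1}t_L(\epsilon_L(u^n))$; $d_i(\dots)=p\otimes u^1\otimes\dots\otimes u^{n-i}u^{n-i+1}\otimes\dots\otimes u^n$ for $1\le i\le n-1$; $d_n(\dots)=pu^1\otimes u^2\otimes\dots\otimes u^n$ (for $n=1$: $d_0(p\otimes u)=pt_L(\epsilon_L(u))$, $d_1(p\otimes u)=pu$); $s_0$ appends $1$ at the right end, $s_i$ ($1\le i\le n-1$) inserts $1$ between $u^{n-i}$ and $u^{n-i+1}$, $s_n$ inserts $1$ between $p$ and $u^1$; $t_n(p\otimes u^1\otimes\dots\otimes u^n)=p_{(0)}u^1_+\otimes u^2_+\otimes\dots\otimes u^n_+\otimes u^n_-\cdots u^1_-p_{(-1)}$, $t_0=\mathrm{id}$. $HH_\bullet(\mathcal U;P)$ and $HC_\bullet(\mathcal U;P)$ are the Hochschild and cyclic homologies of this cyclic module. *)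

theory Defs
  imports Complex_Main "HOL-Library.Poly_Mapping" "HOL-Library.FuncSet"
begin

section \<open>Vector spaces with a carrier, quotients, linear maps\<close>

text \<open>
  The data (algebras, modules, coalgebras, comodules) live on types, with an explicit scalar
  multiplication by the field.  Quotient spaces, and the homology spaces built from them,
  depend on that data and are therefore given by carrier sets of cosets.  Algebras are on
  types of sort \<open>{ring, monoid_mult}\<close>, not \<open>ring_1\<close>, so that the zero algebra is allowed.
\<close>

record ('k, 'v) kspace =
  vcarrier :: "'v set"
  vadd :: "'v \<Rightarrow> 'v \<Rightarrow> 'v"
  vzero :: "'v"
  vscale :: "'k \<Rightarrow> 'v \<Rightarrow> 'v"

definition whole_space :: "('k \<Rightarrow> 'v::ab_group_add \<Rightarrow> 'v) \<Rightarrow> ('k, 'v) kspace" where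
  "whole_space sc = \<lparr>vcarrier = UNIV, vadd = (+), vzero = 0, vscale = sc\<rparr>"

definition linear_map :: "('k, 'v) kspace \<Rightarrow> ('k, 'w) kspace \<Rightarrow> ('v \<Rightarrow> 'w) \<Rightarrow> bool" where
  "linear_map M N f \<longleftrightarrow>
     f \<in> vcarrier M \<rightarrow> vcarrier N \<and>
     (\<forall>x\<in>vcarrier M. \<forall>y\<in>vcarrier M. f (vadd M x y) = vadd N (f x) (f y)) \<and>
     (\<forall>c. \<forall>x\<in>vcarrier M. f (vscale M c x) = vscale N c (f x))"

definition coset :: "('k, 'v) kspace \<Rightarrow> 'v set \<Rightarrow> 'v \<Rightarrow> 'v set" where
  "coset M N x = {vadd M x w | w. w \<in> N}"

definition quotient_space :: "('k, 'v) kspace \<Rightarrow> 'v set \<Rightarrow> ('k, 'v set) kspace" where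
  "quotient_space M N =
     \<lparr>vcarrier = coset M N ` vcarrier M,
      vadd = (\<lambda>X Y. {vadd M x y | x y. x \<in> X \<and> y \<in> Y}),
      vzero = N,
      vscale = (\<lambda>c X. {vadd M (vscale M c x) w | x w. x \<in> X \<and> w \<in> N})\<rparr>"

text \<open>The sum of \<open>f i\<close> over \<open>i < n\<close>.\<close>

primrec vsum :: "('k, 'v) kspace \<Rightarrow> (nat \<Rightarrow> 'v) \<Rightarrow> nat \<Rightarrow> 'v" where
  "vsum M f 0 = vzero M"
| "vsum M f (Suc n) = vadd M (vsum M f n) (f n)"


section \<open>Free vector spaces, tensor products, Sweedler notation\<close>

definition fscale :: "'k::field \<Rightarrow> ('x \<Rightarrow>\<^sub>0 'k) \<Rightarrow> ('x \<Rightarrow>\<^sub>0 'k)" where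
  "fscale c r = Poly_Mapping.map ((*) c) r"

definition free_space :: "'x set \<Rightarrow> ('k::field, 'x \<Rightarrow>\<^sub>0 'k) kspace" where
  "free_space B = \<lparr>vcarrier = {r. Poly_Mapping.keys r \<subseteq> B}, vadd = (+), vzero = 0, vscale = fscale\<rparr>"

abbreviation gen :: "'x \<Rightarrow> ('x \<Rightarrow>\<^sub>0 'k::field)" where
  "gen x \<equiv> Poly_Mapping.single x 1"

abbreviation fspan :: "('x \<Rightarrow>\<^sub>0 'k::field) set \<Rightarrow> ('x \<Rightarrow>\<^sub>0 'k) set" where
  "fspan \<equiv> module.span fscale"

definition cls :: "('x \<Rightarrow>\<^sub>0 'k::field) set \<Rightarrow> ('x \<Rightarrow>\<^sub>0 'k) \<Rightarrow> ('x \<Rightarrow>\<^sub>0 'k) set" where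
  "cls W r = coset (free_space UNIV) W r"

definition lin_ext ::
  "('k::field \<Rightarrow> 'v::ab_group_add \<Rightarrow> 'v) \<Rightarrow> ('x \<Rightarrow> 'v) \<Rightarrow> ('x \<Rightarrow>\<^sub>0 'k) \<Rightarrow> 'v" where
  "lin_ext sc f r = (\<Sum>x\<in>Poly_Mapping.keys r. sc (Poly_Mapping.lookup r x) (f x))"

text \<open>
  Sweedler notation: \<open>sweedler sc X (\<lambda>(x, y). f x y)\<close> is the sum of \<open>f x y\<close> over the simple
  tensors of one representative of the element \<open>X\<close> of a tensor product.  It is
  independent of the representative whenever \<open>f\<close> respects the relations of the tensor product.
\<close>

definition sweedler ::
  "('k::field \<Rightarrow> 'v::ab_group_add \<Rightarrow> 'v) \<Rightarrow> ('x \<Rightarrow>\<^sub>0 'k) set \<Rightarrow> ('x \<Rightarrow> 'v) \<Rightarrow> 'v" where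
  "sweedler sc X f = lin_ext sc f (SOME r. r \<in> X)"

abbreviation sw :: "('x \<Rightarrow>\<^sub>0 'k::field) set \<Rightarrow> ('x \<Rightarrow> ('y \<Rightarrow>\<^sub>0 'k)) \<Rightarrow> ('y \<Rightarrow>\<^sub>0 'k)" where
  "sw \<equiv> sweedler fscale"

text \<open>
  Relations of \<open>X \<otimes> Y\<close> balanced by \<open>rx a x \<otimes> y = x \<otimes> ly a y\<close>, as a subspace of the free vector
  space on \<open>X \<times> Y\<close>.  Taking the scalar multiplications for \<open>rx\<close> and \<open>ly\<close> gives the tensor
  product over the field.
\<close>

definition rel2 ::
  "('k::field \<Rightarrow> 'x::ab_group_add \<Rightarrow> 'x) \<Rightarrow> ('k \<Rightarrow> 'y::ab_group_add \<Rightarrow> 'y) \<Rightarrow>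
   ('a \<Rightarrow> 'x \<Rightarrow> 'x) \<Rightarrow> ('a \<Rightarrow> 'y \<Rightarrow> 'y) \<Rightarrow> ('x \<times> 'y \<Rightarrow>\<^sub>0 'k) set" where
  "rel2 sx sy rx ly = fspan (
     {gen (x + x', y) - gen (x, y) - gen (x', y) | x x' y. True} \<union>
     {gen (x, y + y') - gen (x, y) - gen (x, y') | x y y'. True} \<union>
     {gen (sx c x, y) - fscale c (gen (x, y)) | c x y. True} \<union>
     {gen (x, sy c y) - fscale c (gen (x, y)) | c x y. True} \<union>
     {gen (rx a x, y) - gen (x, ly a y) | a x y. True})"

definition rel3 ::
  "('k::field \<Rightarrow> 'x::ab_group_add \<Rightarrow> 'x) \<Rightarrow> ('k \<Rightarrow> 'y::ab_group_add \<Rightarrow> 'y) \<Rightarrow>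
   ('k \<Rightarrow> 'z::ab_group_add \<Rightarrow> 'z) \<Rightarrow>
   ('a \<Rightarrow> 'x \<Rightarrow> 'x) \<Rightarrow> ('a \<Rightarrow> 'y \<Rightarrow> 'y) \<Rightarrow> ('a \<Rightarrow> 'y \<Rightarrow> 'y) \<Rightarrow> ('a \<Rightarrow> 'z \<Rightarrow> 'z) \<Rightarrow>
   ('x \<times> 'y \<times> 'z \<Rightarrow>\<^sub>0 'k) set" where
  "rel3 sx sy sz rx ly ry lz = fspan (
     {gen (x + x', y, z) - gen (x, y, z) - gen (x', y, z) | x x' y z. True} \<union>
     {gen (x, y + y', z) - gen (x, y, z) - gen (x, y', z) | x y y' z. True} \<union>
     {gen (x, y, z + z') - gen (x, y, z) - gen (x, y, z') | x y z z'. True} \<union>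
     {gen (sx c x, y, z) - fscale c (gen (x, y, z)) | c x y z. True} \<union>
     {gen (x, sy c y, z) - fscale c (gen (x, y, z)) | c x y z. True} \<union>
     {gen (x, y, sz c z) - fscale c (gen (x, y, z)) | c x y z. True} \<union>
     {gen (rx a x, y, z) - gen (x, ly a y, z) | a x y z. True} \<union>
     {gen (x, ry a y, z) - gen (x, y, lz a z) | a x y z. True})"

text \<open>Multilinearity relations of \<open>P \<otimes> U \<otimes> \<dots> \<otimes> U\<close> with \<open>n\<close> factors \<open>U\<close>.\<close>

definition multilin_rels ::
  "('k::field \<Rightarrow> 'p::ab_group_add \<Rightarrow> 'p) \<Rightarrow> ('k \<Rightarrow> 'u::ab_group_add \<Rightarrow> 'u) \<Rightarrow> nat \<Rightarrow>
   ('p \<times> 'u list \<Rightarrow>\<^sub>0 'k) set" where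
  "multilin_rels sp su n =
     {gen (p + p', us) - gen (p, us) - gen (p', us) | p p' us. length us = n} \<union>
     {gen (sp c p, us) - fscale c (gen (p, us)) | c p us. length us = n} \<union>
     {gen (p, vs @ [u + u'] @ ws) - gen (p, vs @ [u] @ ws) - gen (p, vs @ [u'] @ ws)
        | p vs u u' ws. length vs + 1 + length ws = n} \<union>
     {gen (p, vs @ [su c u] @ ws) - fscale c (gen (p, vs @ [u] @ ws))
        | p c vs u ws. length vs + 1 + length ws = n}"

definition tensor2 ::
  "('x \<times> 'y \<Rightarrow>\<^sub>0 'k::field) set \<Rightarrow> ('k, ('x \<times> 'y \<Rightarrow>\<^sub>0 'k) set) kspace" where
  "tensor2 W = quotient_space (free_space UNIV) W"


section \<open>Algebras, coalgebras, comodules\<close>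

definition algebra_over ::
  "('k::field \<Rightarrow> 'r::{ring,monoid_mult} \<Rightarrow> 'r) \<Rightarrow> bool" where
  "algebra_over sc \<longleftrightarrow> vector_space sc \<and>
     (\<forall>c x y. sc c x * y = sc c (x * y) \<and> x * sc c y = sc c (x * y))"

record (overloaded) ('k, 'c) coalgebra_data =
  csc :: "'k::field \<Rightarrow> 'c \<Rightarrow> 'c"
  ccomult :: "'c \<Rightarrow> ('c \<times> 'c \<Rightarrow>\<^sub>0 'k) set"
  ccounit :: "'c \<Rightarrow> 'k"

abbreviation rel_CC :: "('k::field, 'c::ab_group_add) coalgebra_data \<Rightarrow> ('c \<times> 'c \<Rightarrow>\<^sub>0 'k) set" where
  "rel_CC C \<equiv> rel2 (csc C) (csc C) (csc C) (csc C)"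

locale cocommutative_coalgebra =
  fixes C :: "('k::field, 'c::ab_group_add) coalgebra_data"
  assumes C_space: "vector_space (csc C)"
    and comult_linear: "linear_map (whole_space (csc C)) (tensor2 (rel_CC C)) (ccomult C)"
    and counit_linear: "Vector_Spaces.linear (csc C) (*) (ccounit C)"
    and coassoc:
      "cls (rel3 (csc C) (csc C) (csc C) (csc C) (csc C) (csc C) (csc C))
         (sw (ccomult C x) (\<lambda>(x1, x2). sw (ccomult C x1) (\<lambda>(x11, x12). gen (x11, x12, x2)))) =
       cls (rel3 (csc C) (csc C) (csc C) (csc C) (csc C) (csc C) (csc C))
         (sw (ccomult C x) (\<lambda>(x1, x2). sw (ccomult C x2) (\<lambda>(x21, x22). gen (x1, x21, x22))))"
    and counit_left: "sweedler (csc C) (ccomult C x) (\<lambda>(x1, x2). csc C (ccounit C x1) x2) = x"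
    and counit_right: "sweedler (csc C) (ccomult C x) (\<lambda>(x1, x2). csc C (ccounit C x2) x1) = x"
    and cocomm: "ccomult C x = cls (rel_CC C) (sw (ccomult C x) (\<lambda>(x1, x2). gen (x2, x1)))"

record (overloaded) ('k, 'c, 'd) comodule_data =
  dsc :: "'k::field \<Rightarrow> 'd \<Rightarrow> 'd"
  dcoact :: "'d \<Rightarrow> ('d \<times> 'c \<Rightarrow>\<^sub>0 'k) set"

abbreviation rel_DC ::
  "('k::field, 'c::ab_group_add) coalgebra_data \<Rightarrow> ('k, 'c, 'd::ab_group_add) comodule_data \<Rightarrow>
   ('d \<times> 'c \<Rightarrow>\<^sub>0 'k) set" where
  "rel_DC C D \<equiv> rel2 (dsc D) (csc C) (dsc D) (csc C)"

locale right_comodule =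
  fixes C :: "('k::field, 'c::ab_group_add) coalgebra_data"
    and D :: "('k, 'c, 'd::ab_group_add) comodule_data"
  assumes D_space: "vector_space (dsc D)"
    and coact_linear: "linear_map (whole_space (dsc D)) (tensor2 (rel_DC C D)) (dcoact D)"
    and coact_coassoc:
      "cls (rel3 (dsc D) (csc C) (csc C) (dsc D) (csc C) (csc C) (csc C))
         (sw (dcoact D y) (\<lambda>(y0, y1). sw (dcoact D y0) (\<lambda>(y00, y01). gen (y00, y01, y1)))) =
       cls (rel3 (dsc D) (csc C) (csc C) (dsc D) (csc C) (csc C) (csc C))
         (sw (dcoact D y) (\<lambda>(y0, y1). sw (ccomult C y1) (\<lambda>(y11, y12). gen (y0, y11, y12))))"
    and coact_counit:
      "sweedler (dsc D) (dcoact D y) (\<lambda>(y0, y1). dsc D (ccounit C y1) y0) = y"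

text \<open>The iterated coaction \<open>y \<mapsto> y\<^sub>0 \<otimes> y\<^sub>1 \<otimes> \<dots> \<otimes> y\<^sub>n\<close> in \<open>D \<otimes> C \<otimes> \<dots> \<otimes> C\<close> (over the field).\<close>

primrec iter_coact_rep ::
  "('k::field, 'c, 'd) comodule_data \<Rightarrow> nat \<Rightarrow> 'd \<Rightarrow> ('d \<times> 'c list \<Rightarrow>\<^sub>0 'k)" where
  "iter_coact_rep D 0 y = gen (y, [])"
| "iter_coact_rep D (Suc n) y =
     sw (dcoact D y) (\<lambda>(y0, x). lin_ext fscale (\<lambda>(z, xs). gen (z, xs @ [x])) (iter_coact_rep D n y0))"

definition iter_coact ::
  "('k::field, 'c::ab_group_add) coalgebra_data \<Rightarrow> ('k, 'c, 'd::ab_group_add) comodule_data \<Rightarrow>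
   nat \<Rightarrow> 'd \<Rightarrow> ('d \<times> 'c list \<Rightarrow>\<^sub>0 'k) set" where
  "iter_coact C D n y = cls (fspan (multilin_rels (dsc D) (csc C) n)) (iter_coact_rep D n y)"


section \<open>Left bialgebroids and Hopf algebroids\<close>

record (overloaded) ('k, 'u, 'a) bialgebroid_data =
  usc :: "'k::field \<Rightarrow> 'u \<Rightarrow> 'u"
  asc :: "'k \<Rightarrow> 'a \<Rightarrow> 'a"
  src :: "'a \<Rightarrow> 'u"
  tgt :: "'a \<Rightarrow> 'u"
  comult :: "'u \<Rightarrow> ('u \<times> 'u \<Rightarrow>\<^sub>0 'k) set"
  counit :: "'u \<Rightarrow> 'a"

text \<open>Relations \<open>t(a)u \<otimes> v = u \<otimes> s(a)v\<close> defining \<open>U \<otimes>\<^sub>A U\<close>.\<close>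

abbreviation rel_UU ::
  "('k::field, 'u::{ring,monoid_mult}, 'a, 'm) bialgebroid_data_scheme \<Rightarrow> ('u \<times> 'u \<Rightarrow>\<^sub>0 'k) set" where
  "rel_UU H \<equiv> rel2 (usc H) (usc H) (\<lambda>a u. tgt H a * u) (\<lambda>a u. src H a * u)"

abbreviation rel_UUU ::
  "('k::field, 'u::{ring,monoid_mult}, 'a, 'm) bialgebroid_data_scheme \<Rightarrow> ('u \<times> 'u \<times> 'u \<Rightarrow>\<^sub>0 'k) set" where
  "rel_UUU H \<equiv> rel3 (usc H) (usc H) (usc H)
     (\<lambda>a u. tgt H a * u) (\<lambda>a u. src H a * u) (\<lambda>a u. tgt H a * u) (\<lambda>a u. src H a * u)"

text \<open>Relations \<open>u t(a) \<otimes> v = u \<otimes> t(a)v\<close> of the domain of \<open>\<beta>\<close>, the tensor product over the opposite of \<open>A\<close>.\<close>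

abbreviation rel_UUop ::
  "('k::field, 'u::{ring,monoid_mult}, 'a, 'm) bialgebroid_data_scheme \<Rightarrow> ('u \<times> 'u \<Rightarrow>\<^sub>0 'k) set" where
  "rel_UUop H \<equiv> rel2 (usc H) (usc H) (\<lambda>a u. u * tgt H a) (\<lambda>a u. tgt H a * u)"

locale left_bialgebroid =
  fixes H :: "('k::field, 'u::{ring,monoid_mult}, 'a::{ring,monoid_mult}, 'm) bialgebroid_data_scheme"
  assumes U_algebra: "algebra_over (usc H)"
    and A_algebra: "algebra_over (asc H)"
    and src_linear: "Vector_Spaces.linear (asc H) (usc H) (src H)"
    and src_mult: "src H (a * b) = src H a * src H b"
    and src_one: "src H 1 = 1"
    and tgt_linear: "Vector_Spaces.linear (asc H) (usc H) (tgt H)"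
    and tgt_mult: "tgt H (a * b) = tgt H b * tgt H a"
    and tgt_one: "tgt H 1 = 1"
    and src_tgt_commute: "src H a * tgt H b = tgt H b * src H a"
    and comult_linear: "linear_map (whole_space (usc H)) (tensor2 (rel_UU H)) (comult H)"
    and comult_bimodule:
      "comult H (src H a * tgt H b * u) =
         cls (rel_UU H) (sw (comult H u) (\<lambda>(u1, u2). gen (src H a * u1, tgt H b * u2)))"
    and counit_linear: "Vector_Spaces.linear (usc H) (asc H) (counit H)"
    and counit_bimodule: "counit H (src H a * tgt H b * u) = a * counit H u * b"
    and coassoc:
      "cls (rel_UUU H) (sw (comult H u) (\<lambda>(u1, u2). sw (comult H u1) (\<lambda>(u11, u12). gen (u11, u12, u2)))) =
       cls (rel_UUU H) (sw (comult H u) (\<lambda>(u1, u2). sw (comult H u2) (\<lambda>(u21, u22). gen (u1, u21, u22))))"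
    and counit_left: "sweedler (usc H) (comult H u) (\<lambda>(u1, u2). src H (counit H u1) * u2) = u"
    and counit_right: "sweedler (usc H) (comult H u) (\<lambda>(u1, u2). tgt H (counit H u2) * u1) = u"
    and comult_takeuchi:
      "cls (rel_UU H) (sw (comult H u) (\<lambda>(u1, u2). gen (u1 * tgt H a, u2))) =
       cls (rel_UU H) (sw (comult H u) (\<lambda>(u1, u2). gen (u1, u2 * src H a)))"
    and comult_mult:
      "comult H (u * v) =
         cls (rel_UU H) (sw (comult H u) (\<lambda>(u1, u2). sw (comult H v) (\<lambda>(v1, v2). gen (u1 * v1, u2 * v2))))"
    and comult_one: "comult H 1 = cls (rel_UU H) (gen (1, 1))"
    and counit_mult_src: "counit H (u * src H (counit H v)) = counit H (u * v)"
    and counit_mult_tgt: "counit H (u * tgt H (counit H v)) = counit H (u * v)"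

record (overloaded) ('k, 'u, 'a) hopf_algebroid_data = "('k::field, 'u, 'a) bialgebroid_data" +
  antipode :: "'u \<Rightarrow> 'u"

locale hopf_algebroid = left_bialgebroid H
  for H :: "('k::field, 'u::{ring,monoid_mult}, 'a::{ring,monoid_mult}) hopf_algebroid_data" +
  assumes antipode_linear: "Vector_Spaces.linear (usc H) (usc H) (antipode H)"
    and antipode_mult: "antipode H (u * v) = antipode H v * antipode H u"
    and antipode_one: "antipode H 1 = 1"
    and antipode_involutive: "antipode H (antipode H u) = u"
    and antipode_tgt: "antipode H (tgt H a) = src H a"
    and antipode_left:
      "cls (rel_UU H) (sw (comult H u) (\<lambda>(u1, u2).
          sw (comult H (antipode H u1)) (\<lambda>(v1, v2). gen (v1 * u2, v2)))) =
       cls (rel_UU H) (gen (1, antipode H u))"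
    and antipode_right:
      "cls (rel_UU H) (sw (comult H u) (\<lambda>(u1, u2).
          sw (comult H (antipode H u2)) (\<lambda>(v1, v2). gen (v1, v2 * u1)))) =
       cls (rel_UU H) (gen (antipode H u, 1))"

definition hopf_beta ::
  "('k::field, 'u::{ring,monoid_mult}, 'a) hopf_algebroid_data \<Rightarrow>
   ('u \<times> 'u \<Rightarrow>\<^sub>0 'k) set \<Rightarrow> ('u \<times> 'u \<Rightarrow>\<^sub>0 'k) set" where
  "hopf_beta H X =
     cls (rel_UU H) (sw X (\<lambda>(u, v). sw (comult H u) (\<lambda>(u1, u2). gen (u1, u2 * v))))"

text \<open>\<open>translation H u\<close> is \<open>u\<^sub>+ \<otimes> u\<^sub>- = \<beta>\<^sup>-\<^sup>1(u \<otimes> 1)\<close>; \<open>\<beta>\<close> is bijective for every Hopf algebroid.\<close>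

definition translation ::
  "('k::field, 'u::{ring,monoid_mult}, 'a) hopf_algebroid_data \<Rightarrow> 'u \<Rightarrow> ('u \<times> 'u \<Rightarrow>\<^sub>0 'k) set" where
  "translation H u =
     the_inv_into (vcarrier (tensor2 (rel_UUop H))) (hopf_beta H) (cls (rel_UU H) (gen (u, 1)))"


section \<open>Stable anti-Yetter-Drinfeld modules\<close>

record (overloaded) ('k, 'u, 'a, 'p) sayd_data =
  psc :: "'k::field \<Rightarrow> 'p \<Rightarrow> 'p"
  ract :: "'p \<Rightarrow> 'u \<Rightarrow> 'p"
  lact :: "'a \<Rightarrow> 'p \<Rightarrow> 'p"
  pcoact :: "'p \<Rightarrow> ('u \<times> 'p \<Rightarrow>\<^sub>0 'k) set"

text \<open>Relations \<open>t(a)u \<otimes> p = u \<otimes> ap\<close> defining \<open>U \<otimes>\<^sub>A P\<close>.\<close>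

abbreviation rel_UP ::
  "('k::field, 'u::{ring,monoid_mult}, 'a, 'm) bialgebroid_data_scheme \<Rightarrow>
   ('k, 'u, 'a, 'p::ab_group_add) sayd_data \<Rightarrow> ('u \<times> 'p \<Rightarrow>\<^sub>0 'k) set" where
  "rel_UP H P \<equiv> rel2 (usc H) (psc P) (\<lambda>a u. tgt H a * u) (lact P)"

abbreviation rel_UUP ::
  "('k::field, 'u::{ring,monoid_mult}, 'a, 'm) bialgebroid_data_scheme \<Rightarrow>
   ('k, 'u, 'a, 'p::ab_group_add) sayd_data \<Rightarrow> ('u \<times> 'u \<times> 'p \<Rightarrow>\<^sub>0 'k) set" where
  "rel_UUP H P \<equiv> rel3 (usc H) (usc H) (psc P)
     (\<lambda>a u. tgt H a * u) (\<lambda>a u. src H a * u) (\<lambda>a u. tgt H a * u) (lact P)"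

locale sayd_module =
  fixes H :: "('k::field, 'u::{ring,monoid_mult}, 'a::{ring,monoid_mult}) hopf_algebroid_data"
    and P :: "('k, 'u, 'a, 'p::ab_group_add) sayd_data"
  assumes P_space: "vector_space (psc P)"
    and ract_linear_P: "Vector_Spaces.linear (psc P) (psc P) (\<lambda>p. ract P p u)"
    and ract_linear_U: "Vector_Spaces.linear (usc H) (psc P) (ract P p)"
    and ract_one: "ract P p 1 = p"
    and ract_mult: "ract P p (u * v) = ract P (ract P p u) v"
    and lact_linear_P: "Vector_Spaces.linear (psc P) (psc P) (lact P a)"
    and lact_linear_A: "Vector_Spaces.linear (asc H) (psc P) (\<lambda>a. lact P a p)"
    and lact_one: "lact P 1 p = p"
    and lact_mult: "lact P (a * b) p = lact P a (lact P b p)"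
    and pcoact_linear: "linear_map (whole_space (psc P)) (tensor2 (rel_UP H P)) (pcoact P)"
    and pcoact_lact:
      "pcoact P (lact P a p) = cls (rel_UP H P) (sw (pcoact P p) (\<lambda>(q, p0). gen (src H a * q, p0)))"
    and pcoact_coassoc:
      "cls (rel_UUP H P) (sw (pcoact P p) (\<lambda>(q, p0). sw (comult H q) (\<lambda>(q1, q2). gen (q1, q2, p0)))) =
       cls (rel_UUP H P) (sw (pcoact P p) (\<lambda>(q, p0). sw (pcoact P p0) (\<lambda>(q', p00). gen (q, q', p00))))"
    and pcoact_counit: "sweedler (psc P) (pcoact P p) (\<lambda>(q, p0). lact P (counit H q) p0) = p"
    and ract_src_tgt:
      "ract P (ract P p (src H a)) (tgt H b) =
         sweedler (psc P) (pcoact P p) (\<lambda>(q, p0). lact P (b * counit H (q * src H a)) p0)"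
    and anti_yetter_drinfeld:
      "pcoact P (ract P p u) =
         cls (rel_UP H P) (sw (pcoact P p) (\<lambda>(q, p0). sw (translation H u) (\<lambda>(up, um).
           sw (comult H up) (\<lambda>(up1, up2). gen (um * q * up1, ract P p0 up2)))))"
    and stable: "sweedler (psc P) (pcoact P p) (\<lambda>(q, p0). ract P p0 q) = p"


section \<open>Measurings\<close>

locale algebra_measuring =
  fixes C :: "('k::field, 'c::ab_group_add) coalgebra_data"
    and r :: "'k \<Rightarrow> 'r::{ring,monoid_mult} \<Rightarrow> 'r"
    and r' :: "'k \<Rightarrow> 'r2::{ring,monoid_mult} \<Rightarrow> 'r2"
    and f :: "'c \<Rightarrow> 'r \<Rightarrow> 'r2"
  assumes linear_R: "Vector_Spaces.linear r r' (f x)"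
    and linear_C: "Vector_Spaces.linear (csc C) r' (\<lambda>x. f x a)"
    and measuring_mult: "f x (a * b) = sweedler r' (ccomult C x) (\<lambda>(x1, x2). f x1 a * f x2 b)"
    and measuring_one: "f x 1 = r' (ccounit C x) 1"

locale hopf_measuring =
  fixes C :: "('k::field, 'c::ab_group_add) coalgebra_data"
    and H :: "('k, 'u::{ring,monoid_mult}, 'a::{ring,monoid_mult}) hopf_algebroid_data"
    and H' :: "('k, 'u2::{ring,monoid_mult}, 'a2::{ring,monoid_mult}) hopf_algebroid_data"
    and Psi :: "'c \<Rightarrow> 'u \<Rightarrow> 'u2"
    and psi :: "'c \<Rightarrow> 'a \<Rightarrow> 'a2"
  assumes Psi_measuring: "algebra_measuring C (usc H) (usc H') Psi"
    and psi_measuring: "algebra_measuring C (asc H) (asc H') psi"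
    and Psi_src: "Psi x (src H a) = src H' (psi x a)"
    and Psi_tgt: "Psi x (tgt H a) = tgt H' (psi x a)"
    and Psi_antipode: "Psi x (antipode H u) = antipode H' (Psi x u)"
    and psi_counit: "psi x (counit H u) = counit H' (Psi x u)"
    and Psi_comult:
      "comult H' (Psi x u) =
         cls (rel_UU H') (sw (ccomult C x) (\<lambda>(x1, x2). sw (comult H u) (\<lambda>(u1, u2).
           gen (Psi x1 u1, Psi x2 u2))))"

locale comodule_measuring =
  fixes C :: "('k::field, 'c::ab_group_add) coalgebra_data"
    and H' :: "('k, 'u2::{ring,monoid_mult}, 'a2::{ring,monoid_mult}) hopf_algebroid_data"
    and P :: "('k, 'u::{ring,monoid_mult}, 'a, 'p::ab_group_add) sayd_data"
    and P' :: "('k, 'u2, 'a2, 'p2::ab_group_add) sayd_data"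
    and Psi :: "'c \<Rightarrow> 'u \<Rightarrow> 'u2"
    and D :: "('k, 'c, 'd::ab_group_add) comodule_data"
    and Om :: "'d \<Rightarrow> 'p \<Rightarrow> 'p2"
  assumes D_comodule: "right_comodule C D"
    and Om_linear_P: "Vector_Spaces.linear (psc P) (psc P') (Om y)"
    and Om_linear_D: "Vector_Spaces.linear (dsc D) (psc P') (\<lambda>y. Om y p)"
    and Om_ract:
      "Om y (ract P p u) = sweedler (psc P') (dcoact D y) (\<lambda>(y0, y1). ract P' (Om y0 p) (Psi y1 u))"
    and Om_coact:
      "pcoact P' (Om y p) =
         cls (rel_UP H' P') (sw (dcoact D y) (\<lambda>(y0, y1). sw (pcoact P p) (\<lambda>(q, p0).
           gen (Psi y1 q, Om y0 p0))))"


section \<open>Cyclic modules and their homologies\<close>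

text \<open>Faces \<open>face M n i\<close> (\<open>1 \<le> n\<close>, \<open>i \<le> n\<close>) go from degree \<open>n\<close> to \<open>n - 1\<close>, degeneracies
  \<open>degen M n i\<close> (\<open>i \<le> n\<close>) from degree \<open>n\<close> to \<open>n + 1\<close>.\<close>

record ('k, 'v) cyclic_data =
  level :: "nat \<Rightarrow> ('k, 'v) kspace"
  face :: "nat \<Rightarrow> nat \<Rightarrow> 'v \<Rightarrow> 'v"
  degen :: "nat \<Rightarrow> nat \<Rightarrow> 'v \<Rightarrow> 'v"
  cyc :: "nat \<Rightarrow> 'v \<Rightarrow> 'v"

definition cyclic_morphism ::
  "('k, 'v) cyclic_data \<Rightarrow> ('k, 'w) cyclic_data \<Rightarrow> (nat \<Rightarrow> 'v \<Rightarrow> 'w) \<Rightarrow> bool" where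
  "cyclic_morphism M N f \<longleftrightarrow>
     (\<forall>n. linear_map (level M n) (level N n) (f n)) \<and>
     (\<forall>n i. \<forall>x\<in>vcarrier (level M n). 1 \<le> n \<longrightarrow> i \<le> n \<longrightarrow>
        f (n - 1) (face M n i x) = face N n i (f n x)) \<and>
     (\<forall>n i. \<forall>x\<in>vcarrier (level M n). i \<le> n \<longrightarrow>
        f (n + 1) (degen M n i x) = degen N n i (f n x)) \<and>
     (\<forall>n. \<forall>x\<in>vcarrier (level M n). f n (cyc M n x) = cyc N n (f n x))"

text \<open>Chain complexes in degrees \<open>\<ge> 0\<close>; \<open>bd K n\<close> goes from degree \<open>n\<close> to \<open>n - 1\<close> and is used only
  for \<open>n \<ge> 1\<close>.\<close>

record ('k, 'v) complex_data =
  chains :: "nat \<Rightarrow> ('k, 'v) kspace"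
  bd :: "nat \<Rightarrow> 'v \<Rightarrow> 'v"

definition cycles :: "('k, 'v) complex_data \<Rightarrow> nat \<Rightarrow> 'v set" where
  "cycles K n = {x \<in> vcarrier (chains K n). 1 \<le> n \<longrightarrow> bd K n x = vzero (chains K (n - 1))}"

definition boundaries :: "('k, 'v) complex_data \<Rightarrow> nat \<Rightarrow> 'v set" where
  "boundaries K n = bd K (n + 1) ` vcarrier (chains K (n + 1))"

definition homology :: "('k, 'v) complex_data \<Rightarrow> nat \<Rightarrow> ('k, 'v set) kspace" where
  "homology K n = quotient_space ((chains K n)\<lparr>vcarrier := cycles K n\<rparr>) (boundaries K n)"

definition homology_class :: "('k, 'v) complex_data \<Rightarrow> nat \<Rightarrow> 'v \<Rightarrow> 'v set" where
  "homology_class K n z = coset (chains K n) (boundaries K n) z"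

definition homology_map ::
  "('k, 'w) complex_data \<Rightarrow> (nat \<Rightarrow> 'v \<Rightarrow> 'w) \<Rightarrow> nat \<Rightarrow> 'v set \<Rightarrow> 'w set" where
  "homology_map L f n X = homology_class L n (f n (SOME z. z \<in> X))"

text \<open>\<open>f\<close> passes to homology: it sends cycles to cycles, and \<open>[z] \<mapsto> [f z]\<close> is a well-defined linear map.\<close>

definition induces_on_homology ::
  "('k, 'v) complex_data \<Rightarrow> ('k, 'w) complex_data \<Rightarrow> (nat \<Rightarrow> 'v \<Rightarrow> 'w) \<Rightarrow> bool" where
  "induces_on_homology K L f \<longleftrightarrow>
     (\<forall>n. linear_map (homology K n) (homology L n) (homology_map L f n) \<and>
          (\<forall>z\<in>cycles K n. f n z \<in> cycles L n \<and>
             homology_map L f n (homology_class K n z) = homology_class L n (f n z)))"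

text \<open>The Hochschild boundary \<open>b\<close> is \<open>alt_faces M n (n + 1)\<close>, and \<open>b'\<close>, which omits the last
  face, is \<open>alt_faces M n n\<close>.\<close>

definition alt_faces :: "('k::field, 'v) cyclic_data \<Rightarrow> nat \<Rightarrow> nat \<Rightarrow> 'v \<Rightarrow> 'v" where
  "alt_faces M n m x =
     vsum (level M (n - 1)) (\<lambda>i. vscale (level M (n - 1)) ((-1) ^ i) (face M n i x)) m"

definition hochschild_complex :: "('k::field, 'v) cyclic_data \<Rightarrow> ('k, 'v) complex_data" where
  "hochschild_complex M = \<lparr>chains = level M, bd = (\<lambda>n. alt_faces M n (n + 1))\<rparr>"

definition signed_cyc :: "('k::field, 'v) cyclic_data \<Rightarrow> nat \<Rightarrow> 'v \<Rightarrow> 'v" where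
  "signed_cyc M q x = vscale (level M q) ((-1) ^ q) (cyc M q x)"

definition one_minus_cyc :: "('k::field, 'v) cyclic_data \<Rightarrow> nat \<Rightarrow> 'v \<Rightarrow> 'v" where
  "one_minus_cyc M q x = vadd (level M q) x (vscale (level M q) (-1) (signed_cyc M q x))"

definition cyc_norm :: "('k::field, 'v) cyclic_data \<Rightarrow> nat \<Rightarrow> 'v \<Rightarrow> 'v" where
  "cyc_norm M q x = vsum (level M q) (\<lambda>i. (signed_cyc M q ^^ i) x) (q + 1)"

text \<open>
  Cyclic homology over a field of any characteristic: the homology of the total complex of
  Tsygan's bicomplex.  The entry in column \<open>p\<close> and row \<open>q\<close> is \<open>level M q\<close>; the vertical
  differential is \<open>b\<close> in even and \<open>-b'\<close> in odd columns, the horizontal one is \<open>1 - t\<close> from odd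
  to even columns and the norm from even to odd columns.  An element of total degree \<open>n\<close> is a
  family indexed by the row \<open>q \<le> n\<close>, its column being \<open>n - q\<close>.
\<close>

definition cyclic_chains :: "('k::field, 'v) cyclic_data \<Rightarrow> nat \<Rightarrow> ('k, nat \<Rightarrow> 'v) kspace" where
  "cyclic_chains M n =
     \<lparr>vcarrier = (\<Pi>\<^sub>E q\<in>{..n}. vcarrier (level M q)),
      vadd = (\<lambda>x y. \<lambda>q\<in>{..n}. vadd (level M q) (x q) (y q)),
      vzero = (\<lambda>q\<in>{..n}. vzero (level M q)),
      vscale = (\<lambda>c x. \<lambda>q\<in>{..n}. vscale (level M q) c (x q))\<rparr>"

definition cyclic_bd :: "('k::field, 'v) cyclic_data \<Rightarrow> nat \<Rightarrow> (nat \<Rightarrow> 'v) \<Rightarrow> (nat \<Rightarrow> 'v)" where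
  "cyclic_bd M n x = (\<lambda>q\<in>{..n - 1}.
     if even (n - 1 - q)
     then vadd (level M q) (alt_faces M (q + 1) (q + 2) (x (q + 1))) (one_minus_cyc M q (x q))
     else vadd (level M q) (vscale (level M q) (-1) (alt_faces M (q + 1) (q + 1) (x (q + 1))))
            (cyc_norm M q (x q)))"

definition cyclic_complex :: "('k::field, 'v) cyclic_data \<Rightarrow> ('k, nat \<Rightarrow> 'v) complex_data" where
  "cyclic_complex M = \<lparr>chains = cyclic_chains M, bd = cyclic_bd M\<rparr>"

definition total_map :: "(nat \<Rightarrow> 'v \<Rightarrow> 'w) \<Rightarrow> nat \<Rightarrow> (nat \<Rightarrow> 'v) \<Rightarrow> (nat \<Rightarrow> 'w)" where
  "total_map f n x = (\<lambda>q\<in>{..n}. f q (x q))"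


section \<open>The cyclic module of a Hopf algebroid with coefficients\<close>

text \<open>\<open>rel_C H P n\<close> presents \<open>P \<otimes> U \<otimes> \<dots> \<otimes> U\<close> (\<open>n\<close> factors \<open>U\<close>, balanced over the opposite
  of \<open>A\<close>) as a quotient of the free vector space on pairs of an element of \<open>P\<close> and a list of length \<open>n\<close>.\<close>

definition rel_C ::
  "('k::field, 'u::{ring,monoid_mult}, 'a) hopf_algebroid_data \<Rightarrow>
   ('k, 'u, 'a, 'p::ab_group_add) sayd_data \<Rightarrow> nat \<Rightarrow> ('p \<times> 'u list \<Rightarrow>\<^sub>0 'k) set" where
  "rel_C H P n = fspan (
     multilin_rels (psc P) (usc H) n \<union>
     {gen (ract P p (tgt H a), [u] @ us) - gen (p, [tgt H a * u] @ us) | p a u us. 1 + length us = n} \<union>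
     {gen (p, vs @ [u * tgt H a, v] @ ws) - gen (p, vs @ [u, tgt H a * v] @ ws)
        | p vs u a v ws. length vs + 2 + length ws = n})"

definition C_space ::
  "('k::field, 'u::{ring,monoid_mult}, 'a) hopf_algebroid_data \<Rightarrow>
   ('k, 'u, 'a, 'p::ab_group_add) sayd_data \<Rightarrow> nat \<Rightarrow> ('k, ('p \<times> 'u list \<Rightarrow>\<^sub>0 'k) set) kspace" where
  "C_space H P n = quotient_space (free_space {(p, us). length us = n}) (rel_C H P n)"

text \<open>List positions are counted from 0: \<open>us ! (j - 1)\<close> is \<open>u\<^sup>j\<close>.\<close>

definition face_gen ::
  "('k::field, 'u::{ring,monoid_mult}, 'a) hopf_algebroid_data \<Rightarrow>
   ('k, 'u, 'a, 'p) sayd_data \<Rightarrow> nat \<Rightarrow> nat \<Rightarrow> 'p \<times> 'u list \<Rightarrow> 'p \<times> 'u list" where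
  "face_gen H P n i = (\<lambda>(p, us).
     if i = 0 then
       (if n = 1 then (ract P p (tgt H (counit H (us ! 0))), [])
        else (p, take (n - 2) us @ [us ! (n - 2) * tgt H (counit H (us ! (n - 1)))]))
     else if i = n then (ract P p (us ! 0), tl us)
     else (p, take (n - i - 1) us @ [us ! (n - i - 1) * us ! (n - i)] @ drop (n - i + 1) us))"

definition degen_gen :: "nat \<Rightarrow> nat \<Rightarrow> 'p \<times> 'u::monoid_mult list \<Rightarrow> 'p \<times> 'u list" where
  "degen_gen n i = (\<lambda>(p, us). (p, take (n - i) us @ [1] @ drop (n - i) us))"

text \<open>\<open>plus_minus H [u\<^sup>1, \<dots>, u\<^sup>n]\<close> is \<open>([u\<^sup>1\<^sub>+, \<dots>, u\<^sup>n\<^sub>+], u\<^sup>n\<^sub>- \<cdots> u\<^sup>1\<^sub>-)\<close>, summation understood.\<close>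

primrec plus_minus ::
  "('k::field, 'u::{ring,monoid_mult}, 'a) hopf_algebroid_data \<Rightarrow> 'u list \<Rightarrow> ('u list \<times> 'u \<Rightarrow>\<^sub>0 'k)" where
  "plus_minus H [] = gen ([], 1)"
| "plus_minus H (u # us) =
     sw (translation H u) (\<lambda>(up, um).
       lin_ext fscale (\<lambda>(vs, m). gen (up # vs, m * um)) (plus_minus H us))"

definition cyc_gen ::
  "('k::field, 'u::{ring,monoid_mult}, 'a) hopf_algebroid_data \<Rightarrow>
   ('k, 'u, 'a, 'p) sayd_data \<Rightarrow> nat \<Rightarrow> 'p \<times> 'u list \<Rightarrow> ('p \<times> 'u list \<Rightarrow>\<^sub>0 'k)" where
  "cyc_gen H P n = (\<lambda>(p, us).
     if n = 0 then gen (p, us)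
     else sw (pcoact P p) (\<lambda>(q, p0).
            lin_ext fscale (\<lambda>(vs, m). gen (ract P p0 (hd vs), tl vs @ [m * q])) (plus_minus H us)))"

definition hopf_cyclic ::
  "('k::field, 'u::{ring,monoid_mult}, 'a) hopf_algebroid_data \<Rightarrow>
   ('k, 'u, 'a, 'p::ab_group_add) sayd_data \<Rightarrow> ('k, ('p \<times> 'u list \<Rightarrow>\<^sub>0 'k) set) cyclic_data" where
  "hopf_cyclic H P =
     \<lparr>level = C_space H P,
      face = (\<lambda>n i X. cls (rel_C H P (n - 1)) (sw X (\<lambda>x. gen (face_gen H P n i x)))),
      degen = (\<lambda>n i X. cls (rel_C H P (n + 1)) (sw X (\<lambda>x. gen (degen_gen n i x)))),
      cyc = (\<lambda>n X. cls (rel_C H P n) (sw X (cyc_gen H P n)))\<rparr>"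

definition Omega_gen ::
  "('d \<Rightarrow> 'p \<Rightarrow> 'p2) \<Rightarrow> ('c \<Rightarrow> 'u \<Rightarrow> 'u2) \<Rightarrow> 'p \<times> 'u list \<Rightarrow> 'd \<times> 'c list \<Rightarrow> 'p2 \<times> 'u2 list" where
  "Omega_gen Om Psi = (\<lambda>(p, us) (y0, xs). (Om y0 p, map2 Psi xs us))"

definition Omega_map ::
  "('k::field, 'c::ab_group_add) coalgebra_data \<Rightarrow> ('k, 'c, 'd::ab_group_add) comodule_data \<Rightarrow>
   ('k, 'u2::{ring,monoid_mult}, 'a2) hopf_algebroid_data \<Rightarrow>
   ('k, 'u2, 'a2, 'p2::ab_group_add) sayd_data \<Rightarrow>
   ('c \<Rightarrow> 'u \<Rightarrow> 'u2) \<Rightarrow> ('d \<Rightarrow> 'p \<Rightarrow> 'p2) \<Rightarrow> 'd \<Rightarrow> nat \<Rightarrow>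
   ('p \<times> 'u list \<Rightarrow>\<^sub>0 'k) set \<Rightarrow> ('p2 \<times> 'u2 list \<Rightarrow>\<^sub>0 'k) set" where
  "Omega_map C D H' P' Psi Om y n X =
     cls (rel_C H' P' n)
       (sw X (\<lambda>x. sw (iter_coact C D n y) (\<lambda>z. gen (Omega_gen Om Psi x z))))"

end

theory Submission
  imports Defs
begin

text \<open>
  Over a field, a congruence modulo a space of tensor relations can be tested by the scalar forms
  that vanish on the relations, so every Sweedler identity becomes an identity between iterated
  finite sums in \<open>k\<close>, which may be interchanged freely.  The antipode axioms give
  \<open>u\<^sub>+ \<otimes> u\<^sub>- = S(S(u)\<^sub>2) \<otimes> S(u)\<^sub>1\<close>, from which the well-definedness of the cyclic operator and its
  compatibility with measurings are read off: since \<open>\<Psi>\<close> commutes with \<open>S\<close> and \<open>\<Delta>\<close>, measuring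
  commutes with the translation map up to the order of the tensor factors in \<open>C\<close>, which is
  irrelevant by cocommutativity.
\<close>

section \<open>Scalar forms on free vector spaces\<close>

text \<open>The obstacle is that \<open>sweedler\<close> sums over one chosen representative.
  Interchanging two such sums is harmless, but replacing a coset by another presentation, or using
  additivity in the element that is comultiplied, is allowed only for forms that respect the tensor
  relations. Hence most of the work consists of proofs that forms are \<open>balanced\<close>; the
  Hopf-algebraic computations themselves are short. For the same reason operators are studied
  through pullback of forms: an operator given on generators descends to the chain spaces once it
  pulls forms killing the target relations back to forms killing the source relations, and operators
  agree when their pullbacks do. Tensors with arbitrarily many factors are handled by recursion on
  the form: \<open>twist\<close> and \<open>mlist\<close> take the form as an argument and feed it
  one entry at a time, so that the laws of a single factor (\<open>translation\<close>,
  \<open>mstep\<close>) extend by induction. The heart is \<open>mlist_twist\<close>, where the u_-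
  are multiplied in the order opposite to that of the entries, so that the C-legs of the iterated
  coaction have to be permuted.\<close>

definition linear_form :: "('k::field \<Rightarrow> 'v::ab_group_add \<Rightarrow> 'v) \<Rightarrow> ('v \<Rightarrow> 'k) \<Rightarrow> bool" where
  "linear_form s f \<longleftrightarrow> (\<forall>x y. f (x + y) = f x + f y) \<and> (\<forall>c x. f (s c x) = c * f x)"

abbreviation pairing :: "('x \<Rightarrow>\<^sub>0 'k::field) \<Rightarrow> ('x \<Rightarrow> 'k) \<Rightarrow> 'k" where
  "pairing r f \<equiv> lin_ext (*) f r"

text \<open>When \<open>f\<close> annihilates the relations \<open>W\<close>, \<open>ev X f\<close>
  is the value at the coset \<open>X\<close> of the functional that \<open>f\<close> induces on the
  quotient. For other \<open>f\<close> it depends on the representative chosen inside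
  \<open>sweedler\<close>.\<close>

abbreviation ev :: "('x \<Rightarrow>\<^sub>0 'k::field) set \<Rightarrow> ('x \<Rightarrow> 'k) \<Rightarrow> 'k" where
  "ev \<equiv> sweedler (*)"

definition annihilates :: "('x \<Rightarrow>\<^sub>0 'k::field) set \<Rightarrow> ('x \<Rightarrow> 'k) \<Rightarrow> bool" where
  "annihilates W f \<longleftrightarrow> (\<forall>w\<in>W. pairing w f = 0)"

lemma linear_formI:
  "\<lbrakk>\<And>x y. f (x + y) = f x + f y; \<And>c x. f (s c x) = c * f x\<rbrakk> \<Longrightarrow> linear_form s f"
  by (simp add: linear_form_def)

lemma linear_form_add: "linear_form s f \<Longrightarrow> f (x + y) = f x + f y"
  and linear_form_scale: "linear_form s f \<Longrightarrow> f (s c x) = c * f x"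
  by (simp_all add: linear_form_def)

lemma linear_form_zero: "linear_form s f \<Longrightarrow> f 0 = 0"
  proof -
  assume "linear_form s f"
  then have "f (0 + 0) = f 0 + f 0" by (rule linear_form_add)
  then have "f 0 + 0 = f 0 + f 0" by (simp only: add.right_neutral)
  then show "f 0 = 0" by (simp only: add_left_cancel)
qed

lemma linear_form_compose:
  assumes "Vector_Spaces.linear s s' g" and "linear_form s' f"
  shows "linear_form s (\<lambda>x. f (g x))"
  using assms by (simp add: linear_form_def Vector_Spaces.linear_iff)

lemma lookup_fscale [simp]: "Poly_Mapping.lookup (fscale c r) x = c * Poly_Mapping.lookup r x"
  by (simp add: fscale_def map.rep_eq when_def)

lemma vector_space_fscale: "vector_space (fscale :: 'k::field \<Rightarrow> ('x \<Rightarrow>\<^sub>0 'k) \<Rightarrow> _)"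
  by unfold_locales (auto intro!: poly_mapping_eqI simp: lookup_add algebra_simps)

lemma keys_fscale: "Poly_Mapping.keys (fscale c r) \<subseteq> Poly_Mapping.keys r"
  by (auto simp: in_keys_iff)

interpretation free: vector_space "fscale :: 'k::field \<Rightarrow> ('x \<Rightarrow>\<^sub>0 'k) \<Rightarrow> _"
  by (rule vector_space_fscale)

lemma lin_ext_superset:
  assumes "vector_space sc" "finite S" "Poly_Mapping.keys r \<subseteq> S"
  shows "lin_ext sc f r = (\<Sum>x\<in>S. sc (Poly_Mapping.lookup r x) (f x))"
proof -
  interpret vector_space sc by fact
  show ?thesis
    unfolding lin_ext_def using assms
    by (intro sum.mono_neutral_left) (auto simp: in_keys_iff)
qed

lemma vector_space_mult: "vector_space ((*) :: 'k::field \<Rightarrow> 'k \<Rightarrow> 'k)"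
  by unfold_locales (auto simp: algebra_simps)

lemma lin_ext_add:
  assumes "vector_space sc"
  shows "lin_ext sc f (r + r') = lin_ext sc f r + lin_ext sc f r'"
proof -
  interpret vector_space sc by fact
  let ?S = "Poly_Mapping.keys r \<union> Poly_Mapping.keys r'"
  have "Poly_Mapping.keys (r + r') \<subseteq> ?S" by (rule keys_add)
  then show ?thesis
    using assms
    by (simp add: lin_ext_superset[of sc ?S] lookup_add scale_left_distrib sum.distrib)
qed

lemma lin_ext_fscale:
  assumes "vector_space sc"
  shows "lin_ext sc f (fscale c r) = sc c (lin_ext sc f r)"
proof -
  interpret vector_space sc by fact
  let ?S = "Poly_Mapping.keys r"
  show ?thesis
    using assms keys_fscale[of c r]
    by (simp add: lin_ext_superset[of sc ?S] scale_sum_right)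
qed

lemma lin_ext_gen:
  assumes "vector_space sc"
  shows "lin_ext sc f (gen x) = f x"
proof -
  interpret vector_space sc by fact
  show ?thesis by (simp add: lin_ext_def)
qed

lemmas pairing_add [simp] = lin_ext_add[OF vector_space_mult]
  and pairing_fscale [simp] = lin_ext_fscale[OF vector_space_mult]
  and pairing_gen [simp] = lin_ext_gen[OF vector_space_mult]

lemma pairing_zero [simp]: "pairing 0 f = 0"
  by (simp add: lin_ext_def)

lemma pairing_uminus [simp]: "pairing (- r) f = - pairing r f"
  using pairing_fscale[of f "-1" r] by simp

lemma pairing_diff [simp]: "pairing (r - r') f = pairing r f - pairing r' f"
  using pairing_add[of f r "- r'"] by simp

lemma pairing_cong:
  "(\<And>x. x \<in> Poly_Mapping.keys r \<Longrightarrow> f x = g x) \<Longrightarrow> pairing r f = pairing r g"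
  by (simp add: lin_ext_def)

lemma pairing_lin_ext:
  fixes g :: "'b \<Rightarrow> 'c \<Rightarrow>\<^sub>0 'a::field"
  shows
  "pairing (lin_ext fscale g r) f = pairing r (\<lambda>x. pairing (g x) f)"
proof -
  have "pairing (sum h S) f = (\<Sum>x\<in>S. pairing (h x) f)" for h :: "'b \<Rightarrow> 'c \<Rightarrow>\<^sub>0 'a" and S
    by (induction S rule: infinite_finite_induct) auto
  then show ?thesis by (simp add: lin_ext_def[of fscale] lin_ext_def[of "(*)" _ r])
qed

lemma pairing_add_right: "pairing r (\<lambda>x. f x + g x) = pairing r f + pairing r g"
  by (simp add: lin_ext_def distrib_left sum.distrib)

lemma pairing_mult_right: "pairing r (\<lambda>x. c * f x) = c * pairing r f"
  by (simp add: lin_ext_def sum_distrib_left mult.left_commute)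

lemma pairing_swap:
  "pairing r (\<lambda>x. pairing r' (f x)) = pairing r' (\<lambda>y. pairing r (\<lambda>x. f x y))"
  by (simp add: lin_ext_def sum_distrib_left mult.left_commute)
    (rule sum.swap)

lemma ev_cong: "(\<And>x. f x = g x) \<Longrightarrow> ev X f = ev X g"
  by presburger

text \<open>No condition on the functions is needed: each \<open>ev\<close> is a finite sum over one
  fixed representative, and \<open>X\<close>, \<open>Y\<close> do not depend on the summation
  variables.\<close>

lemma ev_add_right: "ev X (\<lambda>x. f x + g x) = ev X f + ev X g"
  and ev_mult_right: "ev X (\<lambda>x. c * f x) = c * ev X f"
  and ev_swap: "ev X (\<lambda>x. ev Y (h x)) = ev Y (\<lambda>y. ev X (\<lambda>x. h x y))"
  by (simp_all add: sweedler_def pairing_add_right pairing_mult_right pairing_swap[where f = h])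

lemma pairing_sw: "pairing (sw X g) f = ev X (\<lambda>x. pairing (g x) f)"
  by (simp add: sweedler_def pairing_lin_ext)

text \<open>The parameter \<open>v\<close> enters through the form; the coset \<open>X\<close> stays
  fixed. \<open>linear_map_form\<close> treats the case in which the coset varies.\<close>

lemma linear_form_ev:
  "(\<And>x. linear_form s (\<lambda>v. f v x)) \<Longrightarrow> linear_form s (\<lambda>v. ev X (f v))"
  by (simp add: linear_form_def cong: ev_cong) (simp add: ev_add_right ev_mult_right)

lemma linear_form_ev_prod:
  "(\<And>x y. linear_form s (\<lambda>v. f v x y)) \<Longrightarrow> linear_form s (\<lambda>v. ev X (\<lambda>(x, y). f v x y))"
  by (rule linear_form_ev) (simp add: case_prod_unfold)

lemma linear_form_sweedler:
  assumes "linear_form sc f" and "vector_space sc"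
  shows "f (sweedler sc X g) = ev X (\<lambda>x. f (g x))"
proof -
  have "f (sum h S) = (\<Sum>x\<in>S. f (h x))" for h and S :: "'c set"
    using assms(1)
    by (induction S rule: infinite_finite_induct) (auto simp: linear_form_add linear_form_zero)
  then show ?thesis
    using assms(1) by (simp add: sweedler_def lin_ext_def linear_form_scale)
qed

lemma linear_sweedler:
  fixes f :: "'x \<Rightarrow> 'v::ab_group_add"
  assumes "Vector_Spaces.linear sc sc' g"
  shows "g (sweedler sc X f) = sweedler sc' X (\<lambda>x. g (f x))"
proof -
  have add: "g (x + y) = g x + g y" and scale: "g (sc c x) = sc' c (g x)" for x y c
    using assms by (simp_all add: Vector_Spaces.linear_iff)
  have "g (0 + 0) = g 0 + g 0" by (rule add)
  then have "g 0 + 0 = g 0 + g 0" by (simp only: add.right_neutral)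
  then have "g 0 = 0" by (simp only: add_left_cancel)
  then have "g (sum h S) = (\<Sum>x\<in>S. g (h x))" for h and S :: "'x set"
    by (induction S rule: infinite_finite_induct) (auto simp: add)
  then show ?thesis by (simp add: sweedler_def lin_ext_def scale)
qed

lemma cls_eq: "cls W r = {r + w | w. w \<in> W}"
  by (simp add: cls_def coset_def free_space_def)

lemma mem_clsI: "0 \<in> W \<Longrightarrow> r \<in> cls W r"
  by (force simp: cls_eq)

lemma annihilates_member:
  "annihilates W f \<Longrightarrow> r' \<in> cls W r \<Longrightarrow> pairing r' f = pairing r f"
  by (auto simp: cls_eq annihilates_def)

lemma ev_cls:
  assumes "free.subspace W" and "annihilates W f"
  shows "ev (cls W r) f = pairing r f"
proof -
  have "r \<in> cls W r" by (simp add: mem_clsI assms(1) free.subspace_0)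
  then show ?thesis
    unfolding sweedler_def by (rule someI2) (rule annihilates_member[OF assms(2)])
qed

lemma annihilates_fspan: "annihilates (fspan G) f \<longleftrightarrow> (\<forall>g\<in>G. pairing g f = 0)"
proof
  assume G: "\<forall>g\<in>G. pairing g f = 0"
  have "fspan G \<subseteq> {w. pairing w f = 0}"
    using G by (intro free.span_minimal) (auto simp: free.subspace_def)
  then show "annihilates (fspan G) f" by (auto simp: annihilates_def)
qed (auto simp: annihilates_def free.span_base)

text \<open>A basis of \<open>W\<close> together with \<open>r\<close> is independent, so some
  functional is 1 at \<open>r\<close> and 0 on \<open>W\<close>; its values on generators are the
  required form. This is where the scalars have to be a field.\<close>

lemma separating_form:
  fixes r :: "'x \<Rightarrow>\<^sub>0 'k::field"
  assumes W: "free.subspace W" and r: "r \<notin> W"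
  obtains f where "annihilates W f" and "pairing r f \<noteq> 0"
proof -
  interpret vector_space_pair "fscale :: 'k \<Rightarrow> ('x \<Rightarrow>\<^sub>0 'k) \<Rightarrow> _" "(*) :: 'k \<Rightarrow> 'k \<Rightarrow> 'k"
    by (intro vector_space_pair.intro vector_space_fscale vector_space_mult)
  obtain B where B: "B \<subseteq> W" "\<not> free.dependent B" "W \<subseteq> free.span B"
    using free.maximal_independent_subset by metis
  have "free.span B \<subseteq> W" using B(1) W free.span_minimal by blast
  then have "\<not> free.dependent (insert r B)"
    using r B(2) by (intro free.independent_insertI) auto
  then obtain g where g: "Vector_Spaces.linear fscale (*) g"
      "\<forall>x\<in>insert r B. g x = (if x = r then 1 else 0)"
    using linear_independent_extend[of "insert r B" "\<lambda>x. if x = r then 1 else 0"] by blast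
  define h where "h x = g (gen x)" for x
  \<comment> \<open>A functional is determined by its values on generators; the induction adds one
    new key at a time.\<close>
  have g_pairing: "g w = pairing w h" for w
  proof (induction w rule: update_induct)
    case const
    have "g (fscale 0 0) = 0 * g 0"
      using g(1) unfolding Vector_Spaces.linear_iff by blast
    then show ?case by simp
  next
    case (update w a c)
    have "Poly_Mapping.update a c w = w + fscale c (gen a)"
      using update.hyps
      by (intro poly_mapping_eqI) (auto simp: lookup_add lookup_update lookup_single in_keys_iff)
    then show ?case using g(1) update.IH by (simp add: Vector_Spaces.linear_iff h_def)
  qed
  have "W \<subseteq> {w. g w = 0}"
  proof -
    have "free.span B \<subseteq> {w. g w = 0}"
    proof (rule free.span_minimal)
      have "r \<notin> B" using r B(1) by auto
      then show "B \<subseteq> {w. g w = 0}" using g(2) by auto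
      show "free.subspace {w. g w = 0}"
        by (simp add: free.subspace_def g_pairing)
    qed
    then show ?thesis using B(3) by blast
  qed
  then show thesis
    using that[of h] g(2) by (auto simp: annihilates_def simp flip: g_pairing)
qed

lemma cls_eqI:
  assumes W: "free.subspace W" and "\<And>f. annihilates W f \<Longrightarrow> pairing r f = pairing r' f"
  shows "cls W r = cls W r'"
proof -
  have *: "r - r' \<in> W"
  proof (rule ccontr)
    assume "r - r' \<notin> W"
    then obtain f where "annihilates W f" "pairing (r - r') f \<noteq> 0"
      by (rule separating_form[OF W])
    then show False using assms by simp
  qed
  have "r + w = r' + (w + (r - r'))" "r' + w = r + (w - (r - r'))" for w
    by simp_all
  then show ?thesis
    unfolding cls_eq using free.subspace_add[OF W _ *] free.subspace_diff[OF W _ *] by fast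
qed

lemma cls_eqD:
  assumes "free.subspace W" and "annihilates W f" and "cls W r = cls W r'"
  shows "pairing r f = pairing r' f"
  using ev_cls[OF assms(1,2), of r] ev_cls[OF assms(1,2), of r'] assms(3) by simp

text \<open>Version for sets that are merely known to be cosets, whose representatives are those
  chosen by \<open>ev\<close>.\<close>

lemma cls_eq_clsI:
  assumes "free.subspace W" and "X \<in> range (cls W)" and "Y \<in> range (cls W)"
    and "\<And>f. annihilates W f \<Longrightarrow> ev X f = ev Y f"
  shows "X = Y"
proof -
  obtain r r' where "X = cls W r" and "Y = cls W r'"
    using assms(2,3) by blast
  with assms(1,4) show ?thesis by (auto simp: ev_cls intro!: cls_eqI)
qed

section \<open>Operations and cosets in quotients of free vector spaces\<close>

lemma quotient_add:
  assumes W: "free.subspace W"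
  shows "vadd (quotient_space (free_space B) W) (cls W r) (cls W r') =
    cls W (r + r')"
proof -
  have "\<exists>v. r + v1 + (r' + v2) = r + r' + v \<and> v \<in> W"
    if "v1 \<in> W" "v2 \<in> W" for v1 v2
    using that by (intro exI[of _ "v1 + v2"]) (simp add: W free.subspace_add algebra_simps)
  moreover have "\<exists>x y. r + r' + v = x + y \<and> (\<exists>w. x = r + w \<and> w \<in> W) \<and> (\<exists>w. y = r' + w \<and> w \<in> W)"
    if "v \<in> W" for v
    using that by (intro exI[of _ "r + v"] exI[of _ "r' + 0"]) (auto simp: W free.subspace_0 algebra_simps)
  ultimately show ?thesis
    by (auto simp: quotient_space_def free_space_def cls_eq)
qed

lemma quotient_scale:
  assumes W: "free.subspace W"
  shows "vscale (quotient_space (free_space B) W) c (cls W r) =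
    cls W (fscale c r)"
proof -
  have "\<exists>v. fscale c (r + v1) + v2 = fscale c r + v \<and> v \<in> W"
    if "v1 \<in> W" "v2 \<in> W" for v1 v2
    using that
    by (intro exI[of _ "fscale c v1 + v2"])
      (simp add: W free.subspace_add free.subspace_scale free.scale_right_distrib algebra_simps)
  moreover have "\<exists>x w. fscale c r + v = fscale c x + w \<and> (\<exists>w. x = r + w \<and> w \<in> W) \<and> w \<in> W"
    if "v \<in> W" for v
    using that by (intro exI[of _ "r + 0"] exI[of _ v]) (auto simp: W free.subspace_0)
  ultimately show ?thesis
    by (auto simp: quotient_space_def free_space_def cls_eq)
qed

lemma quotient_zero: "vzero (quotient_space (free_space B) W) = cls W 0"
  by (auto simp: quotient_space_def cls_eq)

text \<open>\<open>B\<close> restricts the carrier only; sums, scalings and cosets are those of the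
  whole free space.\<close>

lemma coset_free_space: "coset (free_space B) W = cls W"
  by (simp add: fun_eq_iff cls_def coset_def free_space_def)

lemma quotient_carrier:
  "vcarrier (quotient_space (free_space B) W) = cls W ` {r. Poly_Mapping.keys r \<subseteq> B}"
  by (simp add: quotient_space_def coset_free_space) (simp add: free_space_def)

lemma linear_map_range:
  assumes "linear_map (whole_space s) (tensor2 W) d"
  shows "d x \<in> range (cls W)"
  using assms by (auto simp: linear_map_def tensor2_def whole_space_def quotient_carrier)

text \<open>The coset varies with \<open>x\<close>, and the representatives chosen for
  \<open>d x\<close>, \<open>d y\<close> and \<open>d (x + y)\<close> are unrelated. Linearity holds
  because the pairing with \<open>f\<close> is constant on cosets of \<open>W\<close>.\<close>

lemma linear_map_form:
  assumes W: "free.subspace W" and d: "linear_map (whole_space s) (tensor2 W) d" and f: "annihilates W f"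
  shows "linear_form s (\<lambda>x. ev (d x) f)"
proof (rule linear_formI)
  fix x y c
  obtain r r' where r: "d x = cls W r" "d y = cls W r'"
    using linear_map_range[OF d] by blast
  have "d (x + y) = cls W (r + r')" "d (s c x) = cls W (fscale c r)"
    using d r W by (simp_all add: linear_map_def tensor2_def whole_space_def quotient_add quotient_scale)
  then show "ev (d (x + y)) f = ev (d x) f + ev (d y) f" "ev (d (s c x)) f = c * ev (d x) f"
    using r f W by (simp_all add: ev_cls)
qed

section \<open>Balanced bilinear forms as functionals on tensor products\<close>

definition balanced ::
  "('k::field \<Rightarrow> 'x::ab_group_add \<Rightarrow> 'x) \<Rightarrow> ('k \<Rightarrow> 'y::ab_group_add \<Rightarrow> 'y) \<Rightarrow>
   ('a \<Rightarrow> 'x \<Rightarrow> 'x) \<Rightarrow> ('a \<Rightarrow> 'y \<Rightarrow> 'y) \<Rightarrow> ('x \<Rightarrow> 'y \<Rightarrow> 'k) \<Rightarrow> bool" where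
  "balanced sx sy rx ly b \<longleftrightarrow>
     (\<forall>y. linear_form sx (\<lambda>x. b x y)) \<and> (\<forall>x. linear_form sy (b x)) \<and>
     (\<forall>a x y. b (rx a x) y = b x (ly a y))"

lemma subspace_rel2 [simp]: "free.subspace (rel2 sx sy rx ly)"
  and subspace_rel3 [simp]: "free.subspace (rel3 sx sy sz rx ly ry lz)"
  by (simp_all add: rel2_def rel3_def)

text \<open>Turns the generator families of the relation spaces into universally quantified
  equations, one rule per number of bound variables.\<close>

lemma ball_setcompr:
  "(\<forall>g\<in>{f2 x y | x y. C2 x y}. Q g) \<longleftrightarrow> (\<forall>x y. C2 x y \<longrightarrow> Q (f2 x y))"
  "(\<forall>g\<in>{f3 x y z | x y z. C3 x y z}. Q g) \<longleftrightarrow> (\<forall>x y z. C3 x y z \<longrightarrow> Q (f3 x y z))"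
  "(\<forall>g\<in>{f4 x y z w | x y z w. C4 x y z w}. Q g) \<longleftrightarrow>
     (\<forall>x y z w. C4 x y z w \<longrightarrow> Q (f4 x y z w))"
  "(\<forall>g\<in>{f5 x y z w v | x y z w v. C5 x y z w v}. Q g) \<longleftrightarrow>
     (\<forall>x y z w v. C5 x y z w v \<longrightarrow> Q (f5 x y z w v))"
  "(\<forall>g\<in>{f6 x y z w v u | x y z w v u. C6 x y z w v u}. Q g) \<longleftrightarrow>
     (\<forall>x y z w v u. C6 x y z w v u \<longrightarrow> Q (f6 x y z w v u))"
  by blast+

text \<open>Universal property of the balanced tensor product, expressed for scalar-valued
  forms.\<close>

lemma annihilates_rel2:
  "annihilates (rel2 sx sy rx ly) f \<longleftrightarrow> balanced sx sy rx ly (\<lambda>x y. f (x, y))"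
  unfolding rel2_def annihilates_fspan balanced_def linear_form_def ball_Un ball_setcompr
    pairing_diff pairing_gen pairing_fscale
  by (auto simp: algebra_simps)

lemma annihilates_rel3:
  "annihilates (rel3 sx sy sz rx ly ry lz) f \<longleftrightarrow>
     (\<forall>z. balanced sx sy rx ly (\<lambda>x y. f (x, y, z))) \<and> (\<forall>x. balanced sy sz ry lz (\<lambda>y z. f (x, y, z)))"
  unfolding rel3_def annihilates_fspan balanced_def linear_form_def ball_Un ball_setcompr
    pairing_diff pairing_gen pairing_fscale
  by (auto simp: algebra_simps)

lemma balancedI:
  assumes "\<And>y. linear_form sx (\<lambda>x. b x y)" and "\<And>x. linear_form sy (b x)"
    and "\<And>a x y. b (rx a x) y = b x (ly a y)"
  shows "balanced sx sy rx ly b"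
  using assms by (simp add: balanced_def)

lemma balanced_left: "balanced sx sy rx ly b \<Longrightarrow> linear_form sx (\<lambda>x. b x y)"
  and balanced_right: "balanced sx sy rx ly b \<Longrightarrow> linear_form sy (b x)"
  and balanced_shift: "balanced sx sy rx ly b \<Longrightarrow> b (rx a x) y = b x (ly a y)"
  by (simp_all add: balanced_def)

lemma balanced_compose:
  assumes "balanced sx sy rx ly b"
    and "\<And>h. linear_form sx h \<Longrightarrow> linear_form sx' (\<lambda>x. h (f x))"
    and "\<And>h. linear_form sy h \<Longrightarrow> linear_form sy' (\<lambda>y. h (g y))"
    and "\<And>a x y. b (f (rx' a x)) (g y) = b (f x) (g (ly' a y))"
  shows "balanced sx' sy' rx' ly' (\<lambda>x y. b (f x) (g y))"
proof (rule balancedI)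
  show "linear_form sx' (\<lambda>x. b (f x) (g y))" for y
    by (rule assms(2)[of "\<lambda>x. b x (g y)"]) (rule balanced_left[OF assms(1)])
  show "linear_form sy' (\<lambda>y. b (f x) (g y))" for x
    by (rule assms(3)[of "b (f x)"]) (rule balanced_right[OF assms(1)])
qed (rule assms(4))

section \<open>The translation map of a Hopf algebroid\<close>

context hopf_algebroid
begin

abbreviation balanced_UU :: "('u \<Rightarrow> 'u \<Rightarrow> 'k) \<Rightarrow> bool" where
  "balanced_UU \<equiv> balanced (usc H) (usc H) (\<lambda>a u. tgt H a * u) (\<lambda>a u. src H a * u)"

abbreviation balanced_UUop :: "('u \<Rightarrow> 'u \<Rightarrow> 'k) \<Rightarrow> bool" where
  "balanced_UUop \<equiv> balanced (usc H) (usc H) (\<lambda>a u. u * tgt H a) (\<lambda>a u. tgt H a * u)"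

lemma usc_mult: "usc H c x * y = usc H c (x * y)" "x * usc H c y = usc H c (x * y)"
  using U_algebra by (simp_all add: algebra_over_def)

lemma linear_form_mult_left: "linear_form (usc H) f \<Longrightarrow> linear_form (usc H) (\<lambda>u. f (v * u))"
  and linear_form_mult_right: "linear_form (usc H) f \<Longrightarrow> linear_form (usc H) (\<lambda>u. f (u * v))"
  by (simp_all add: linear_form_def usc_mult distrib_left distrib_right)

lemma linear_form_antipode: "linear_form (usc H) f \<Longrightarrow> linear_form (usc H) (\<lambda>u. f (antipode H u))"
  by (rule linear_form_compose[OF antipode_linear])

lemma antipode_src: "antipode H (src H a) = tgt H a"
  by (metis antipode_involutive antipode_tgt)

lemma balanced_mult_right:
  assumes b: "balanced_UU b"
  shows "balanced_UU (\<lambda>x y. b (x * v) (y * w))"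
  by (rule balanced_compose[OF b])
    (auto intro: linear_form_mult_right simp: mult.assoc balanced_shift[OF b])

lemma balanced_mult_left:
  assumes b: "balanced_UU b"
  shows "balanced_UU (\<lambda>x y. b (src H a * x) (tgt H a' * y))"
proof (rule balanced_compose[OF b])
  fix c x y
  have "src H a * (tgt H c * x) = tgt H c * (src H a * x)"
    and "src H c * (tgt H a' * y) = tgt H a' * (src H c * y)"
    by (simp_all add: src_tgt_commute flip: mult.assoc)
  then show "b (src H a * (tgt H c * x)) (tgt H a' * y) = b (src H a * x) (tgt H a' * (src H c * y))"
    by (metis balanced_shift[OF b])
qed (auto intro: linear_form_mult_left)

lemma comult_form:
  assumes "balanced_UU b"
  shows "linear_form (usc H) (\<lambda>u. ev (comult H u) (\<lambda>(x, y). b x y))"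
  by (rule linear_map_form[OF _ comult_linear]) (simp_all add: annihilates_rel2 assms)

lemma comult_bimodule_form:
  assumes "balanced_UU b"
  shows "ev (comult H (src H a * tgt H a' * u)) (\<lambda>(x, y). b x y) =
    ev (comult H u) (\<lambda>(x, y). b (src H a * x) (tgt H a' * y))"
  unfolding comult_bimodule
  by (simp add: ev_cls annihilates_rel2 assms pairing_sw case_prod_unfold)

lemma comult_src_form:
  "balanced_UU b \<Longrightarrow> ev (comult H (src H a * u)) (\<lambda>(x, y). b x y) =
    ev (comult H u) (\<lambda>(x, y). b (src H a * x) y)"
  using comult_bimodule_form[of b a 1 u] by (simp add: tgt_one)

lemma takeuchi_form:
  assumes "balanced_UU b"
  shows "ev (comult H u) (\<lambda>(x, y). b (x * tgt H a) y) = ev (comult H u) (\<lambda>(x, y). b x (y * src H a))"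
  using cls_eqD[OF _ _ comult_takeuchi, of "\<lambda>(x, y). b x y" u a] assms
  by (simp add: annihilates_rel2 pairing_sw case_prod_unfold)

lemma comult_mult_form:
  assumes "balanced_UU b"
  shows "ev (comult H (u * v)) (\<lambda>(x, y). b x y) =
    ev (comult H u) (\<lambda>(x, y). ev (comult H v) (\<lambda>(x', y'). b (x * x') (y * y')))"
  unfolding comult_mult
  by (simp add: ev_cls annihilates_rel2 assms pairing_sw case_prod_unfold)

lemma comult_one_form: "balanced_UU b \<Longrightarrow> ev (comult H 1) (\<lambda>(x, y). b x y) = b 1 1"
  unfolding comult_one by (simp add: ev_cls annihilates_rel2)

text \<open>\<Delta> is multiplicative, and s(a)t(a') = s(a)t(a')1 has coproduct s(a) \<otimes>
  t(a'). Substituting this coproduct requires \<open>?c\<close>, the pairing with \<Delta>(u) as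
  left factor, to be balanced, and that is the Takeuchi condition.\<close>

lemma comult_mult_bimodule_form:
  assumes b: "balanced_UU b"
  shows "ev (comult H (u * (src H a * tgt H a'))) (\<lambda>(x, y). b x y) =
    ev (comult H u) (\<lambda>(x, y). b (x * src H a) (y * tgt H a'))"
proof -
  let ?c = "\<lambda>x' y'. ev (comult H u) (\<lambda>(x, y). b (x * x') (y * y'))"
  have c: "balanced_UU ?c"
  proof (rule balancedI)
    fix a x' y'
    show "?c (tgt H a * x') y' = ?c x' (src H a * y')"
      using takeuchi_form[OF balanced_mult_right[OF b, of x' y'], of u a] by (simp add: mult.assoc)
  next
    show "linear_form (usc H) (\<lambda>x'. ?c x' y')" for y'
      using b by (intro linear_form_ev)
        (auto simp: case_prod_unfold intro: linear_form_mult_left[of "\<lambda>x. b x _"] balanced_left)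
    show "linear_form (usc H) (?c x')" for x'
      using b by (intro linear_form_ev)
        (auto simp: case_prod_unfold intro: linear_form_mult_left[of "b _"] balanced_right)
  qed
  have "ev (comult H (u * (src H a * tgt H a'))) (\<lambda>(x, y). b x y) =
      ev (comult H (src H a * tgt H a')) (\<lambda>(x', y'). ?c x' y')"
    unfolding comult_mult_form[OF b] by (simp add: case_prod_unfold) (rule ev_swap)
  also have "\<dots> = ?c (src H a) (tgt H a')"
    using comult_bimodule_form[OF c, of a a' 1] comult_one_form[OF balanced_mult_left[OF c]]
    by simp
  finally show ?thesis .
qed

lemma comult_mult_src_form:
  "balanced_UU b \<Longrightarrow> ev (comult H (u * src H a)) (\<lambda>(x, y). b x y) =
    ev (comult H u) (\<lambda>(x, y). b (x * src H a) y)"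
  using comult_mult_bimodule_form[of b u a 1] by (simp add: tgt_one)

lemma comult_mult_tgt_form:
  "balanced_UU b \<Longrightarrow> ev (comult H (u * tgt H a)) (\<lambda>(x, y). b x y) =
    ev (comult H u) (\<lambda>(x, y). b x (y * tgt H a))"
  using comult_mult_bimodule_form[of b u 1 a] by (simp add: src_one)

section \<open>The canonical map \<beta> and its inverse\<close>

lemma hopf_beta_form:
  "balanced_UU b \<Longrightarrow> ev (hopf_beta H X) (\<lambda>(x, y). b x y) =
    ev X (\<lambda>(u, v). ev (comult H u) (\<lambda>(x, y). b x (y * v)))"
  unfolding hopf_beta_def
  by (simp add: ev_cls annihilates_rel2 pairing_sw case_prod_unfold)

text \<open>\<beta> respects ut(a) \<otimes> v = u \<otimes> t(a)v because \<Delta>(ut(a)) = u_1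
  \<otimes> u_2 t(a).\<close>

lemma balanced_beta:
  assumes b: "balanced_UU b"
  shows "balanced_UUop (\<lambda>u v. ev (comult H u) (\<lambda>(x, y). b x (y * v)))"
proof (rule balancedI)
  fix a u v
  have bv: "balanced_UU (\<lambda>x y. b x (y * v))" for v
    using balanced_mult_right[OF b, of 1 v] by simp
  show "linear_form (usc H) (\<lambda>u. ev (comult H u) (\<lambda>(x, y). b x (y * v)))"
    by (rule comult_form[OF bv])
  show "linear_form (usc H) (\<lambda>v. ev (comult H u) (\<lambda>(x, y). b x (y * v)))"
    using b by (intro linear_form_ev)
      (auto simp: case_prod_unfold intro: linear_form_mult_left[of "b _"] balanced_right)
  show "ev (comult H (u * tgt H a)) (\<lambda>(x, y). b x (y * v)) =
      ev (comult H u) (\<lambda>(x, y). b x (y * (tgt H a * v)))"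
    by (simp add: comult_mult_tgt_form[OF bv] mult.assoc)
qed

text \<open>The inverse of \<open>\<beta>\<close> is \<open>u \<otimes> v \<mapsto> S(S(u)\<^sub>2) \<otimes> S(u)\<^sub>1 v\<close>; the two antipode axioms say
  that it is a left and a right inverse.\<close>

lemma balanced_op_antipode:
  assumes b: "balanced_UUop b"
  shows "balanced_UU (\<lambda>x y. b (antipode H y) (x * v))"
proof (rule balancedI)
  show "linear_form (usc H) (\<lambda>x. b (antipode H y) (x * v))" for y
    by (rule linear_form_mult_right[OF balanced_right[OF b]])
  show "linear_form (usc H) (\<lambda>y. b (antipode H y) (x * v))" for x
    by (rule linear_form_antipode[OF balanced_left[OF b]])
qed (simp add: antipode_mult antipode_src balanced_shift[OF b] mult.assoc)

text \<open>The inverse candidate respects t(a)u \<otimes> v = u \<otimes> s(a)v: S(t(a)u) =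
  S(u)s(a), and \<Delta> puts a right factor s(a) into the first tensor leg.\<close>

lemma balanced_gamma:
  assumes b: "balanced_UUop b"
  shows "balanced_UU (\<lambda>u v. ev (comult H (antipode H u)) (\<lambda>(x, y). b (antipode H y) (x * v)))"
proof (rule balancedI)
  fix a u v
  note bv = balanced_op_antipode[OF b]
  show "linear_form (usc H) (\<lambda>u. ev (comult H (antipode H u)) (\<lambda>(x, y). b (antipode H y) (x * v)))"
    by (rule linear_form_antipode[OF comult_form[OF bv]])
  show "linear_form (usc H) (\<lambda>v. ev (comult H (antipode H u)) (\<lambda>(x, y). b (antipode H y) (x * v)))"
    using b by (intro linear_form_ev)
      (auto simp: case_prod_unfold intro: linear_form_mult_left[of "b _"] balanced_right)
  show "ev (comult H (antipode H (tgt H a * u))) (\<lambda>(x, y). b (antipode H y) (x * v)) =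
      ev (comult H (antipode H u)) (\<lambda>(x, y). b (antipode H y) (x * (src H a * v)))"
    by (simp add: antipode_mult antipode_tgt comult_mult_src_form[OF bv] mult.assoc)
qed

text \<open>The left antipode axiom, tested against the form (x, y) \<mapsto> b(S(y), xv), gives
  b(S(S(u)), v), and S is involutive.\<close>

lemma gamma_beta:
  assumes b: "balanced_UUop b"
  shows "ev (comult H u) (\<lambda>(u1, u2). ev (comult H (antipode H u1)) (\<lambda>(x, y). b (antipode H y) (x * (u2 * v)))) = b u v"
proof -
  note bv = balanced_op_antipode[OF b, of v]
  have "ev (comult H u) (\<lambda>(u1, u2). ev (comult H (antipode H u1)) (\<lambda>(x, y). b (antipode H y) (x * u2 * v))) =
      b (antipode H (antipode H u)) (1 * v)"
    using cls_eqD[OF _ _ antipode_left, of "\<lambda>(x, y). b (antipode H y) (x * v)" u] bv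
    by (simp add: annihilates_rel2 pairing_sw case_prod_unfold)
  then show ?thesis by (simp add: antipode_involutive mult.assoc)
qed

text \<open>Every balanced form on X is recovered from \<beta>(X) by composing with the inverse
  candidate. Injectivity has to come first because \<open>translation\<close> is defined through
  \<open>the_inv_into\<close>.\<close>

lemma hopf_beta_inj: "inj_on (hopf_beta H) (vcarrier (tensor2 (rel_UUop H)))"
proof (rule inj_onI)
  fix X Y :: "('u \<times> 'u \<Rightarrow>\<^sub>0 'k) set"
  assume X: "X \<in> vcarrier (tensor2 (rel_UUop H))" and Y: "Y \<in> vcarrier (tensor2 (rel_UUop H))"
    and XY: "hopf_beta H X = hopf_beta H Y"
  show "X = Y"
  proof (rule cls_eq_clsI[OF subspace_rel2])
    show "X \<in> range (cls (rel_UUop H))" "Y \<in> range (cls (rel_UUop H))"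
      using X Y by (auto simp: tensor2_def quotient_carrier)
    fix f :: "'u \<times> 'u \<Rightarrow> 'k"
    assume "annihilates (rel_UUop H) f"
    then have f: "balanced_UUop (\<lambda>x y. f (x, y))" by (simp add: annihilates_rel2)
    have "ev Z f = ev (hopf_beta H Z)
        (\<lambda>(u, v). ev (comult H (antipode H u)) (\<lambda>(x, y). f (antipode H y, x * v)))" for Z
      unfolding hopf_beta_form[OF balanced_gamma[OF f]]
      by (simp add: gamma_beta[OF f])
    then show "ev X f = ev Y f" using XY by simp
  qed
qed

text \<open>By injectivity it suffices that \<beta> sends the candidate to u \<otimes> 1.\<close>

lemma translation_eq:
  "translation H u = cls (rel_UUop H) (sw (comult H (antipode H u)) (\<lambda>(x, y). gen (antipode H y, x)))"
  (is "_ = ?T")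
  unfolding translation_def
proof (rule the_inv_into_f_eq[OF hopf_beta_inj])
  show "?T \<in> vcarrier (tensor2 (rel_UUop H))"
    by (simp add: tensor2_def quotient_carrier)
  show "hopf_beta H ?T = cls (rel_UU H) (gen (u, 1))"
  proof (rule cls_eq_clsI[OF subspace_rel2])
    fix f :: "'u \<times> 'u \<Rightarrow> 'k"
    assume "annihilates (rel_UU H) f"
    then have f: "balanced_UU (\<lambda>x y. f (x, y))" by (simp add: annihilates_rel2)
    have "ev (hopf_beta H ?T) f =
        ev ?T (\<lambda>(u, v). ev (comult H u) (\<lambda>(x, y). f (x, y * v)))"
      using hopf_beta_form[OF f] by simp
    also have "\<dots> = ev (comult H (antipode H u)) (\<lambda>(x, y).
        ev (comult H (antipode H y)) (\<lambda>(x', y'). f (x', y' * x)))"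
      using balanced_beta[OF f]
      by (simp add: ev_cls annihilates_rel2 pairing_sw case_prod_unfold)
    \<comment> \<open>The right antipode axiom is applied to S(u) in place of u, so its right side
      is S(S(u)) \<otimes> 1.\<close>
    also have "\<dots> = f (antipode H (antipode H u), 1)"
      using cls_eqD[OF _ _ antipode_right, of f "antipode H u"] f
      by (simp add: annihilates_rel2 pairing_sw case_prod_unfold)
    finally show "ev (hopf_beta H ?T) f = ev (cls (rel_UU H) (gen (u, 1))) f"
      using f by (simp add: ev_cls annihilates_rel2 antipode_involutive)
  qed (auto simp: hopf_beta_def)
qed

section \<open>Calculation rules for u_+ \<otimes> u_-\<close>

lemma translation_form:
  assumes "balanced_UUop b"
  shows "ev (translation H u) (\<lambda>(p, m). b p m) = ev (comult H (antipode H u)) (\<lambda>(x, y). b (antipode H y) x)"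
  unfolding translation_eq using assms
  by (simp add: ev_cls annihilates_rel2 pairing_sw case_prod_unfold)

lemma translation_linear:
  assumes "balanced_UUop b"
  shows "linear_form (usc H) (\<lambda>u. ev (translation H u) (\<lambda>(p, m). b p m))"
  unfolding translation_form[OF assms]
  using linear_form_antipode[OF comult_form[OF balanced_op_antipode[OF assms, of 1]]] by simp

text \<open>With u_+ = S(y) and u_- = x for \<Delta>(S(u)) = x \<otimes> y, the factor t(a)S(y) is
  S(y s(a)), so this is the Takeuchi condition for \<Delta>(S(u)).\<close>

lemma translation_takeuchi:
  assumes b: "balanced_UUop b"
  shows "ev (translation H u) (\<lambda>(p, m). b (tgt H a * p) m) = ev (translation H u) (\<lambda>(p, m). b p (m * tgt H a))"
proof -
  have "balanced_UUop (\<lambda>p m. b (tgt H a * p) m)"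
    by (rule balanced_compose[OF b])
      (auto intro: linear_form_mult_left simp: balanced_shift[OF b] simp flip: mult.assoc)
  moreover have "balanced_UUop (\<lambda>p m. b p (m * tgt H a))"
    by (rule balanced_compose[OF b])
      (auto intro: linear_form_mult_right simp: balanced_shift[OF b] mult.assoc)
  ultimately show ?thesis
    using takeuchi_form[OF balanced_op_antipode[OF b, of 1], of "antipode H u" a]
    by (simp add: translation_form antipode_mult antipode_src)
qed

lemma balanced_op_mult_right:
  assumes b: "balanced_UUop b"
  shows "balanced_UUop (\<lambda>p m. b p (m * v))"
  by (rule balanced_compose[OF b])
    (auto intro: linear_form_mult_right simp: balanced_shift[OF b] mult.assoc)

lemma balanced_op_mult_src:
  assumes b: "balanced_UUop b"
  shows "balanced_UUop (\<lambda>p m. b p (src H a * m))"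
proof (rule balanced_compose[OF b])
  fix a' x y
  have "src H a * (tgt H a' * y) = tgt H a' * (src H a * y)"
    by (simp add: src_tgt_commute flip: mult.assoc)
  then show "b (x * tgt H a') (src H a * y) = b x (src H a * (tgt H a' * y))"
    by (simp add: balanced_shift[OF b])
qed (auto intro: linear_form_mult_left)

text \<open>S(ut(a)) = s(a)S(u), and the left factor s(a) lands in the first leg of the coproduct,
  that is in u_-.\<close>

lemma translation_mult_tgt:
  assumes b: "balanced_UUop b"
  shows "ev (translation H (u * tgt H a)) (\<lambda>(p, m). b p m) = ev (translation H u) (\<lambda>(p, m). b p (src H a * m))"
  using comult_src_form[OF balanced_op_antipode[OF b, of 1]]
  by (simp add: translation_form[OF b] translation_form[OF balanced_op_mult_src[OF b]]
      antipode_mult antipode_tgt)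

text \<open>Here S(t(a)u) = S(u)s(a) places s(a) at the right end of u_-.\<close>

lemma translation_tgt_mult:
  assumes b: "balanced_UUop b"
  shows "ev (translation H (tgt H a * u)) (\<lambda>(p, m). b p m) = ev (translation H u) (\<lambda>(p, m). b p (m * src H a))"
  using comult_mult_src_form[OF balanced_op_antipode[OF b, of 1]]
  by (simp add: translation_form[OF b] translation_form[OF balanced_op_mult_right[OF b]]
      antipode_mult antipode_tgt)

end

section \<open>Forms on the chain spaces\<close>

text \<open>A functional on the tensor power of \<open>U\<close> over the opposite of
  \<open>A\<close>, constrained on lists of length \<open>n\<close> only. It recurses from the head
  because \<open>twist\<close> and \<open>mlist\<close> do.\<close>

primrec list_form ::
  "('k::field, 'u::{ring,monoid_mult}, 'a) hopf_algebroid_data \<Rightarrow> nat \<Rightarrow> ('u list \<Rightarrow> 'k) \<Rightarrow> bool" where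
  "list_form H 0 h \<longleftrightarrow> True"
| "list_form H (Suc n) h \<longleftrightarrow>
     (\<forall>u. list_form H n (\<lambda>us. h (u # us))) \<and>
     (\<forall>us. length us = n \<longrightarrow> linear_form (usc H) (\<lambda>u. h (u # us))) \<and>
     (\<forall>u a v us. Suc (length us) = n \<longrightarrow> h (u * tgt H a # v # us) = h (u # tgt H a * v # us))"

definition chain_form ::
  "('k::field, 'u::{ring,monoid_mult}, 'a) hopf_algebroid_data \<Rightarrow>
   ('k, 'u, 'a, 'p::ab_group_add) sayd_data \<Rightarrow> nat \<Rightarrow> ('p \<Rightarrow> 'u list \<Rightarrow> 'k) \<Rightarrow> bool" where
  "chain_form H P n b \<longleftrightarrow>
     (\<forall>us. length us = n \<longrightarrow> linear_form (psc P) (\<lambda>p. b p us)) \<and>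
     (\<forall>p. list_form H n (b p)) \<and>
     (\<forall>p a u us. Suc (length us) = n \<longrightarrow> b (ract P p (tgt H a)) (u # us) = b p (tgt H a * u # us))"

text \<open>Passes from the recursion at the head to conditions at an arbitrary position, the shape
  in which \<open>rel_C\<close> is generated.\<close>

lemma list_form_iff:
  "list_form H n h \<longleftrightarrow>
     (\<forall>vs ws. length vs + 1 + length ws = n \<longrightarrow> linear_form (usc H) (\<lambda>u. h (vs @ [u] @ ws))) \<and>
     (\<forall>vs u a v ws. length vs + 2 + length ws = n \<longrightarrow>
        h (vs @ [u * tgt H a, v] @ ws) = h (vs @ [u, tgt H a * v] @ ws))"
proof (induction n arbitrary: h)
  case 0
  then show ?case by simp
next
  case (Suc n)
  have all_list: "(\<forall>vs. Q vs) \<longleftrightarrow> Q [] \<and> (\<forall>u vs. Q (u # vs))" for Q :: "'b list \<Rightarrow> bool"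
    by (metis list.exhaust)
  have lin: "(\<forall>vs ws. length vs + 1 + length ws = Suc n \<longrightarrow> linear_form (usc H) (\<lambda>u. h (vs @ [u] @ ws))) \<longleftrightarrow>
      (\<forall>ws. length ws = n \<longrightarrow> linear_form (usc H) (\<lambda>u. h (u # ws))) \<and>
      (\<forall>v vs ws. length vs + 1 + length ws = n \<longrightarrow> linear_form (usc H) (\<lambda>u. h (v # vs @ [u] @ ws)))"
    by (subst all_list) simp
  have bal: "(\<forall>vs u a v ws. length vs + 2 + length ws = Suc n \<longrightarrow>
        h (vs @ [u * tgt H a, v] @ ws) = h (vs @ [u, tgt H a * v] @ ws)) \<longleftrightarrow>
      (\<forall>u a v ws. Suc (length ws) = n \<longrightarrow> h (u * tgt H a # v # ws) = h (u # tgt H a * v # ws)) \<and>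
      (\<forall>w vs u a v ws. length vs + 2 + length ws = n \<longrightarrow>
        h (w # vs @ [u * tgt H a, v] @ ws) = h (w # vs @ [u, tgt H a * v] @ ws))"
    by (subst all_list) simp
  show ?case
    unfolding list_form.simps Suc.IH lin bal by blast
qed

text \<open>Universal property of the chain space. The operators are studied on chain forms, and the
  results are transferred to cosets by this equivalence.\<close>

lemma annihilates_rel_C:
  "annihilates (rel_C H P n) f \<longleftrightarrow> chain_form H P n (\<lambda>p us. f (p, us))"
  unfolding rel_C_def multilin_rels_def annihilates_fspan ball_Un ball_setcompr
    pairing_diff pairing_gen pairing_fscale chain_form_def list_form_iff linear_form_def
  by (auto simp: algebra_simps)

lemma subspace_rel_C [simp]: "free.subspace (rel_C H P n)"
  by (simp add: rel_C_def)

lemma list_form_cong: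
  "(\<And>us. length us = n \<Longrightarrow> h us = h' us) \<Longrightarrow> list_form H n h \<longleftrightarrow> list_form H n h'"
proof (induction n arbitrary: h h')
  case (Suc n)
  have "list_form H n (\<lambda>us. h (u # us)) \<longleftrightarrow> list_form H n (\<lambda>us. h' (u # us))" for u
    using Suc.prems by (intro Suc.IH) simp
  then show ?case using Suc.prems by (simp add: linear_form_def)
qed simp

lemma list_form_tail: "list_form H (Suc n) h \<Longrightarrow> list_form H n (\<lambda>us. h (u # us))"
  and list_form_head: "list_form H (Suc n) h \<Longrightarrow> length us = n \<Longrightarrow> linear_form (usc H) (\<lambda>u. h (u # us))"
  and list_form_shift:
    "list_form H (Suc n) h \<Longrightarrow> Suc (length us) = n \<Longrightarrow> h (u * tgt H a # v # us) = h (u # tgt H a * v # us)"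
  by simp_all

lemma list_form_ev:
  "(\<And>x. list_form H n (h x)) \<Longrightarrow> list_form H n (\<lambda>us. ev X (\<lambda>x. h x us))"
  by (induction n arbitrary: h) (auto intro!: linear_form_ev ev_cong)

lemma list_form_ev_prod:
  "(\<And>x y. list_form H n (h x y)) \<Longrightarrow> list_form H n (\<lambda>us. ev X (\<lambda>(x, y). h x y us))"
  using list_form_ev[of H n "case_prod h" X] by (simp add: case_prod_unfold)

text \<open>\<open>twist H [u\<^sup>1, \<dots>, u\<^sup>n] c h\<close> is \<open>h [u\<^sup>1\<^sub>+, \<dots>, u\<^sup>n\<^sub>+, u\<^sup>n\<^sub>- \<cdots> u\<^sup>1\<^sub>- c]\<close>, summation understood.\<close>

primrec twist ::
  "('k::field, 'u::{ring,monoid_mult}, 'a) hopf_algebroid_data \<Rightarrow> 'u list \<Rightarrow> 'u \<Rightarrow> ('u list \<Rightarrow> 'k) \<Rightarrow> 'k" where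
  "twist H [] c h = h [c]"
| "twist H (u # us) c h = ev (translation H u) (\<lambda>(p, m). twist H us (m * c) (\<lambda>ws. h (p # ws)))"

text \<open>\<open>plus_minus\<close> returns the product of the u_-, whereas \<open>twist\<close>
  passes it on as an argument; with \<open>c\<close> arbitrary this makes inductions on
  \<open>us\<close> possible. For the cyclic operator \<open>c\<close> is p_(-1).\<close>

lemma pairing_plus_minus:
  "pairing (plus_minus H us) (\<lambda>(vs, m). h (vs @ [m * c])) = twist H us c h"
proof (induction us arbitrary: c h)
  case (Cons u us)
  have "pairing (plus_minus H us) (\<lambda>x. h (p # fst x @ [snd x * (q * c)])) =
      twist H us (q * c) (\<lambda>ws. h (p # ws))" for p q
    using Cons.IH[of "\<lambda>ws. h (p # ws)" "q * c"] by (simp add: case_prod_unfold)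
  then show ?case
    by (simp add: pairing_sw pairing_lin_ext case_prod_unfold mult.assoc)
qed simp

lemma pairing_plus_minus_cong:
  "(\<And>vs m. length vs = length us \<Longrightarrow> f (vs, m) = g (vs, m)) \<Longrightarrow>
    pairing (plus_minus H us) f = pairing (plus_minus H us) g"
proof (induction us arbitrary: f g)
  case (Cons u us)
  have "pairing (plus_minus H us) (\<lambda>(vs, m). f (p # vs, m * q)) =
      pairing (plus_minus H us) (\<lambda>(vs, m). g (p # vs, m * q))" for p q
    by (rule Cons.IH) (simp add: Cons.prems)
  then show ?case
    by (simp add: pairing_sw pairing_lin_ext case_prod_unfold)
qed simp

lemma twist_cong:
  "(\<And>ws. length ws = Suc (length us) \<Longrightarrow> h ws = h' ws) \<Longrightarrow> twist H us c h = twist H us c h'"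
proof (induction us arbitrary: c h h')
  case (Cons u us)
  have "twist H us d (\<lambda>ws. h (p # ws)) = twist H us d (\<lambda>ws. h' (p # ws))" for p d
    by (rule Cons.IH) (simp add: Cons.prems)
  then show ?case by simp
qed simp

lemma twist_ev: "twist H us c (\<lambda>ws. ev X (\<lambda>x. h x ws)) = ev X (\<lambda>x. twist H us c (h x))"
proof (induction us arbitrary: c h)
  case (Cons u us)
  show ?case
    by (simp add: Cons.IH[of _ "\<lambda>x ws. h x (_ # ws)"] case_prod_unfold) (rule ev_swap)
qed simp

lemma linear_form_twist:
  "(\<And>ws. length ws = Suc (length us) \<Longrightarrow> linear_form s (\<lambda>x. h x ws)) \<Longrightarrow>
    linear_form s (\<lambda>x. twist H us c (h x))"
proof (induction us arbitrary: c h)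
  case (Cons u us)
  have "linear_form s (\<lambda>x. twist H us d (\<lambda>ws. h x (p # ws)))" for p d
    by (rule Cons.IH) (simp add: Cons.prems)
  then show ?case by (auto intro: linear_form_ev_prod)
qed simp

context hopf_algebroid
begin

lemma linear_form_twist_end:
  "list_form H (Suc (length us)) h \<Longrightarrow> linear_form (usc H) (\<lambda>c. twist H us c h)"
proof (induction us arbitrary: h)
  case (Cons u us)
  have "linear_form (usc H) (\<lambda>c. twist H us c (\<lambda>ws. h (p # ws)))" for p
    using Cons.prems by (intro Cons.IH) simp
  then show ?case by (auto intro!: linear_form_ev_prod intro: linear_form_mult_left)
qed simp

text \<open>Balancedness of the first step of \<open>twist\<close> over \<open>u # us\<close> needs
  t(a) to pass through \<open>twist\<close> over \<open>us\<close>, and passing t(a) through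
  \<open>twist\<close> over \<open>u # us\<close> needs that balancedness. The two facts are proved
  in one induction, so this lemma and the next take the statement for \<open>us\<close> as
  \<open>IH\<close>.\<close>

lemma twist_shift_step:
  assumes h: "list_form H (Suc (Suc (length us))) h"
    and IH: "\<And>h c. list_form H (Suc (length us)) h \<Longrightarrow>
      twist H us (tgt H a * c) h = twist H us c (\<lambda>ws. h (tgt H a * hd ws # tl ws))"
  shows "twist H us (m * c) (\<lambda>ws. h (p * tgt H a # ws)) = twist H us (tgt H a * m * c) (\<lambda>ws. h (p # ws))"
proof -
  have "h (p * tgt H a # ws) = h (p # tgt H a * hd ws # tl ws)" if "length ws = Suc (length us)" for ws
    using that list_form_shift[OF h, of "tl ws" p a "hd ws"] by (cases ws) auto
  then have "twist H us (m * c) (\<lambda>ws. h (p * tgt H a # ws)) =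
      twist H us (m * c) (\<lambda>ws. h (p # tgt H a * hd ws # tl ws))"
    by (intro twist_cong) simp
  also have "\<dots> = twist H us (tgt H a * (m * c)) (\<lambda>ws. h (p # ws))"
    using IH[OF list_form_tail[OF h]] by simp
  finally show ?thesis by (simp add: mult.assoc)
qed

lemma balanced_twist_step:
  assumes h: "list_form H (Suc (Suc (length us))) h"
    and IH: "\<And>h c a. list_form H (Suc (length us)) h \<Longrightarrow>
      twist H us (tgt H a * c) h = twist H us c (\<lambda>ws. h (tgt H a * hd ws # tl ws))"
  shows "balanced_UUop (\<lambda>p m. twist H us (m * c) (\<lambda>ws. h (p # ws)))"
proof (rule balancedI)
  show "linear_form (usc H) (\<lambda>p. twist H us (m * c) (\<lambda>ws. h (p # ws)))" for m
    by (rule linear_form_twist) (use h in simp)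
  show "linear_form (usc H) (\<lambda>m. twist H us (m * c) (\<lambda>ws. h (p # ws)))" for p
    by (rule linear_form_mult_right[OF linear_form_twist_end[OF list_form_tail[OF h]]])
qed (rule twist_shift_step[OF h IH])

text \<open>The Takeuchi rule of the translation map carries t(a) from the right of u_- to the left
  of u_+, hence from the last entry to the first.\<close>

lemma twist_tgt_mult:
  "list_form H (Suc (length us)) h \<Longrightarrow>
    twist H us (tgt H a * c) h = twist H us c (\<lambda>ws. h (tgt H a * hd ws # tl ws))"
proof (induction us arbitrary: h c a)
  case (Cons u us)
  have "balanced_UUop (\<lambda>p m. twist H us (m * c) (\<lambda>ws. h (p # ws)))"
    using Cons.prems Cons.IH by (intro balanced_twist_step) auto
  from translation_takeuchi[OF this] show ?case by (simp add: mult.assoc)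
qed simp

lemma balanced_twist:
  "list_form H (Suc (Suc (length us))) h \<Longrightarrow>
    balanced_UUop (\<lambda>p m. twist H us (m * c) (\<lambda>ws. h (p # ws)))"
  by (rule balanced_twist_step[OF _ twist_tgt_mult])

text \<open>(t(a)u)_- = u_- s(a). The same factor s(a) is produced in p_(-1) by the left A-linearity
  of the coaction.\<close>

lemma twist_head_tgt_mult:
  assumes "list_form H (Suc (Suc (length us))) h"
  shows "twist H (tgt H a * u # us) c h = twist H (u # us) (src H a * c) h"
  using translation_tgt_mult[OF balanced_twist[OF assms]] by (simp add: mult.assoc)

text \<open>The element s(a) links two neighbours: (ut(a))_- = s(a)u_- and (t(a)v)_- = v_- s(a) lead
  to the same product v_- s(a) u_-.\<close>

lemma list_form_twist:
  "list_form H (Suc n) h \<Longrightarrow> list_form H n (\<lambda>us. twist H us c h)"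
proof (induction n arbitrary: h c)
  case (Suc n)
  show ?case
    unfolding list_form.simps(2)
  proof (intro conjI allI impI)
    show "list_form H n (\<lambda>us. twist H (u # us) c h)" for u
      unfolding twist.simps using Suc.prems by (intro list_form_ev_prod Suc.IH list_form_tail)
  next
    fix us :: "'u list"
    assume us: "length us = n"
    show "linear_form (usc H) (\<lambda>u. twist H (u # us) c h)"
      using translation_linear[OF balanced_twist, of us h c] Suc.prems us by simp
  next
    fix u a v and us :: "'u list"
    assume us: "Suc (length us) = n"
    have "twist H (u * tgt H a # v # us) c h = ev (translation H u)
        (\<lambda>(p, m). twist H (v # us) (src H a * m * c) (\<lambda>ws. h (p # ws)))"
      using translation_mult_tgt[OF balanced_twist, of "v # us" h] Suc.prems us by (simp add: twist.simps(2)[of _ u])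
    also have "\<dots> = twist H (u # tgt H a * v # us) c h"
      using Suc.prems us list_form_tail[OF Suc.prems]
      by (simp add: twist.simps(2)[of _ u] twist_head_tgt_mult mult.assoc del: list_form.simps twist.simps)
    finally show "twist H (u * tgt H a # v # us) c h = twist H (u # tgt H a * v # us) c h" .
  qed
qed simp

end

text \<open>One merge covers several faces: \<phi> is the identity for the inner faces and
  t\<epsilon> for d_0.\<close>

definition contract :: "('u \<Rightarrow> 'u) \<Rightarrow> nat \<Rightarrow> 'u::times list \<Rightarrow> 'u list" where
  "contract \<phi> k us = take k us @ [us ! k * \<phi> (us ! Suc k)] @ drop (Suc (Suc k)) us"

lemma contract_simps [simp]:
  "contract \<phi> 0 (u # v # us) = u * \<phi> v # us"
  "contract \<phi> (Suc k) (u # us) = u # contract \<phi> k us"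
  by (simp_all add: contract_def)

lemma length_contract: "Suc k < length us \<Longrightarrow> length (contract \<phi> k us) = length us - 1"
  by (simp add: contract_def)

text \<open>Left multiplication of the first entry survives the merge, whether or not that entry is
  one of the two merged.\<close>

lemma contract_mult_head:
  fixes t :: "'u::semigroup_mult"
  assumes "Suc k \<le> length us"
  shows "contract \<phi> k (t * v # us) = t * hd (contract \<phi> k (v # us)) # tl (contract \<phi> k (v # us))"
  using assms by (cases k; cases us) (auto simp: mult.assoc)

lemma face_gen_eq:
  assumes "length us = n" and "1 \<le> n" and "i \<le> n"
  shows "face_gen H P n i (p, us) =
    (if i = 0 then
       if n = 1 then (ract P p (tgt H (counit H (hd us))), tl us)
       else (p, contract (\<lambda>u. tgt H (counit H u)) (n - 2) us)
     else if i = n then (ract P p (hd us), tl us)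
     else (p, contract (\<lambda>u. u) (n - i - 1) us))"
proof -
  have "us \<noteq> []" "n = 1 \<Longrightarrow> tl us = []" using assms by (auto simp: length_Suc_conv)
  moreover have "Suc (n - 2) = n - 1" "drop (Suc (Suc (n - 2))) us = []" if "n \<noteq> 1"
    using assms that by auto
  moreover have "Suc (n - i - 1) = n - i" "Suc (n - i) = n - i + 1" if "i \<noteq> n"
    using assms that by auto
  ultimately show ?thesis
    using assms by (simp add: face_gen_def contract_def hd_conv_nth)
qed

lemma chain_form_cong:
  assumes "\<And>p us. length us = n \<Longrightarrow> b p us = b' p us"
  shows "chain_form H P n b \<longleftrightarrow> chain_form H P n b'"
proof -
  have "list_form H n (b p) \<longleftrightarrow> list_form H n (b' p)" for p
    using assms by (rule list_form_cong)
  then show ?thesis using assms by (simp add: chain_form_def linear_form_def)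
qed

lemma chain_form_linear: "chain_form H P n b \<Longrightarrow> length us = n \<Longrightarrow> linear_form (psc P) (\<lambda>p. b p us)"
  and chain_form_list_form: "chain_form H P n b \<Longrightarrow> list_form H n (b p)"
  and chain_form_shift: "chain_form H P n b \<Longrightarrow> Suc (length us) = n \<Longrightarrow>
    b (ract P p (tgt H a)) (u # us) = b p (tgt H a * u # us)"
  by (simp_all add: chain_form_def)

context hopf_algebroid
begin

text \<open>Together with \<open>tgt_bilinear_map\<close>, the conditions on \<phi> under which a
  merge descends to tensors over the opposite of \<open>A\<close>. Linearity is phrased through
  forms so that it combines directly with \<open>linear_form\<close>.\<close>

definition tgt_linear_map :: "('u \<Rightarrow> 'u) \<Rightarrow> bool" where
  "tgt_linear_map \<phi> \<longleftrightarrow> (\<forall>f. linear_form (usc H) f \<longrightarrow> linear_form (usc H) (\<lambda>u. f (\<phi> u))) \<and>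
     (\<forall>a v. \<phi> (tgt H a * v) = tgt H a * \<phi> v)"

definition tgt_bilinear_map :: "('u \<Rightarrow> 'u) \<Rightarrow> bool" where
  "tgt_bilinear_map \<phi> \<longleftrightarrow> (\<forall>a v. \<phi> (v * tgt H a) = \<phi> v * tgt H a)"

lemma tgt_linear_map_form:
  "\<lbrakk>tgt_linear_map \<phi>; linear_form (usc H) f\<rbrakk> \<Longrightarrow> linear_form (usc H) (\<lambda>u. f (\<phi> u))"
  by (simp add: tgt_linear_map_def)

lemma tgt_linear_map_ident: "tgt_linear_map (\<lambda>u. u)"
  and tgt_bilinear_map_ident: "tgt_bilinear_map (\<lambda>u. u)"
  by (simp_all add: tgt_linear_map_def tgt_bilinear_map_def)

lemma counit_tgt_mult: "counit H (tgt H a * u) = counit H u * a"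
  using counit_bimodule[of 1 a u] by (simp add: src_one)

text \<open>\<epsilon>(t(a)u) = \<epsilon>(u)a and t reverses products, so t(a) comes out of
  t\<epsilon> on the left.\<close>

lemma tgt_linear_map_counit: "tgt_linear_map (\<lambda>u. tgt H (counit H u))"
  by (auto simp: tgt_linear_map_def counit_tgt_mult tgt_mult
      intro: linear_form_compose[OF counit_linear linear_form_compose[OF tgt_linear]])

text \<open>Right t-linearity of \<phi> is called for when an entry follows the merged pair;
  \<open>n = Suc k\<close> means that the pair is at the end, as for d_0.\<close>

lemma list_form_contract:
  assumes "tgt_linear_map \<phi>" and "list_form H n h" and "Suc k \<le> n"
    and "tgt_bilinear_map \<phi> \<or> n = Suc k"
  shows "list_form H (Suc n) (\<lambda>us. h (contract \<phi> k us))"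
  using assms(2-)
proof (induction k arbitrary: n h)
  case 0
  then obtain m where n: "n = Suc m" by (cases n) auto
  have h: "list_form H (Suc m) h" using 0 n by simp
  have "list_form H (Suc m) (\<lambda>us. h (contract \<phi> 0 (u # us)))" for u
    unfolding list_form.simps(2) contract_simps
  proof (intro conjI allI impI)
    show "list_form H m (\<lambda>us. h (u * \<phi> v # us))" for v
      by (rule list_form_tail[OF h])
    show "linear_form (usc H) (\<lambda>v. h (u * \<phi> v # us))" if "length us = m" for us
      by (rule tgt_linear_map_form[OF assms(1) linear_form_mult_left[OF list_form_head[OF h that]]])
    show "h (u * \<phi> (v * tgt H a) # w # us) = h (u * \<phi> v # tgt H a * w # us)"
      if "Suc (length us) = m" for v a w us
      using list_form_shift[OF h that, of "u * \<phi> v"] 0(3) n that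
      by (auto simp: tgt_bilinear_map_def mult.assoc)
  qed
  moreover have "linear_form (usc H) (\<lambda>u. h (contract \<phi> 0 (u # us)))" if "length us = n" for us
    using that n linear_form_mult_right[OF list_form_head[OF h]] by (cases us) auto
  moreover have "h (contract \<phi> 0 (u * tgt H a # v # us)) = h (contract \<phi> 0 (u # tgt H a * v # us))"
    for u a v us
    using assms(1) by (simp add: tgt_linear_map_def mult.assoc)
  ultimately show ?case by (simp only: list_form.simps n) simp
next
  case (Suc k)
  then obtain m where n: "n = Suc m" and k: "Suc k \<le> m" by (cases n) auto
  have h: "list_form H (Suc m) h" using Suc n by simp
  have "list_form H n (\<lambda>us. h (contract \<phi> (Suc k) (u # us)))" for u
    unfolding contract_simps n using Suc.prems n k list_form_tail[OF h] by (intro Suc.IH) auto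
  moreover have "linear_form (usc H) (\<lambda>u. h (contract \<phi> (Suc k) (u # us)))" if "length us = n" for us
    unfolding contract_simps using that n k by (intro list_form_head[OF h]) (simp add: length_contract)
  moreover have "h (contract \<phi> (Suc k) (u * tgt H a # v # us)) =
      h (contract \<phi> (Suc k) (u # tgt H a * v # us))" if "Suc (length us) = n" for u a v us
  proof -
    have len: "length (contract \<phi> k (v # us)) = m" using that n k by (simp add: length_contract)
    then have "contract \<phi> k (v # us) \<noteq> []" using k by auto
    then have "contract \<phi> k (v # us) = hd (contract \<phi> k (v # us)) # tl (contract \<phi> k (v # us))"
      by simp
    moreover have "Suc (length (tl (contract \<phi> k (v # us)))) = m" using len k by simp
    moreover have "Suc k \<le> length us" using that n k by simp
    ultimately show ?thesis
      using list_form_shift[OF h] by (metis contract_mult_head contract_simps(2))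
  qed
  ultimately show ?case by (simp only: list_form.simps) simp
qed

lemma list_form_insert:
  assumes "list_form H (Suc n) h" and "k \<le> n"
  shows "list_form H n (\<lambda>us. h (take k us @ [1] @ drop k us))"
  using assms
proof (induction k arbitrary: n h)
  case (Suc k)
  then obtain m where n: "n = Suc m" and k: "k \<le> m" by (cases n) auto
  have h: "list_form H (Suc (Suc m)) h" using Suc n by simp
  have "h (u * tgt H a # take k (v # us) @ 1 # drop k (v # us)) =
      h (u # take k (tgt H a * v # us) @ 1 # drop k (tgt H a * v # us))" if "Suc (length us) = m" for u a v us
  proof (cases k)
    case 0
    \<comment> \<open>t(a) passes through the inserted unit in two moves: ut(a) \<otimes> 1
      \<otimes> v = u \<otimes> t(a) \<otimes> v = u \<otimes> 1 \<otimes> t(a)v.\<close>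
    then show ?thesis
      using list_form_shift[OF h, of "v # us" u a 1] list_form_shift[OF list_form_tail[OF h], of us u 1 a v] that
      by simp
  next
    case (Suc l)
    then show ?thesis using list_form_shift[OF h] that by simp
  qed
  moreover have "linear_form (usc H) (\<lambda>u. h (u # take k us @ 1 # drop k us))" if "length us = m" for us
    using that k by (intro list_form_head[OF h]) simp
  moreover have "list_form H m (\<lambda>us. h (u # take k us @ 1 # drop k us))" for u
    using Suc.IH[OF list_form_tail[OF h] k] by simp
  ultimately show ?case by (simp add: n)
qed simp

end

section \<open>Pullback of forms along the cyclic operators\<close>

text \<open>The pullback of \<open>b\<close> along t_n: the head of the twisted list is u^1_+, which
  acts on p_(0). Degree 0 is separate because t_0 is the identity.\<close>

definition cyc_pullback ::
  "('k::field, 'u::{ring,monoid_mult}, 'a) hopf_algebroid_data \<Rightarrow> ('k, 'u, 'a, 'p) sayd_data \<Rightarrow>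
   nat \<Rightarrow> ('p \<Rightarrow> 'u list \<Rightarrow> 'k) \<Rightarrow> 'p \<Rightarrow> 'u list \<Rightarrow> 'k" where
  "cyc_pullback H P n b p us =
     (if n = 0 then b p us
      else ev (pcoact P p) (\<lambda>(q, p0). twist H us q (\<lambda>ws. b (ract P p0 (hd ws)) (tl ws))))"

lemma pairing_cyc_gen:
  assumes "length us = n"
  shows "pairing (cyc_gen H P n (p, us)) (\<lambda>(p, us). b p us) = cyc_pullback H P n b p us"
proof (cases "n = 0")
  case False
  \<comment> \<open>For \<open>n > 0\<close> the list \<open>vs\<close> is nonempty, so appending
    the last entry leaves its head alone, and the integrand becomes a function of the whole list, as
    \<open>twist\<close> expects.\<close>
  have "pairing (plus_minus H us) (\<lambda>(vs, m). b (ract P p0 (hd vs)) (tl vs @ [m * q])) =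
      pairing (plus_minus H us) (\<lambda>(vs, m). b (ract P p0 (hd (vs @ [m * q]))) (tl (vs @ [m * q])))" for q p0
    using False assms by (intro pairing_plus_minus_cong) (auto simp: neq_Nil_conv length_Suc_conv)
  also have "\<dots> q p0 = twist H us q (\<lambda>ws. b (ract P p0 (hd ws)) (tl ws))" for q p0
    by (rule pairing_plus_minus)
  finally show ?thesis
    using False
    by (simp add: cyc_gen_def cyc_pullback_def pairing_sw pairing_lin_ext case_prod_unfold)
qed (simp add: cyc_gen_def cyc_pullback_def)

locale hopf_module = hopf_algebroid H + sayd_module H P
  for H :: "('k::field, 'u::{ring,monoid_mult}, 'a::{ring,monoid_mult}) hopf_algebroid_data"
    and P :: "('k, 'u, 'a, 'p::ab_group_add) sayd_data"
begin

text \<open>The axiom for ps(a)t(b) with source argument 1, followed by the counit law of the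
  coaction. It identifies the A-structure in the chain relations with the one in the tensor product
  that receives the coaction.\<close>

lemma ract_tgt: "ract P p (tgt H a) = lact P a p"
proof -
  have "ract P p (tgt H a) = sweedler (psc P) (pcoact P p) (\<lambda>(q, p0). lact P (a * counit H q) p0)"
    using ract_src_tgt[of p 1 a] by (simp add: src_one ract_one)
  also have "\<dots> = lact P a (sweedler (psc P) (pcoact P p) (\<lambda>(q, p0). lact P (counit H q) p0))"
    by (simp add: linear_sweedler[OF lact_linear_P] lact_mult case_prod_unfold)
  finally show ?thesis by (simp add: pcoact_counit)
qed

lemma list_form_ract:
  assumes b: "chain_form H P n b"
  shows "list_form H (Suc n) (\<lambda>ws. b (ract P p (hd ws)) (tl ws))"
proof -
  have "b (ract P p (u * tgt H a)) (v # us) = b (ract P p u) (tgt H a * v # us)"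
    if "Suc (length us) = n" for u a v us
    using chain_form_shift[OF b that] by (simp add: ract_mult)
  then show ?thesis
    by (simp add: chain_form_list_form[OF b] linear_form_compose[OF ract_linear_U chain_form_linear[OF b]])
qed

text \<open>A factor t(a) in front of p_(-1) emerges at the first entry u^1_+ by
  \<open>twist_tgt_mult\<close>, and there it acts on p_(0) as a does.\<close>

lemma balanced_UP_twist:
  assumes b: "chain_form H P n b" and us: "length us = n"
  shows "balanced (usc H) (psc P) (\<lambda>a u. tgt H a * u) (lact P)
    (\<lambda>q p0. twist H us q (\<lambda>ws. b (ract P p0 (hd ws)) (tl ws)))"
proof (rule balancedI)
  fix p0 q a
  have h: "list_form H (Suc (length us)) (\<lambda>ws. b (ract P p (hd ws)) (tl ws))" for p
    using list_form_ract[OF b] us by simp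
  show "linear_form (usc H) (\<lambda>q. twist H us q (\<lambda>ws. b (ract P p0 (hd ws)) (tl ws)))"
    by (rule linear_form_twist_end[OF h])
  show "linear_form (psc P) (\<lambda>p0. twist H us q (\<lambda>ws. b (ract P p0 (hd ws)) (tl ws)))"
    using us
    by (intro linear_form_twist linear_form_compose[OF ract_linear_P chain_form_linear[OF b]]) simp
  show "twist H us (tgt H a * q) (\<lambda>ws. b (ract P p0 (hd ws)) (tl ws)) =
      twist H us q (\<lambda>ws. b (ract P (lact P a p0) (hd ws)) (tl ws))"
    unfolding twist_tgt_mult[OF h] by (simp add: ract_mult ract_tgt)
qed

lemma pcoact_form:
  assumes "balanced (usc H) (psc P) (\<lambda>a u. tgt H a * u) (lact P) b"
  shows "linear_form (psc P) (\<lambda>p. ev (pcoact P p) (\<lambda>(q, p0). b q p0))"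
  by (rule linear_map_form[OF _ pcoact_linear]) (simp_all add: annihilates_rel2 assms)

lemma pcoact_lact_form:
  assumes "balanced (usc H) (psc P) (\<lambda>a u. tgt H a * u) (lact P) b"
  shows "ev (pcoact P (lact P a p)) (\<lambda>(q, p0). b q p0) = ev (pcoact P p) (\<lambda>(q, p0). b (src H a * q) p0)"
  unfolding pcoact_lact
  by (simp add: ev_cls annihilates_rel2 assms pairing_sw case_prod_unfold)

text \<open>At the junction of P and u^1 both sides produce the factor s(a): once from the coaction
  of ap = pt(a), once from (t(a)u)_-. The relations among the entries are those of
  \<open>list_form_twist\<close>.\<close>

lemma chain_form_cyc:
  assumes b: "chain_form H P n b"
  shows "chain_form H P n (cyc_pullback H P n b)"
proof (cases n)
  case 0
  then show ?thesis using b by (simp add: cyc_pullback_def[abs_def])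
next
  case (Suc m)
  show ?thesis
    unfolding chain_form_def
  proof (intro conjI allI impI)
    show "linear_form (psc P) (\<lambda>p. cyc_pullback H P n b p us)" if "length us = n" for us
      using pcoact_form[OF balanced_UP_twist[OF b that]] by (simp add: cyc_pullback_def Suc)
    show "list_form H n (cyc_pullback H P n b p)" for p
      using list_form_ev_prod[OF list_form_twist[OF list_form_ract[OF b]]]
      by (simp add: cyc_pullback_def[abs_def] Suc)
    show "cyc_pullback H P n b (ract P p (tgt H a)) (u # us) = cyc_pullback H P n b p (tgt H a * u # us)"
      if us: "Suc (length us) = n" for p a u us
    proof -
      have "twist H (tgt H a * u # us) q (\<lambda>ws. b (ract P p0 (hd ws)) (tl ws)) =
          twist H (u # us) (src H a * q) (\<lambda>ws. b (ract P p0 (hd ws)) (tl ws))" for q p0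
        using list_form_ract[OF b] us by (intro twist_head_tgt_mult) simp
      then show ?thesis
        using pcoact_lact_form[OF balanced_UP_twist[OF b, of "u # us"]] us
        by (simp add: cyc_pullback_def ract_tgt del: twist.simps)
    qed
  qed
qed

lemma chain_form_contract:
  assumes b: "chain_form H P n b" and \<phi>: "tgt_linear_map \<phi>" and k: "Suc k \<le> n"
    and "tgt_bilinear_map \<phi> \<or> n = Suc k"
  shows "chain_form H P (Suc n) (\<lambda>p us. b p (contract \<phi> k us))"
  unfolding chain_form_def
proof (intro conjI allI impI)
  show "linear_form (psc P) (\<lambda>p. b p (contract \<phi> k us))" if "length us = Suc n" for us
    using that k by (intro chain_form_linear[OF b]) (simp add: length_contract)
  show "list_form H (Suc n) (\<lambda>us. b p (contract \<phi> k us))" for p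
    using assms by (intro list_form_contract chain_form_list_form)
  show "b (ract P p (tgt H a)) (contract \<phi> k (u # us)) = b p (contract \<phi> k (tgt H a * u # us))"
    if us: "Suc (length us) = Suc n" for p a u us
  proof -
    have len: "length (contract \<phi> k (u # us)) = n" using us k by (simp add: length_contract)
    then obtain w ws where w: "contract \<phi> k (u # us) = w # ws" "Suc (length ws) = n"
      using k by (cases "contract \<phi> k (u # us)") auto
    then have "contract \<phi> k (tgt H a * u # us) = tgt H a * w # ws"
      using us k by (subst contract_mult_head) simp_all
    then show ?thesis using chain_form_shift[OF b w(2)] w(1) by simp
  qed
qed

text \<open>Covers d_n with \<phi> the identity and, in degree 1, d_0 with \<phi> = t\<epsilon>. In
  the latter case no entry remains to the right, which is the alternative
  \<open>n = 0\<close>.\<close>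

lemma chain_form_act:
  assumes b: "chain_form H P n b" and \<phi>: "tgt_linear_map \<phi>" and right: "tgt_bilinear_map \<phi> \<or> n = 0"
  shows "chain_form H P (Suc n) (\<lambda>p us. b (ract P p (\<phi> (hd us))) (tl us))"
  unfolding chain_form_def
proof (intro conjI allI impI)
  show "linear_form (psc P) (\<lambda>p. b (ract P p (\<phi> (hd us))) (tl us))" if "length us = Suc n" for us
    using that by (intro linear_form_compose[OF ract_linear_P chain_form_linear[OF b]]) simp
  have "linear_form (usc H) (\<lambda>u. b (ract P p (\<phi> u)) us)" if "length us = n" for p us
    by (rule tgt_linear_map_form[OF \<phi> linear_form_compose[OF ract_linear_U chain_form_linear[OF b that]]])
  moreover have "b (ract P p (\<phi> (u * tgt H a))) (v # us) = b (ract P p (\<phi> u)) (tgt H a * v # us)"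
    if "Suc (length us) = n" for p u a v us
    using right that chain_form_shift[OF b that] by (auto simp: tgt_bilinear_map_def ract_mult)
  ultimately show "list_form H (Suc n) (\<lambda>us. b (ract P p (\<phi> (hd us))) (tl us))" for p
    by (simp add: chain_form_list_form[OF b])
  show "b (ract P (ract P p (tgt H a)) (\<phi> (hd (u # us)))) (tl (u # us)) =
      b (ract P p (\<phi> (hd (tgt H a * u # us)))) (tl (tgt H a * u # us))" for p a u us
    using \<phi> by (simp add: tgt_linear_map_def ract_mult)
qed

lemma chain_form_face:
  assumes b: "chain_form H P (n - 1) b" and "1 \<le> n" and "i \<le> n"
  shows "chain_form H P n (\<lambda>p us. case face_gen H P n i (p, us) of (p, us) \<Rightarrow> b p us)"
proof -
  obtain m where n: "n = Suc m" using assms by (cases n) auto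
  have b: "chain_form H P m b" using b n by simp
  \<comment> \<open>In degree 1 the face d_0 acts on P instead of merging two entries.\<close>
  consider (last1) "i = 0" "n = 1" | (last) "i = 0" "n \<noteq> 1" | (first) "i \<noteq> 0" "i = n" | (mid) "i \<noteq> 0" "i \<noteq> n"
    by blast
  then show ?thesis
  proof cases
    case last1
    then show ?thesis
      using chain_form_act[OF b tgt_linear_map_counit] n
      by (subst chain_form_cong[where b' = "\<lambda>p us. b (ract P p (tgt H (counit H (hd us)))) (tl us)"])
        (simp_all add: face_gen_eq)
  next
    case last
    then show ?thesis
      using chain_form_contract[OF b tgt_linear_map_counit, of "n - 2"] n
      by (subst chain_form_cong[where b' = "\<lambda>p us. b p (contract (\<lambda>u. tgt H (counit H u)) (n - 2) us)"])
        (simp_all add: face_gen_eq)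
  next
    case first
    then show ?thesis
      using chain_form_act[OF b tgt_linear_map_ident] n
      by (subst chain_form_cong[where b' = "\<lambda>p us. b (ract P p (hd us)) (tl us)"])
        (simp_all add: face_gen_eq tgt_bilinear_map_ident)
  next
    case mid
    then show ?thesis
      using chain_form_contract[OF b tgt_linear_map_ident, of "n - i - 1"] n assms
      by (subst chain_form_cong[where b' = "\<lambda>p us. b p (contract (\<lambda>u. u) (n - i - 1) us)"])
        (simp_all add: face_gen_eq tgt_bilinear_map_ident)
  qed
qed

lemma chain_form_degen:
  assumes b: "chain_form H P (n + 1) b" and "i \<le> n"
  shows "chain_form H P n (\<lambda>p us. case degen_gen n i (p, us) of (p, us) \<Rightarrow> b p us)"
  unfolding degen_gen_def prod.case chain_form_def
proof (intro conjI allI impI)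
  show "linear_form (psc P) (\<lambda>p. b p (take (n - i) us @ [1] @ drop (n - i) us))" if "length us = n" for us
    using that by (intro chain_form_linear[OF b]) simp
  show "list_form H n (\<lambda>us. b p (take (n - i) us @ [1] @ drop (n - i) us))" for p
    using list_form_insert[of n "b p" "n - i"] chain_form_list_form[OF b] by simp
  show "b (ract P p (tgt H a)) (take (n - i) (u # us) @ [1] @ drop (n - i) (u # us)) =
      b p (take (n - i) (tgt H a * u # us) @ [1] @ drop (n - i) (tgt H a * u # us))"
    if us: "Suc (length us) = n" for p a u us
  proof (cases "n - i")
    case 0
    \<comment> \<open>The unit stands directly after p, so t(a) travels through it: pt(a) \<otimes>
      1 \<otimes> u = p \<otimes> t(a) \<otimes> u = p \<otimes> 1 \<otimes> t(a)u.\<close>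
    have "b (ract P p (tgt H a)) (1 # u # us) = b p (1 * tgt H a # u # us)"
      using chain_form_shift[OF b, of "u # us" p a 1] us by simp
    also have "\<dots> = b p (1 # tgt H a * u # us)"
      using list_form_shift[of H n "b p" us 1 a u] chain_form_list_form[OF b, of p] us
      by (simp del: list_form.simps)
    finally show ?thesis using 0 by simp
  next
    case (Suc k)
    then show ?thesis using chain_form_shift[OF b] us by simp
  qed
qed

end

section \<open>Evaluating forms on measured elements\<close>

lemma (in algebra_measuring) linear_form_measuring:
  "linear_form r' f' \<Longrightarrow> linear_form r (\<lambda>a. f' (f x a))"
  "linear_form r' f' \<Longrightarrow> linear_form (csc C) (\<lambda>x. f' (f x a))"
  by (rule linear_form_compose[OF linear_R] linear_form_compose[OF linear_C], assumption)+

locale measured_hopf_modules =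
  dom: hopf_module H P + cod: hopf_module H' P' +
  coalg: cocommutative_coalgebra C + hopf_measuring C H H' Psi psi +
  comodule_measuring C H' P P' Psi D Om
  for H :: "('k::field, 'u::{ring,monoid_mult}, 'a::{ring,monoid_mult}) hopf_algebroid_data"
    and P :: "('k, 'u, 'a, 'p::ab_group_add) sayd_data"
    and H' :: "('k, 'u2::{ring,monoid_mult}, 'a2::{ring,monoid_mult}) hopf_algebroid_data"
    and P' :: "('k, 'u2, 'a2, 'p2::ab_group_add) sayd_data"
    and C :: "('k, 'c::ab_group_add) coalgebra_data"
    and Psi :: "'c \<Rightarrow> 'u \<Rightarrow> 'u2" and psi :: "'c \<Rightarrow> 'a \<Rightarrow> 'a2"
    and D :: "('k, 'c, 'd::ab_group_add) comodule_data" and Om :: "'d \<Rightarrow> 'p \<Rightarrow> 'p2"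
begin

section \<open>Linearity of measurements and rules for iterated coactions\<close>

lemma Psi_form:
  "linear_form (usc H') f \<Longrightarrow> linear_form (usc H) (\<lambda>u. f (Psi x u))"
  "linear_form (usc H') f \<Longrightarrow> linear_form (csc C) (\<lambda>x. f (Psi x u))"
  by (rule algebra_measuring.linear_form_measuring[OF Psi_measuring], assumption)+

lemma dcoact_form:
  assumes "\<And>x. linear_form (dsc D) (\<lambda>z. b z x)" and "\<And>z. linear_form (csc C) (b z)"
  shows "linear_form (dsc D) (\<lambda>y. ev (dcoact D y) (\<lambda>(z, x). b z x))"
proof (rule linear_map_form[OF _ right_comodule.coact_linear[OF D_comodule]])
  show "annihilates (rel_DC C D) (\<lambda>(z, x). b z x)"
    using assms by (simp add: annihilates_rel2 balanced_def linear_form_scale[of _ "b _"]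
        linear_form_scale[of _ "\<lambda>z. b z _"])
qed simp

text \<open>Coassociativity turns a second coaction into a coproduct in C, where cocommutativity
  permits exchanging the two legs. For the exchange, coassociativity is applied to \<open>g\<close>
  and to \<open>g\<close> with its last two arguments swapped.\<close>

lemma dcoact_iterate:
  assumes "\<And>x x'. linear_form (dsc D) (\<lambda>z. g z x x')" and "\<And>z x'. linear_form (csc C) (\<lambda>x. g z x x')"
    and "\<And>z x. linear_form (csc C) (g z x)"
  shows "ev (dcoact D y) (\<lambda>(z, x). ev (dcoact D z) (\<lambda>(z', x'). g z' x' x)) =
    ev (dcoact D y) (\<lambda>(z, x). ev (ccomult C x) (\<lambda>(x1, x2). g z x1 x2))" (is ?coassoc)
    and "ev (dcoact D y) (\<lambda>(z, x). ev (dcoact D z) (\<lambda>(z', x'). g z' x' x)) =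
      ev (dcoact D y) (\<lambda>(z, x). ev (dcoact D z) (\<lambda>(z', x'). g z' x x'))" (is ?swap)
proof -
  have coassoc: "ev (dcoact D y) (\<lambda>(z, x). ev (dcoact D z) (\<lambda>(z', x'). f z' x' x)) =
      ev (dcoact D y) (\<lambda>(z, x). ev (ccomult C x) (\<lambda>(x1, x2). f z x1 x2))"
    if "\<And>x x'. linear_form (dsc D) (\<lambda>z. f z x x')" "\<And>z x'. linear_form (csc C) (\<lambda>x. f z x x')"
      "\<And>z x. linear_form (csc C) (f z x)" for f
  proof -
    have "annihilates (rel3 (dsc D) (csc C) (csc C) (dsc D) (csc C) (csc C) (csc C)) (\<lambda>(z, x, x'). f z x x')"
      using that by (simp add: annihilates_rel3 balanced_def linear_form_scale[of _ "f _ _"]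
        linear_form_scale[of _ "\<lambda>z. f z _ _"] linear_form_scale[of _ "\<lambda>x. f _ x _"])
    from cls_eqD[OF _ this right_comodule.coact_coassoc[OF D_comodule, of y]]
    show ?thesis by (simp add: pairing_sw case_prod_unfold)
  qed
  show ?coassoc by (rule coassoc) (fact assms)+
  have "ev (ccomult C x) (\<lambda>(x1, x2). g z x1 x2) = ev (ccomult C x) (\<lambda>(x1, x2). g z x2 x1)" for z x
  proof -
    have "annihilates (rel_CC C) (\<lambda>(x1, x2). g z x1 x2)"
      using assms by (simp add: annihilates_rel2 balanced_def linear_form_scale[of _ "g _ _"]
        linear_form_scale[of _ "\<lambda>x. g _ x _"])
    then show ?thesis
      by (subst coalg.cocomm) (simp add: ev_cls pairing_sw case_prod_unfold)
  qed
  then show ?swap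
    using coassoc[of g] coassoc[of "\<lambda>z x x'. g z x' x"] assms by simp
qed

text \<open>\<open>mstep u y f\<close> is \<open>f y\<^sub>0 (y\<^sub>1(u))\<close>, summation understood.\<close>

definition mstep :: "'u \<Rightarrow> 'd \<Rightarrow> ('d \<Rightarrow> 'u2 \<Rightarrow> 'k) \<Rightarrow> 'k" where
  "mstep u y f = ev (dcoact D y) (\<lambda>(z, x). f z (Psi x u))"

lemma mstep_cong: "(\<And>z x. f z (Psi x u) = g z (Psi x u)) \<Longrightarrow> mstep u y f = mstep u y g"
  by (simp add: mstep_def)

lemma mstep_ev: "mstep u y (\<lambda>z w. ev X (\<lambda>(p, m). f p m z w)) = ev X (\<lambda>(p, m). mstep u y (f p m))"
  unfolding mstep_def case_prod_unfold by (rule ev_swap)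

lemma linear_form_mstep:
  "(\<And>z w. linear_form s (\<lambda>v. f v z w)) \<Longrightarrow> linear_form s (\<lambda>v. mstep u y (f v))"
  unfolding mstep_def by (rule linear_form_ev_prod)

lemma list_form_mstep:
  "(\<And>z w. list_form H0 n (h z w)) \<Longrightarrow> list_form H0 n (\<lambda>us. mstep u y (\<lambda>z w. h z w us))"
  unfolding mstep_def by (rule list_form_ev_prod)

lemma twist_mstep: "twist H0 us c (\<lambda>ws. mstep u y (\<lambda>z w. h z w ws)) = mstep u y (\<lambda>z w. twist H0 us c (h z w))"
  unfolding mstep_def case_prod_unfold by (rule twist_ev)

lemma mstep_linear_left:
  assumes "\<And>z. linear_form (usc H') (f z)"
  shows "linear_form (usc H) (\<lambda>u. mstep u y f)"
  unfolding mstep_def by (rule linear_form_ev_prod) (rule Psi_form[OF assms])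

lemma mstep_linear_right:
  assumes "\<And>w. linear_form (dsc D) (\<lambda>z. f z w)" and "\<And>z. linear_form (usc H') (f z)"
  shows "linear_form (dsc D) (\<lambda>y. mstep u y f)"
  unfolding mstep_def by (rule dcoact_form[OF assms(1) Psi_form(2)[OF assms(2)]])

text \<open>\<Psi> applied to a product splits y_(1) by the coproduct of C, and coassociativity
  turns the split into a second coaction. The inner coaction supplies the earlier leg, hence
  \<open>v\<close> is measured outside and \<open>u\<close> inside.\<close>

lemma mstep_mult:
  assumes "\<And>w. linear_form (dsc D) (\<lambda>z. f z w)" and f: "\<And>z. linear_form (usc H') (f z)"
  shows "mstep (u * v) y f = mstep v y (\<lambda>z w'. mstep u z (\<lambda>z' w. f z' (w * w')))"
proof -
  have "f z (Psi x (u * v)) = ev (ccomult C x) (\<lambda>(x1, x2). f z (Psi x1 u * Psi x2 v))" for z x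
    using cod.U_algebra
    by (simp add: algebra_measuring.measuring_mult[OF Psi_measuring] linear_form_sweedler[OF f]
        algebra_over_def case_prod_unfold)
  then show ?thesis
    unfolding mstep_def using assms
    by (subst dcoact_iterate(1)[where g = "\<lambda>z x1 x2. f z (Psi x1 u * Psi x2 v)"])
      (auto intro: Psi_form(2)[OF cod.linear_form_mult_right] Psi_form(2)[OF cod.linear_form_mult_left])
qed

text \<open>The order in which two entries are measured is irrelevant, by cocommutativity of
  C.\<close>

lemma mstep_swap:
  assumes "\<And>w w'. linear_form (dsc D) (\<lambda>z. f z w w')" and "\<And>z w'. linear_form (usc H') (\<lambda>w. f z w w')"
    and "\<And>z w. linear_form (usc H') (f z w)"
  shows "mstep v y (\<lambda>z w'. mstep u z (\<lambda>z' w. f z' w w')) = mstep u y (\<lambda>z w. mstep v z (\<lambda>z' w'. f z' w w'))"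
  unfolding mstep_def
  by (rule dcoact_iterate(2)[where g = "\<lambda>z x1 x2. f z (Psi x1 u) (Psi x2 v)"])
    (rule assms(1) Psi_form(2)[OF assms(2)] Psi_form(2)[OF assms(3)])+

text \<open>\<Psi>(x)(1) = \<epsilon>(x)1, and the counit law of the comodule D removes the leg
  x.\<close>

lemma mstep_one:
  assumes "linear_form (dsc D) (\<lambda>z. f z 1)" and "\<And>z. linear_form (usc H') (f z)"
  shows "mstep 1 y f = f y 1"
proof -
  have "f y 1 = ev (dcoact D y) (\<lambda>(z, x). f (dsc D (ccounit C x) z) 1)"
    using linear_form_sweedler[OF assms(1) right_comodule.D_space[OF D_comodule],
        of "dcoact D y" "\<lambda>(z, x). dsc D (ccounit C x) z"]
    by (simp add: right_comodule.coact_counit[OF D_comodule, unfolded case_prod_unfold] case_prod_unfold)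
  then show ?thesis
    by (simp add: mstep_def algebra_measuring.measuring_one[OF Psi_measuring]
        linear_form_scale[OF assms(1)] linear_form_scale[OF assms(2)])
qed

text \<open>Measuring t(a) yields elements in the image of t', so the balancing relations over A'
  apply to them.\<close>

lemma mstep_tgt_cong:
  "(\<And>z a'. f z (tgt H' a') = g z (tgt H' a')) \<Longrightarrow> mstep (tgt H a) y f = mstep (tgt H a) y g"
  by (rule mstep_cong) (simp add: Psi_tgt)

text \<open>Provides for d_0 the hypothesis on \<phi> and \<phi>' in \<open>mlist_contract\<close>
  and \<open>mlist_act\<close>.\<close>

lemma mstep_tgt_counit:
  "mstep (tgt H (counit H u)) y f = mstep u y (\<lambda>z w. f z (tgt H' (counit H' w)))"
  by (simp add: mstep_def Psi_tgt psi_counit)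

text \<open>Once t(a) is split off from \<open>p\<close> and shifted over to \<open>m\<close>, its
  C-leg is the last one, whereas measuring t(a)m requires it directly before the leg of
  \<open>m\<close>. Two exchanges of legs repair the order.\<close>

lemma balanced_mstep_mstep:
  assumes b: "\<And>z. cod.balanced_UUop (b z)" and z: "\<And>p m. linear_form (dsc D) (\<lambda>z. b z p m)"
  shows "dom.balanced_UUop (\<lambda>p m. mstep p y (\<lambda>z p'. mstep m z (\<lambda>z' m'. b z' p' m')))"
proof (rule balancedI)
  note left = balanced_left[OF b] and right = balanced_right[OF b]
  show "linear_form (usc H) (\<lambda>p. mstep p y (\<lambda>z p'. mstep m z (\<lambda>z' m'. b z' p' m')))" for m
    by (rule mstep_linear_left) (rule linear_form_mstep, rule left)
  show "linear_form (usc H) (\<lambda>m. mstep p y (\<lambda>z p'. mstep m z (\<lambda>z' m'. b z' p' m')))" for p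
    by (rule linear_form_mstep) (rule mstep_linear_left, rule right)
  fix a p m
  have "mstep (p * tgt H a) y (\<lambda>z p'. mstep m z (\<lambda>z' m'. b z' p' m')) =
      mstep (tgt H a) y (\<lambda>z w. mstep p z (\<lambda>z p'. mstep m z (\<lambda>z' m'. b z' (p' * w) m')))"
    by (rule mstep_mult) (rule mstep_linear_right[OF z right] linear_form_mstep left)+
  also have "\<dots> = mstep (tgt H a) y (\<lambda>z w. mstep p z (\<lambda>z p'. mstep m z (\<lambda>z' m'. b z' p' (w * m'))))"
    by (rule mstep_tgt_cong) (simp add: balanced_shift[OF b])
  also have "\<dots> = mstep p y (\<lambda>z p'. mstep (tgt H a) z (\<lambda>z w. mstep m z (\<lambda>z' m'. b z' p' (w * m'))))"
    by (rule mstep_swap)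
      (rule mstep_linear_right[OF z cod.linear_form_mult_left[OF right]]
        linear_form_mstep left cod.linear_form_mult_right[OF right])+
  also have "\<dots> = mstep p y (\<lambda>z p'. mstep m z (\<lambda>z m'. mstep (tgt H a) z (\<lambda>z' w. b z' p' (w * m'))))"
    by (rule mstep_cong, rule mstep_swap)
      (rule z cod.linear_form_mult_left[OF right] cod.linear_form_mult_right[OF right])+
  also have "\<dots> = mstep p y (\<lambda>z p'. mstep (tgt H a * m) z (\<lambda>z' m'. b z' p' m'))"
    by (rule mstep_cong, rule mstep_mult[symmetric]) (rule z right)+
  finally show "mstep (p * tgt H a) y (\<lambda>z p'. mstep m z (\<lambda>z' m'. b z' p' m')) =
      mstep p y (\<lambda>z p'. mstep (tgt H a * m) z (\<lambda>z' m'. b z' p' m'))" .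
qed

lemma Psi_comult_form:
  assumes "cod.balanced_UU b"
  shows "ev (comult H' (Psi x u)) (\<lambda>(w1, w2). b w1 w2) =
    ev (ccomult C x) (\<lambda>(x1, x2). ev (comult H u) (\<lambda>(u1, u2). b (Psi x1 u1) (Psi x2 u2)))"
  unfolding Psi_comult using assms
  by (simp add: ev_cls annihilates_rel2 pairing_sw case_prod_unfold)

text \<open>In \<Delta>(S(u)) the first leg is u_- and the second becomes u_+ through S. Since
  \<Psi> commutes with S and \<Delta>, u_- receives the earlier and u_+ the later C-leg, which is
  the nesting on the right side.\<close>

lemma mstep_translation:
  assumes b: "\<And>z. cod.balanced_UUop (b z)" and z: "\<And>p m. linear_form (dsc D) (\<lambda>z. b z p m)"
  shows "mstep u y (\<lambda>z w. ev (translation H' w) (\<lambda>(p, m). b z p m)) =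
    ev (translation H u) (\<lambda>(p, m). mstep p y (\<lambda>z p'. mstep m z (\<lambda>z' m'. b z' p' m')))"
proof -
  let ?S = "antipode H u"
  have bS: "cod.balanced_UU (\<lambda>w1 w2. b z (antipode H' w2) w1)" for z
    using cod.balanced_op_antipode[OF b, of z 1] by simp
  have "mstep u y (\<lambda>z w. ev (translation H' w) (\<lambda>(p, m). b z p m)) =
      ev (dcoact D y) (\<lambda>(z, x). ev (ccomult C x) (\<lambda>(x1, x2). ev (comult H ?S)
        (\<lambda>(u1, u2). b z (Psi x2 (antipode H u2)) (Psi x1 u1))))"
    by (simp add: mstep_def cod.translation_form[OF b] Psi_comult_form[OF bS] flip: Psi_antipode)
  also have "\<dots> = ev (comult H ?S) (\<lambda>(u1, u2). ev (dcoact D y) (\<lambda>(z, x). ev (ccomult C x) (\<lambda>(x1, x2).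
      b z (Psi x2 (antipode H u2)) (Psi x1 u1))))"
    unfolding case_prod_unfold
    by (simp add: ev_swap[where X = "ccomult C _" and Y = "comult H ?S"]
        ev_swap[where X = "dcoact D y" and Y = "comult H ?S"])
  \<comment> \<open>Coassociativity is read from right to left: the outer coaction supplies
    \<open>x2\<close>, the inner one \<open>x1\<close>.\<close>
  also have "\<dots> = ev (comult H ?S) (\<lambda>(u1, u2). mstep (antipode H u2) y (\<lambda>z p'. mstep u1 z (\<lambda>z' m'. b z' p' m')))"
    unfolding mstep_def
    by (subst dcoact_iterate(1)[where g = "\<lambda>z x1 x2. b z (Psi x2 (antipode H _)) (Psi x1 _)", symmetric])
      (rule z Psi_form(2) balanced_left[OF b] balanced_right[OF b] refl)+
  also have "\<dots> = ev (translation H u) (\<lambda>(p, m). mstep p y (\<lambda>z p'. mstep m z (\<lambda>z' m'. b z' p' m')))"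
    by (rule dom.translation_form[OF balanced_mstep_mstep[OF assms], symmetric])
  finally show ?thesis .
qed

lemma Om_ract_form:
  assumes "linear_form (psc P') g"
  shows "g (Om y (ract P p u)) = mstep u y (\<lambda>z w. g (ract P' (Om z p) w))"
  unfolding Om_ract mstep_def
  by (simp add: linear_form_sweedler[OF assms cod.P_space] case_prod_unfold)

lemma Om_coact_form:
  assumes "balanced (usc H') (psc P') (\<lambda>a u. tgt H' a * u) (lact P') b"
  shows "ev (pcoact P' (Om y p)) (\<lambda>(q, p0). b q p0) =
    ev (pcoact P p) (\<lambda>(q, p0). mstep q y (\<lambda>z q'. b q' (Om z p0)))"
proof -
  have "ev (pcoact P' (Om y p)) (\<lambda>(q, p0). b q p0) =
      ev (dcoact D y) (\<lambda>(z, x). ev (pcoact P p) (\<lambda>(q, p0). b (Psi x q) (Om z p0)))"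
    unfolding Om_coact using assms
    by (simp add: ev_cls annihilates_rel2 pairing_sw case_prod_unfold)
  then show ?thesis
    unfolding mstep_def case_prod_unfold by (simp add: ev_swap[of "dcoact D y"])
qed

end

section \<open>Measuring a list of entries by the iterated coaction\<close>

lemma pairing_iter_cong:
  "(\<And>z xs. length xs = n \<Longrightarrow> f (z, xs) = g (z, xs)) \<Longrightarrow>
    pairing (iter_coact_rep D n y) f = pairing (iter_coact_rep D n y) g"
proof (induction n arbitrary: y f g)
  case (Suc n)
  have "pairing (iter_coact_rep D n y0) (\<lambda>(z, xs). f (z, xs @ [x])) =
      pairing (iter_coact_rep D n y0) (\<lambda>(z, xs). g (z, xs @ [x]))" for y0 x
    by (rule Suc.IH) (simp add: Suc.prems)
  then show ?case by (simp add: pairing_sw pairing_lin_ext case_prod_unfold)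
qed simp

lemma (in hopf_algebroid) linear_form_twist_head:
  "list_form H (Suc (Suc (length us))) h \<Longrightarrow> linear_form (usc H) (\<lambda>u. twist H (u # us) c h)"
  using translation_linear[OF balanced_twist] by simp

context measured_hopf_modules
begin

text \<open>\<open>mlist [u\<^sup>1, \<dots>, u\<^sup>n] y f\<close> is \<open>f y\<^sub>0 [y\<^sub>1(u\<^sup>1), \<dots>, y\<^sub>n(u\<^sup>n)]\<close>, summation understood.\<close>

primrec mlist :: "'u list \<Rightarrow> 'd \<Rightarrow> ('d \<Rightarrow> 'u2 list \<Rightarrow> 'k) \<Rightarrow> 'k" where
  "mlist [] y f = f y []"
| "mlist (u # us) y f = mlist us y (\<lambda>z ws. mstep u z (\<lambda>z' w. f z' (w # ws)))"

lemma mlist_cong: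
  "(\<And>z ws. length ws = length us \<Longrightarrow> f z ws = g z ws) \<Longrightarrow> mlist us y f = mlist us y g"
proof (induction us arbitrary: f g)
  case (Cons u us)
  show ?case
    unfolding mlist.simps by (rule Cons.IH, rule mstep_cong) (simp add: Cons.prems)
qed simp

lemma mlist_ev: "mlist us y (\<lambda>z ws. ev X (\<lambda>(p, m). f p m z ws)) = ev X (\<lambda>(p, m). mlist us y (f p m))"
  by (induction us arbitrary: f) (simp_all add: mstep_ev)

lemma linear_form_mlist:
  "(\<And>z ws. length ws = length us \<Longrightarrow> linear_form s (\<lambda>v. f v z ws)) \<Longrightarrow> linear_form s (\<lambda>v. mlist us y (f v))"
proof (induction us arbitrary: f)
  case (Cons u us)
  show ?case
    unfolding mlist.simps by (rule Cons.IH, rule linear_form_mstep) (simp add: Cons.prems)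
qed simp

text \<open>The regularity that the laws of \<open>mstep\<close> ask for: balanced in the entries
  and linear in the parameter from D.\<close>

definition family_form :: "nat \<Rightarrow> ('d \<Rightarrow> 'u2 list \<Rightarrow> 'k) \<Rightarrow> bool" where
  "family_form n f \<longleftrightarrow> (\<forall>z. list_form H' n (f z)) \<and> (\<forall>ws. length ws = n \<longrightarrow> linear_form (dsc D) (\<lambda>z. f z ws))"

lemma family_form_list_form: "family_form n f \<Longrightarrow> list_form H' n (f z)"
  and family_form_linear: "family_form n f \<Longrightarrow> length ws = n \<Longrightarrow> linear_form (dsc D) (\<lambda>z. f z ws)"
  and family_form_head: "family_form (Suc n) f \<Longrightarrow> length ws = n \<Longrightarrow> linear_form (usc H') (\<lambda>w. f z (w # ws))"
  by (simp_all add: family_form_def)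

lemma family_form_tail:
  assumes f: "family_form (Suc n) f"
  shows "family_form n (\<lambda>z ws. mstep u z (\<lambda>z' w. f z' (w # ws)))"
  unfolding family_form_def
proof (intro conjI allI impI)
  show "list_form H' n (\<lambda>ws. mstep u z (\<lambda>z' w. f z' (w # ws)))" for z
    by (rule list_form_mstep) (rule list_form_tail[OF family_form_list_form[OF f]])
  show "linear_form (dsc D) (\<lambda>z. mstep u z (\<lambda>z' w. f z' (w # ws)))" if "length ws = n" for ws
    using that by (intro mstep_linear_right family_form_linear[OF f] family_form_head[OF f]) simp_all
qed

text \<open>The outermost coaction measures the last entry, in agreement with
  \<open>iter_coact_rep\<close>, which appends its C-leg at the end.\<close>

lemma mlist_snoc:
  "mlist (us @ [u]) y f = mstep u y (\<lambda>z w. mlist us z (\<lambda>z' ws. f z' (ws @ [w])))"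
  by (induction us arbitrary: f) simp_all

lemma pairing_iter_coact_rep:
  "length us = n \<Longrightarrow> pairing (iter_coact_rep D n y) (\<lambda>(z, xs). f z (map2 Psi xs us)) = mlist us y f"
proof (induction n arbitrary: y f us)
  case (Suc n)
  then obtain vs u where us: "us = vs @ [u]" "length vs = n"
    by (metis length_Suc_conv_rev)
  have "pairing (iter_coact_rep D n y0) (\<lambda>(z, xs). f z (map2 Psi (xs @ [x]) us)) =
      pairing (iter_coact_rep D n y0) (\<lambda>(z, xs). f z (map2 Psi xs vs @ [Psi x u]))" for y0 x
    by (rule pairing_iter_cong) (simp add: us)
  also have "\<dots> y0 x = mlist vs y0 (\<lambda>z ws. f z (ws @ [Psi x u]))" for y0 x
    by (rule Suc.IH[OF us(2)])
  finally show ?case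
    by (simp add: us(1) mlist_snoc mstep_def pairing_sw pairing_lin_ext case_prod_unfold)
qed simp

text \<open>Makes the measured tensor independent of the representative of the iterated coaction,
  which lives in a tensor product over the field.\<close>

lemma annihilates_iter_coact:
  assumes f: "family_form n f" and us: "length us = n"
  shows "annihilates (fspan (multilin_rels (dsc D) (csc C) n)) (\<lambda>(z, xs). f z (map2 Psi xs us))"
proof -
  have slot: "linear_form (csc C) (\<lambda>x. f z (map2 Psi (vs @ [x] @ ws) us))"
    if "length vs + 1 + length ws = n" for z vs ws
  proof -
    \<comment> \<open>Cutting \<open>us\<close> at the slot isolates the one entry that the varying
      C-leg measures.\<close>
    have split: "us = take (length vs) us @ [us ! length vs] @ drop (Suc (length vs)) us"
      using that us by (simp add: Cons_nth_drop_Suc)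
    have "map2 Psi (vs @ [x] @ ws) us =
        map2 Psi vs (take (length vs) us) @ [Psi x (us ! length vs)] @ map2 Psi ws (drop (Suc (length vs)) us)" for x
      using that us by (subst split) (simp add: min_def)
    moreover have "linear_form (usc H')
        (\<lambda>w. f z (map2 Psi vs (take (length vs) us) @ [w] @ map2 Psi ws (drop (Suc (length vs)) us)))"
      using family_form_list_form[OF f, of z] that us unfolding list_form_iff by simp
    ultimately show ?thesis
      by (simp only: Psi_form(2)[where f = "\<lambda>w. f z (map2 Psi vs (take (length vs) us) @ [w] @ _)"])
  qed
  have "linear_form (dsc D) (\<lambda>z. f z (map2 Psi xs us))" if "length xs = n" for xs
    using that us by (intro family_form_linear[OF f]) simp
  then show ?thesis
    using slot unfolding annihilates_fspan multilin_rels_def ball_Un ball_setcompr pairing_diff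
      pairing_gen pairing_fscale linear_form_def
    by simp
qed

lemma ev_iter_coact:
  assumes f: "family_form n f" and us: "length us = n"
  shows "r \<in> iter_coact C D n y \<Longrightarrow> pairing r (\<lambda>(z, xs). f z (map2 Psi xs us)) = mlist us y f"
    and "ev (iter_coact C D n y) (\<lambda>(z, xs). f z (map2 Psi xs us)) = mlist us y f"
  using annihilates_iter_coact[OF assms]
  by (simp_all add: iter_coact_def annihilates_member ev_cls pairing_iter_coact_rep us)

text \<open>The leg of t(a) lies between those of u and v, so it can be attributed to ut(a) or to
  t(a)v without any exchange of legs.\<close>

lemma list_form_mlist: "family_form n f \<Longrightarrow> list_form H n (\<lambda>us. mlist us y f)"
proof (induction n arbitrary: f)
  case (Suc n)
  note f = Suc.prems
  show ?case
    unfolding list_form.simps(2)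
  proof (intro conjI allI impI)
    show "list_form H n (\<lambda>us. mlist (u # us) y f)" for u
      unfolding mlist.simps by (rule Suc.IH[OF family_form_tail[OF f]])
    show "linear_form (usc H) (\<lambda>u. mlist (u # us) y f)" if "length us = n" for us
      unfolding mlist.simps using that
      by (intro linear_form_mlist mstep_linear_left family_form_head[OF f]) simp
    fix u a v and us :: "'u list"
    assume us: "Suc (length us) = n"
    have lin: "linear_form (dsc D) (\<lambda>z. f z (x # w # ws))" "linear_form (usc H') (\<lambda>w. f z (w # x # ws))"
        "linear_form (usc H') (\<lambda>w. f z (x # w # ws))"
      if "length ws = length us" for z x w ws
      using that us family_form_linear[OF f, of "x # w # ws"] family_form_head[OF f, of "x # ws" z]
        list_form_head[OF list_form_tail, of H' "length us" "f z" ws] family_form_list_form[OF f, of z]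
      by (auto simp del: list_form.simps)
    have "mstep v z (\<lambda>z w. mstep (u * tgt H a) z (\<lambda>z w'. f z (w' # w # ws))) =
        mstep (tgt H a * v) z (\<lambda>z w. mstep u z (\<lambda>z w'. f z (w' # w # ws)))"
      if ws: "length ws = length us" for z ws
    proof -
      have "mstep (u * tgt H a) z (\<lambda>z w'. f z (w' # w # ws)) =
          mstep (tgt H a) z (\<lambda>z c. mstep u z (\<lambda>z w'. f z (w' * c # w # ws)))" for z w
        by (rule mstep_mult) (rule lin[OF ws])+
      \<comment> \<open>The measured t(a) lies in the image of t', hence crosses to the next entry
        by the relation in U'.\<close>
      also have "\<dots> z w = mstep (tgt H a) z (\<lambda>z c. mstep u z (\<lambda>z w'. f z (w' # c * w # ws)))" for z w
        using list_form_shift[OF family_form_list_form[OF f]] ws us by (intro mstep_tgt_cong) simp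
      finally have "mstep v z (\<lambda>z w. mstep (u * tgt H a) z (\<lambda>z w'. f z (w' # w # ws))) =
          mstep v z (\<lambda>z w. mstep (tgt H a) z (\<lambda>z c. mstep u z (\<lambda>z w'. f z (w' # c * w # ws))))"
        by simp
      also have "\<dots> = mstep (tgt H a * v) z (\<lambda>z w. mstep u z (\<lambda>z w'. f z (w' # w # ws)))"
        by (rule mstep_mult[symmetric]) (rule mstep_linear_right linear_form_mstep lin[OF ws])+
      finally show ?thesis .
    qed
    then show "mlist (u * tgt H a # v # us) y f = mlist (u # tgt H a * v # us) y f"
      unfolding mlist.simps by (intro mlist_cong)
  qed
qed simp

text \<open>\<open>mstep_mult\<close> converts the single C-leg that measures the merged entry into
  the two adjacent legs that measure its factors.\<close>

lemma mlist_contract: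
  assumes \<phi>: "\<And>y v f. mstep (\<phi> v) y f = mstep v y (\<lambda>z w. f z (\<phi>' w))"
  shows "\<lbrakk>length us = Suc n; Suc k \<le> n; family_form n f\<rbrakk> \<Longrightarrow>
    mlist (contract \<phi> k us) y f = mlist us y (\<lambda>z ws. f z (contract \<phi>' k ws))"
proof (induction k arbitrary: n us f)
  case 0
  then obtain u v vs where us: "us = u # v # vs" "Suc (length vs) = n"
    by (auto simp: length_Suc_conv Suc_le_eq gr0_conv_Suc)
  have f: "family_form (Suc (length vs)) f" using 0 us by simp
  have "mstep (u * \<phi> v) z (\<lambda>z w. f z (w # ws)) =
      mstep v z (\<lambda>z w'. mstep u z (\<lambda>z w. f z (w * \<phi>' w' # ws)))" if "length ws = length vs" for z ws
  proof -
    have "mstep (u * \<phi> v) z (\<lambda>z w. f z (w # ws)) =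
        mstep (\<phi> v) z (\<lambda>z w'. mstep u z (\<lambda>z w. f z (w * w' # ws)))"
      using that by (intro mstep_mult family_form_linear[OF f] family_form_head[OF f]) simp_all
    then show ?thesis by (simp only: \<phi>)
  qed
  then show ?case unfolding us(1) contract_simps mlist.simps by (intro mlist_cong)
next
  case (Suc k)
  then obtain u vs m where us: "us = u # vs" and m: "length vs = Suc m" "n = Suc m"
    by (cases us; cases n) auto
  show ?case
    unfolding us contract_simps mlist.simps
    using Suc.prems m us by (intro Suc.IH[of _ m] family_form_tail) simp_all
qed

lemma mlist_insert:
  "\<lbrakk>k \<le> length us; family_form (Suc (length us)) f\<rbrakk> \<Longrightarrow>
    mlist (take k us @ [1] @ drop k us) y f = mlist us y (\<lambda>z ws. f z (take k ws @ [1] @ drop k ws))"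
proof (induction k arbitrary: us f)
  case 0
  note f = 0(2)
  have "mstep 1 z (\<lambda>z w. f z (w # ws)) = f z (1 # ws)" if "length ws = length us" for z ws
    using that by (intro mstep_one family_form_linear[OF f] family_form_head[OF f]) simp_all
  then show ?case by (auto intro: mlist_cong)
next
  case (Suc k)
  then obtain u vs where us: "us = u # vs" by (cases us) auto
  then show ?case using Suc.IH[of vs] Suc.prems family_form_tail by simp
qed

text \<open>The core of the compatibility with t_n. The C-leg of \<open>c\<close> precedes those of
  the entries on the left side, whereas on the right \<open>c\<close> belongs to the last entry.
  Each induction step exchanges legs by cocommutativity until u_- and \<open>c\<close> are adjacent,
  combines them into one entry, and absorbs the measured u_+ into the form.\<close>

lemma mlist_twist:
  "family_form (Suc (length us)) G \<Longrightarrow>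
    mlist us y (\<lambda>z ws. mstep c z (\<lambda>z c'. twist H' ws c' (G z))) = twist H us c (\<lambda>ws. mlist ws y G)"
proof (induction us arbitrary: c G)
  case (Cons u us)
  note G = Cons.prems
  have GH: "list_form H' (Suc (Suc (length us))) (G z)" for z
    using family_form_list_form[OF G] by (simp del: list_form.simps)
  have inner: "mstep u z (\<lambda>z w. mstep c z (\<lambda>z c'. twist H' (w # ws) c' (G z))) =
      ev (translation H u) (\<lambda>(p, m). mstep (m * c) z (\<lambda>z d.
        twist H' ws d (\<lambda>vs. mstep p z (\<lambda>z w. G z (w # vs)))))"
    if ws: "length ws = length us" for z ws
  proof -
    have GHw: "list_form H' (Suc (Suc (length ws))) (G z)" for z using GH ws by (simp del: list_form.simps)
    have Gz: "linear_form (dsc D) (\<lambda>z. G z vs)" if "length vs = Suc (Suc (length ws))" for vs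
      using that ws by (intro family_form_linear[OF G]) simp
    \<comment> \<open>Moving \<open>c\<close> outside makes the measurement of \<open>u\<close> the
      innermost one, where the translation rule applies.\<close>
    have "mstep u z (\<lambda>z w. mstep c z (\<lambda>z c'. twist H' (w # ws) c' (G z))) =
        mstep c z (\<lambda>z c'. mstep u z (\<lambda>z w. twist H' (w # ws) c' (G z)))"
      using GHw
      by (intro mstep_swap[where f = "\<lambda>z c' w. twist H' (w # ws) c' (G z)"] linear_form_twist Gz
          cod.linear_form_twist_end cod.linear_form_twist_head) (simp_all del: list_form.simps twist.simps)
    also have "\<dots> = mstep c z (\<lambda>z c'. ev (translation H u) (\<lambda>(p, m). mstep p z (\<lambda>z p'.
        mstep m z (\<lambda>z m'. twist H' ws (m' * c') (\<lambda>vs. G z (p' # vs))))))"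
      unfolding twist.simps
      by (intro mstep_cong mstep_translation cod.balanced_twist GHw linear_form_twist Gz) simp
    \<comment> \<open>Now the measurement of u_- is next to that of \<open>c\<close>, ready for
      \<open>mstep_mult\<close>.\<close>
    also have "\<dots> = mstep c z (\<lambda>z c'. ev (translation H u) (\<lambda>(p, m). mstep m z (\<lambda>z m'.
        mstep p z (\<lambda>z p'. twist H' ws (m' * c') (\<lambda>vs. G z (p' # vs))))))"
    proof -
      have "mstep p z (\<lambda>z p'. mstep m z (\<lambda>z m'. twist H' ws (m' * c') (\<lambda>vs. G z (p' # vs)))) =
          mstep m z (\<lambda>z m'. mstep p z (\<lambda>z p'. twist H' ws (m' * c') (\<lambda>vs. G z (p' # vs))))" for p m z c'
        by (rule mstep_swap[where f = "\<lambda>z m' p'. twist H' ws (m' * c') (\<lambda>vs. G z (p' # vs))"])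
          (rule linear_form_twist Gz balanced_right[OF cod.balanced_twist[OF GHw]]
            balanced_left[OF cod.balanced_twist[OF GHw]] | simp)+
      then show ?thesis by simp
    qed
    also have "\<dots> = ev (translation H u) (\<lambda>(p, m). mstep c z (\<lambda>z c'. mstep m z (\<lambda>z m'.
        twist H' ws (m' * c') (\<lambda>vs. mstep p z (\<lambda>z w. G z (w # vs))))))"
      by (simp only: mstep_ev twist_mstep)
    also have "\<dots> = ev (translation H u) (\<lambda>(p, m). mstep (m * c) z (\<lambda>z d.
        twist H' ws d (\<lambda>vs. mstep p z (\<lambda>z w. G z (w # vs)))))"
    proof -
      have tail: "family_form (Suc (length ws)) (\<lambda>z vs. mstep p z (\<lambda>z w. G z (w # vs)))" for p
        using G ws by (intro family_form_tail) simp
      have "mstep c z (\<lambda>z c'. mstep m z (\<lambda>z m'. twist H' ws (m' * c') (\<lambda>vs. mstep p z (\<lambda>z w. G z (w # vs))))) =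
          mstep (m * c) z (\<lambda>z d. twist H' ws d (\<lambda>vs. mstep p z (\<lambda>z w. G z (w # vs))))" for p m
        by (rule mstep_mult[symmetric], rule linear_form_twist, rule family_form_linear[OF tail], assumption)
          (rule cod.linear_form_twist_end[OF family_form_list_form[OF tail]])
      then show ?thesis by simp
    qed
    finally show ?thesis .
  qed
  have "mlist (u # us) y (\<lambda>z ws. mstep c z (\<lambda>z c'. twist H' ws c' (G z))) =
      ev (translation H u) (\<lambda>(p, m). mlist us y (\<lambda>z ws. mstep (m * c) z (\<lambda>z d.
        twist H' ws d (\<lambda>vs. mstep p z (\<lambda>z w. G z (w # vs))))))"
    unfolding mlist.simps mlist_ev[symmetric] by (intro mlist_cong inner)
  also have "\<dots> = ev (translation H u) (\<lambda>(p, m). twist H us (m * c) (\<lambda>ws. mlist (p # ws) y G))"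
  proof -
    have "mlist us y (\<lambda>z ws. mstep d z (\<lambda>z d. twist H' ws d (\<lambda>vs. mstep p z (\<lambda>z w. G z (w # vs))))) =
        twist H us d (\<lambda>ws. mlist (p # ws) y G)" for p d
      unfolding mlist.simps using G by (intro Cons.IH family_form_tail) simp
    then show ?thesis by simp
  qed
  finally show ?case by simp
qed simp

section \<open>Pullback of chain forms along the measured map\<close>

definition Om_pullback :: "'d \<Rightarrow> ('p2 \<Rightarrow> 'u2 list \<Rightarrow> 'k) \<Rightarrow> 'p \<Rightarrow> 'u list \<Rightarrow> 'k" where
  "Om_pullback y b p us = mlist us y (\<lambda>z ws. b (Om z p) ws)"

lemma family_form_Om:
  assumes "chain_form H' P' n b"
  shows "family_form n (\<lambda>z ws. b (Om z p) ws)"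
  using chain_form_list_form[OF assms] linear_form_compose[OF Om_linear_D chain_form_linear[OF assms]]
  by (simp add: family_form_def)

text \<open>y(pu) = y_(0)(p) y_(1)(u), so an action on P is measured as one more entry in front of
  the list.\<close>

lemma mlist_act:
  assumes b: "chain_form H' P' n b" and us: "length us = n"
    and \<phi>: "\<And>y v f. mstep (\<phi> v) y f = mstep v y (\<lambda>z w. f z (\<phi>' w))"
  shows "Om_pullback y b (ract P p (\<phi> u)) us =
    Om_pullback y (\<lambda>p us. b (ract P' p (\<phi>' (hd us))) (tl us)) p (u # us)"
proof -
  have "b (Om z (ract P p (\<phi> u))) ws = mstep u z (\<lambda>z w. b (ract P' (Om z p) (\<phi>' w)) ws)"
    if "length ws = length us" for z ws
    using that us unfolding \<phi>[symmetric, where f = "\<lambda>z w. b (ract P' (Om z p) w) ws"]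
    by (intro Om_ract_form[OF chain_form_linear[OF b]]) simp
  then show ?thesis unfolding Om_pullback_def mlist.simps by (auto intro: mlist_cong)
qed

text \<open>This makes the measured map well defined. y_(0)(pt(a)) is y_(0)(p) times a factor in the
  image of t'; it crosses to the next entry over A' and is reassembled there by
  \<open>mstep_mult\<close> as the measurement of t(a)u.\<close>

lemma chain_form_Om:
  assumes b: "chain_form H' P' n b"
  shows "chain_form H P n (Om_pullback y b)"
  unfolding chain_form_def
proof (intro conjI allI impI)
  show "linear_form (psc P) (\<lambda>p. Om_pullback y b p us)" if "length us = n" for us
    unfolding Om_pullback_def using that
    by (intro linear_form_mlist linear_form_compose[OF Om_linear_P chain_form_linear[OF b]]) simp
  show "list_form H n (Om_pullback y b p)" for p
    unfolding Om_pullback_def[abs_def] by (rule list_form_mlist[OF family_form_Om[OF b]])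
  fix p a u and us :: "'u list"
  assume us: "Suc (length us) = n"
  have "mstep u z (\<lambda>z w. b (Om z (ract P p (tgt H a))) (w # ws)) =
      mstep (tgt H a * u) z (\<lambda>z w. b (Om z p) (w # ws))" if ws: "length ws = length us" for z ws
  proof -
    have len: "length (w # ws) = n" for w using ws us by simp
    have "b (Om z (ract P p (tgt H a))) (w # ws) = mstep (tgt H a) z (\<lambda>z c. b (Om z p) (c * w # ws))" for z w
      unfolding Om_ract_form[OF chain_form_linear[OF b len]] using ws us
      by (intro mstep_tgt_cong) (simp add: chain_form_shift[OF b])
    then have "mstep u z (\<lambda>z w. b (Om z (ract P p (tgt H a))) (w # ws)) =
        mstep u z (\<lambda>z w. mstep (tgt H a) z (\<lambda>z c. b (Om z p) (c * w # ws)))"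
      by simp
    also have "\<dots> = mstep (tgt H a * u) z (\<lambda>z w. b (Om z p) (w # ws))"
      using family_form_Om[OF b, of p] len us ws
      by (intro mstep_mult[symmetric] family_form_linear[where f = "\<lambda>z. b (Om z p)"]
          family_form_head[where f = "\<lambda>z. b (Om z p)" and n = "length us"]) auto
    finally show ?thesis .
  qed
  then show "Om_pullback y b (ract P p (tgt H a)) (u # us) = Om_pullback y b p (tgt H a * u # us)"
    unfolding Om_pullback_def mlist.simps by (intro mlist_cong)
qed

lemma Om_pullback_face:
  assumes b: "chain_form H' P' (n - 1) b" and us: "length us = n" and "1 \<le> n" and "i \<le> n"
  shows "(case face_gen H P n i (p, us) of (p, us) \<Rightarrow> Om_pullback y b p us) =
    Om_pullback y (\<lambda>p us. case face_gen H' P' n i (p, us) of (p, us) \<Rightarrow> b p us) p us"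
proof -
  obtain m where n: "n = Suc m" using assms by (cases n) auto
  then obtain u vs where uvs: "us = u # vs" "length vs = m" using us by (cases us) auto
  have b: "chain_form H' P' m b" using b n by simp
  \<comment> \<open>The measurement evaluates its form only on lists of the length of
    \<open>us\<close>, where \<open>face_gen\<close> has its description by merges.\<close>
  have *: "Om_pullback y (\<lambda>p us. case face_gen H' P' n i (p, us) of (p, us) \<Rightarrow> b p us) p us =
      Om_pullback y g p us"
    if "\<And>p us. length us = n \<Longrightarrow> (case face_gen H' P' n i (p, us) of (p, us) \<Rightarrow> b p us) = g p us" for g
    unfolding Om_pullback_def using that us by (intro mlist_cong) simp
  note act = mlist_act[OF b uvs(2), folded uvs(1)]
  note contract = mlist_contract[OF _ _ _ family_form_Om[OF b], folded Om_pullback_def]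
  consider (last1) "i = 0" "n = 1" | (last) "i = 0" "n \<noteq> 1" | (first) "i \<noteq> 0" "i = n" | (mid) "i \<noteq> 0" "i \<noteq> n"
    by blast
  then show ?thesis
  proof cases
    case last1
    then show ?thesis
      using act[of "\<lambda>u. tgt H (counit H u)" "\<lambda>w. tgt H' (counit H' w)", OF mstep_tgt_counit] us uvs
      by (subst *[where g = "\<lambda>p us. b (ract P' p (tgt H' (counit H' (hd us)))) (tl us)"])
        (simp_all add: face_gen_eq)
  next
    case last
    then show ?thesis
      using contract[of "\<lambda>u. tgt H (counit H u)" "\<lambda>w. tgt H' (counit H' w)", OF mstep_tgt_counit, of us "n - 2"] us n
      by (subst *[where g = "\<lambda>p us. b p (contract (\<lambda>u. tgt H' (counit H' u)) (n - 2) us)"])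
        (simp_all add: face_gen_eq Om_pullback_def)
  next
    case first
    then show ?thesis
      using act[of "\<lambda>u. u" "\<lambda>w. w"] us uvs n
      by (subst *[where g = "\<lambda>p us. b (ract P' p (hd us)) (tl us)"])
        (simp_all add: face_gen_eq)
  next
    case mid
    then show ?thesis
      using contract[of "\<lambda>u. u" "\<lambda>w. w", of us "n - i - 1"] us n \<open>i \<le> n\<close>
      by (subst *[where g = "\<lambda>p us. b p (contract (\<lambda>u. u) (n - i - 1) us)"])
        (simp_all add: face_gen_eq Om_pullback_def)
  qed
qed

lemma Om_pullback_degen:
  assumes b: "chain_form H' P' (n + 1) b" and us: "length us = n"
  shows "(case degen_gen n i (p, us) of (p, us) \<Rightarrow> Om_pullback y b p us) =
    Om_pullback y (\<lambda>p us. case degen_gen n i (p, us) of (p, us) \<Rightarrow> b p us) p us"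
  unfolding degen_gen_def prod.case Om_pullback_def
  using family_form_Om[OF b] us by (intro mlist_insert) simp_all

text \<open>Compatibility of \<Omega> with the coactions measures p_(-1) along with the entries.
  \<open>mlist_twist\<close> moves the measurement through the translation maps, and
  \<open>mlist_act\<close> turns the action of the measured u^1_+ on y_(0)(p_(0)) into the
  measurement of p_(0)u^1_+.\<close>

lemma Om_pullback_cyc:
  assumes b: "chain_form H' P' n b" and us: "length us = n"
  shows "cyc_pullback H P n (Om_pullback y b) p us = Om_pullback y (cyc_pullback H' P' n b) p us"
proof (cases "n = 0")
  case True
  then show ?thesis by (simp add: cyc_pullback_def Om_pullback_def)
next
  case False
  define G where "G p0 z ws = b (ract P' (Om z p0) (hd ws)) (tl ws)" for p0 z ws
  have G: "family_form (Suc n) (G p0)" for p0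
    using cod.list_form_ract[OF b]
      linear_form_compose[OF Om_linear_D linear_form_compose[OF cod.ract_linear_P chain_form_linear[OF b]]]
    by (simp add: family_form_def G_def[abs_def] del: list_form.simps)
  have "Om_pullback y (cyc_pullback H' P' n b) p us =
      mlist us y (\<lambda>z ws. ev (pcoact P p) (\<lambda>(q, p0). mstep q z (\<lambda>z q'. twist H' ws q' (G p0 z))))"
    unfolding Om_pullback_def G_def using us False
    by (intro mlist_cong) (simp add: cyc_pullback_def Om_coact_form[OF cod.balanced_UP_twist[OF b]])
  also have "\<dots> = ev (pcoact P p) (\<lambda>(q, p0). twist H us q (\<lambda>ws. mlist ws y (G p0)))"
    unfolding mlist_ev using G us by (simp add: mlist_twist)
  also have "\<dots> = ev (pcoact P p) (\<lambda>(q, p0). twist H us q (\<lambda>ws. Om_pullback y b (ract P p0 (hd ws)) (tl ws)))"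
  proof -
    have "mlist ws y (G p0) = Om_pullback y b (ract P p0 (hd ws)) (tl ws)"
      if len: "length ws = Suc (length us)" for ws p0
    proof -
      obtain w vs where ws: "ws = w # vs" "length vs = n" using len us by (cases ws) auto
      show ?thesis
        using mlist_act[OF b ws(2), of "\<lambda>u. u" "\<lambda>w. w" y p0 w]
        by (simp add: ws(1) Om_pullback_def G_def[abs_def])
    qed
    then have "twist H us q (\<lambda>ws. mlist ws y (G p0)) =
        twist H us q (\<lambda>ws. Om_pullback y b (ract P p0 (hd ws)) (tl ws))" for q p0
      by (rule twist_cong)
    then show ?thesis by simp
  qed
  finally show ?thesis using False by (simp add: cyc_pullback_def)
qed

end

section \<open>Functoriality of Hochschild and cyclic homology\<close>

text \<open>Vector space laws relative to a carrier, with scaling by -1 as the additive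
  inverse.\<close>

locale kspace_laws =
  fixes M :: "('k::field, 'v) kspace"
  assumes add_closed: "\<lbrakk>x \<in> vcarrier M; y \<in> vcarrier M\<rbrakk> \<Longrightarrow> vadd M x y \<in> vcarrier M"
    and scale_closed: "x \<in> vcarrier M \<Longrightarrow> vscale M c x \<in> vcarrier M"
    and zero_closed: "vzero M \<in> vcarrier M"
    and add_assoc: "\<lbrakk>x \<in> vcarrier M; y \<in> vcarrier M; z \<in> vcarrier M\<rbrakk> \<Longrightarrow>
      vadd M (vadd M x y) z = vadd M x (vadd M y z)"
    and add_commute: "\<lbrakk>x \<in> vcarrier M; y \<in> vcarrier M\<rbrakk> \<Longrightarrow> vadd M x y = vadd M y x"
    and add_zero: "x \<in> vcarrier M \<Longrightarrow> vadd M x (vzero M) = x"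
    and add_minus: "x \<in> vcarrier M \<Longrightarrow> vadd M x (vscale M (-1) x) = vzero M"
    and scale_zero: "x \<in> vcarrier M \<Longrightarrow> vscale M 0 x = vzero M"
    and scale_scale: "x \<in> vcarrier M \<Longrightarrow> vscale M c (vscale M d x) = vscale M (c * d) x"
    and scale_add: "\<lbrakk>x \<in> vcarrier M; y \<in> vcarrier M\<rbrakk> \<Longrightarrow>
      vscale M c (vadd M x y) = vadd M (vscale M c x) (vscale M c y)"
begin

lemma add_left_commute:
  "\<lbrakk>x \<in> vcarrier M; y \<in> vcarrier M; z \<in> vcarrier M\<rbrakk> \<Longrightarrow> vadd M x (vadd M y z) = vadd M y (vadd M x z)"
  by (metis add_assoc add_commute)

lemmas add_ac = add_assoc add_commute add_left_commute
lemmas closed = add_closed scale_closed zero_closed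

lemma scale_vzero: "vscale M c (vzero M) = vzero M"
  by (metis mult_zero_right scale_scale scale_zero zero_closed)

lemma vsum_closed: "(\<And>i. i < m \<Longrightarrow> g i \<in> vcarrier M) \<Longrightarrow> vsum M g m \<in> vcarrier M"
  by (induction m) (auto simp: closed)

end

section \<open>Linear maps between spaces given by carriers\<close>

lemma vsum_cong: "(\<And>i. i < m \<Longrightarrow> f i = g i) \<Longrightarrow> vsum M f m = vsum M g m"
  by (induction m) auto

lemma linear_map_closed: "linear_map M N f \<Longrightarrow> x \<in> vcarrier M \<Longrightarrow> f x \<in> vcarrier N"
  and linear_map_add: "\<lbrakk>linear_map M N f; x \<in> vcarrier M; y \<in> vcarrier M\<rbrakk> \<Longrightarrow>
    f (vadd M x y) = vadd N (f x) (f y)"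
  and linear_map_scale: "\<lbrakk>linear_map M N f; x \<in> vcarrier M\<rbrakk> \<Longrightarrow> f (vscale M c x) = vscale N c (f x)"
  by (auto simp: linear_map_def)

lemma linear_mapI:
  assumes "\<And>x. x \<in> vcarrier M \<Longrightarrow> f x \<in> vcarrier N"
    and "\<And>x y. \<lbrakk>x \<in> vcarrier M; y \<in> vcarrier M\<rbrakk> \<Longrightarrow> f (vadd M x y) = vadd N (f x) (f y)"
    and "\<And>c x. x \<in> vcarrier M \<Longrightarrow> f (vscale M c x) = vscale N c (f x)"
  shows "linear_map M N f"
  using assms by (auto simp: linear_map_def)

lemma linear_map_zero:
  assumes "kspace_laws M" "kspace_laws N" "linear_map M N f"
  shows "f (vzero M) = vzero N"
proof -
  interpret M: kspace_laws M by fact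
  interpret N: kspace_laws N by fact
  have "f (vscale M 0 (vzero M)) = vscale N 0 (f (vzero M))"
    using assms(3) M.zero_closed by (rule linear_map_scale)
  then show ?thesis
    by (simp add: M.scale_zero M.zero_closed N.scale_zero linear_map_closed[OF assms(3)])
qed

lemma linear_map_ident: "linear_map M M (\<lambda>x. x)"
  by (rule linear_mapI) simp_all

lemma linear_map_comp:
  assumes "linear_map M N f" and "linear_map N L g"
  shows "linear_map M L (\<lambda>x. g (f x))"
  using assms by (intro linear_mapI) (simp_all add: linear_map_closed linear_map_add linear_map_scale)

lemma linear_map_funpow:
  assumes "linear_map M M f"
  shows "linear_map M M (f ^^ i)"
proof (induction i)
  case 0
  then show ?case using linear_map_ident by (simp add: id_def)
next
  case (Suc i)
  then show ?case using linear_map_comp[OF Suc assms] by (simp add: comp_def)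
qed

lemma linear_map_add_fun:
  assumes "kspace_laws N" "linear_map M N f" "linear_map M N g"
  shows "linear_map M N (\<lambda>x. vadd N (f x) (g x))"
proof -
  interpret N: kspace_laws N by fact
  show ?thesis
    using assms(2,3)
    by (intro linear_mapI)
      (simp_all add: linear_map_closed linear_map_add linear_map_scale N.closed N.add_ac N.scale_add)
qed

lemma linear_map_scale_fun:
  assumes "kspace_laws N" "linear_map M N f"
  shows "linear_map M N (\<lambda>x. vscale N c (f x))"
proof -
  interpret N: kspace_laws N by fact
  show ?thesis
    using assms(2)
    by (intro linear_mapI)
      (simp_all add: linear_map_closed linear_map_add linear_map_scale N.closed N.scale_add
        N.scale_scale mult.commute)
qed

lemma linear_map_vsum_fun:
  assumes "kspace_laws N" and "\<And>i. i < m \<Longrightarrow> linear_map M N (g i)"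
  shows "linear_map M N (\<lambda>x. vsum N (\<lambda>i. g i x) m)"
  using assms(2)
proof (induction m)
  case 0
  interpret N: kspace_laws N by fact
  show ?case by (rule linear_mapI) (simp_all add: N.closed N.add_zero N.scale_vzero)
next
  case (Suc m)
  then show ?case
    using linear_map_add_fun[OF assms(1), of M "\<lambda>x. vsum N (\<lambda>i. g i x) m" "g m"] by simp
qed

lemma linear_map_vsum:
  assumes "kspace_laws M" "kspace_laws N" "linear_map M N f"
    and "\<And>i. i < m \<Longrightarrow> g i \<in> vcarrier M"
  shows "f (vsum M g m) = vsum N (\<lambda>i. f (g i)) m"
  using assms(4)
proof (induction m)
  case 0
  then show ?case by (simp add: linear_map_zero[OF assms(1-3)])
next
  case (Suc m)
  then show ?case
    by (simp add: linear_map_add[OF assms(3)] kspace_laws.vsum_closed[OF assms(1)])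
qed

lemma (in kspace_laws) coset_eq:
  assumes B: "B \<subseteq> vcarrier M" "vzero M \<in> B" "\<And>x y. \<lbrakk>x \<in> B; y \<in> B\<rbrakk> \<Longrightarrow> vadd M x y \<in> B"
      "\<And>c x. x \<in> B \<Longrightarrow> vscale M c x \<in> B"
    and z: "z \<in> vcarrier M" and w: "w \<in> B"
  shows "coset M B (vadd M z w) = coset M B z"
proof -
  have in_carrier: "x \<in> vcarrier M" if "x \<in> B" for x using that B by auto
  have "vadd M (vadd M z w) v = vadd M z (vadd M w v)" if "v \<in> B" for v
    using z w that by (simp add: add_assoc in_carrier)
  \<comment> \<open>The shift by \<open>w\<close> is undone by the element -w + v of
    \<open>B\<close>.\<close>
  moreover have "vadd M z v = vadd M (vadd M z w) (vadd M (vscale M (-1) w) v)" if "v \<in> B" for v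
  proof -
    have "vadd M (vadd M z w) (vadd M (vscale M (-1) w) v) =
        vadd M (vadd M w (vscale M (-1) w)) (vadd M z v)"
      using z in_carrier[OF w] in_carrier[OF that] by (simp add: closed add_ac)
    also have "\<dots> = vadd M z v"
      using z in_carrier[OF w] in_carrier[OF that]
      by (subst add_commute) (simp_all add: closed add_minus add_zero)
    finally show ?thesis ..
  qed
  ultimately show ?thesis
    using B(3) B(3)[OF B(4)[OF w]] w unfolding coset_def by blast
qed

section \<open>Homology of a complex and the maps induced by chain maps\<close>

locale linear_complex =
  fixes K :: "('k::field, 'v) complex_data"
  assumes chains_laws: "kspace_laws (chains K n)"
    and bd_linear: "linear_map (chains K (Suc n)) (chains K n) (bd K (Suc n))"
begin

lemma boundaries_subspace:
  "boundaries K n \<subseteq> vcarrier (chains K n)" (is ?sub)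
  "vzero (chains K n) \<in> boundaries K n" (is ?zero)
  "\<And>x y. \<lbrakk>x \<in> boundaries K n; y \<in> boundaries K n\<rbrakk> \<Longrightarrow> vadd (chains K n) x y \<in> boundaries K n"
  "\<And>c x. x \<in> boundaries K n \<Longrightarrow> vscale (chains K n) c x \<in> boundaries K n"
proof -
  interpret kspace_laws "chains K (Suc n)" by (rule chains_laws)
  show ?sub
    using linear_map_closed[OF bd_linear] by (auto simp: boundaries_def)
  show ?zero
    using linear_map_zero[OF chains_laws chains_laws bd_linear, of n] zero_closed
    by (force simp: boundaries_def intro: rev_image_eqI)
  show "vadd (chains K n) x y \<in> boundaries K n" if "x \<in> boundaries K n" "y \<in> boundaries K n" for x y
    using that add_closed by (auto simp: boundaries_def linear_map_add[OF bd_linear, symmetric])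
  show "vscale (chains K n) c x \<in> boundaries K n" if "x \<in> boundaries K n" for c x
    using that scale_closed by (auto simp: boundaries_def linear_map_scale[OF bd_linear, symmetric])
qed

lemma boundaries_carrier: "x \<in> boundaries K n \<Longrightarrow> x \<in> vcarrier (chains K n)"
  using boundaries_subspace(1) by auto

lemma cycles_carrier: "z \<in> cycles K n \<Longrightarrow> z \<in> vcarrier (chains K n)"
  by (simp add: cycles_def)

lemma homology_carrier: "vcarrier (homology K n) = homology_class K n ` cycles K n"
  by (simp add: homology_def quotient_space_def homology_class_def[abs_def] coset_def)

lemma homology_add:
  assumes z: "z \<in> vcarrier (chains K n)" "z' \<in> vcarrier (chains K n)"
  shows "vadd (homology K n) (homology_class K n z) (homology_class K n z') =
    homology_class K n (vadd (chains K n) z z')"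
proof -
  interpret kspace_laws "chains K n" by (rule chains_laws)
  have regroup: "vadd (chains K n) (vadd (chains K n) z v) (vadd (chains K n) z' v') =
      vadd (chains K n) (vadd (chains K n) z z') (vadd (chains K n) v v')"
    if "v \<in> boundaries K n" "v' \<in> boundaries K n" for v v'
    using z that boundaries_carrier by (simp add: closed add_ac)
  have "\<exists>v v'. v \<in> boundaries K n \<and> v' \<in> boundaries K n \<and> vadd (chains K n) (vadd (chains K n) z z') w =
      vadd (chains K n) (vadd (chains K n) z v) (vadd (chains K n) z' v')" if "w \<in> boundaries K n" for w
    using that boundaries_subspace(2) regroup[OF that boundaries_subspace(2)] boundaries_carrier add_zero
    by metis
  then show ?thesis
    using regroup boundaries_subspace(3)
    by (auto simp: homology_def quotient_space_def homology_class_def coset_def) metis+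
qed

lemma homology_scale:
  assumes z: "z \<in> vcarrier (chains K n)"
  shows "vscale (homology K n) c (homology_class K n z) = homology_class K n (vscale (chains K n) c z)"
proof -
  interpret kspace_laws "chains K n" by (rule chains_laws)
  have regroup: "vadd (chains K n) (vscale (chains K n) c (vadd (chains K n) z v)) v' =
      vadd (chains K n) (vscale (chains K n) c z) (vadd (chains K n) (vscale (chains K n) c v) v')"
    if "v \<in> boundaries K n" "v' \<in> boundaries K n" for v v'
    using z that boundaries_carrier by (simp add: closed add_ac scale_add)
  have "vadd (chains K n) z (vzero (chains K n)) = z" using z add_zero by simp
  then have "\<exists>v. v \<in> boundaries K n \<and> vadd (chains K n) z v = z"
    using boundaries_subspace(2) by blast
  then show ?thesis
    using regroup boundaries_subspace(3)[OF boundaries_subspace(4)]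
    by (auto simp: homology_def quotient_space_def homology_class_def coset_def) metis+
qed

lemma cycles_subspace:
  assumes z: "z \<in> cycles K n" "z' \<in> cycles K n"
  shows "vadd (chains K n) z z' \<in> cycles K n" and "vscale (chains K n) c z \<in> cycles K n"
proof -
  have bd: "linear_map (chains K n) (chains K (n - 1)) (bd K n)" if "1 \<le> n"
    using bd_linear[of "n - 1"] that by simp
  interpret n: kspace_laws "chains K n" by (rule chains_laws)
  interpret m: kspace_laws "chains K (n - Suc 0)" by (rule chains_laws)
  show "vadd (chains K n) z z' \<in> cycles K n" "vscale (chains K n) c z \<in> cycles K n"
    using z by (auto simp: cycles_def n.closed linear_map_add[OF bd] linear_map_scale[OF bd]
        m.add_zero m.zero_closed m.scale_vzero)
qed

lemma homology_class_shift:
  "\<lbrakk>z \<in> vcarrier (chains K n); w \<in> boundaries K n\<rbrakk> \<Longrightarrow>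
    homology_class K n (vadd (chains K n) z w) = homology_class K n z"
  unfolding homology_class_def
  by (rule kspace_laws.coset_eq[OF chains_laws boundaries_subspace])

end

text \<open>The representative chosen in \<open>homology_map\<close> differs from \<open>z\<close>
  by a boundary, and a chain map sends boundaries to boundaries.\<close>

lemma induces_on_homologyI:
  assumes "linear_complex K" and "linear_complex L"
    and f: "\<And>n. linear_map (chains K n) (chains L n) (f n)"
    and comm: "\<And>n x. x \<in> vcarrier (chains K (Suc n)) \<Longrightarrow> f n (bd K (Suc n) x) = bd L (Suc n) (f (Suc n) x)"
  shows "induces_on_homology K L f"
  unfolding induces_on_homology_def
proof (intro allI conjI ballI)
  interpret K: linear_complex K by fact
  interpret L: linear_complex L by fact
  fix n
  show f_cycle: "f n z \<in> cycles L n" if z: "z \<in> cycles K n" for z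
  proof -
    have "bd L n (f n z) = vzero (chains L (n - 1))" if n: "1 \<le> n"
    proof -
      obtain m where m: "n = Suc m" using n by (cases n) auto
      have "bd L n (f n z) = f m (bd K n z)" using comm[of z m] z m by (simp add: cycles_def)
      also have "\<dots> = vzero (chains L m)"
        using z m linear_map_zero[OF K.chains_laws L.chains_laws f, of m] by (simp add: cycles_def)
      finally show ?thesis using m by simp
    qed
    then show ?thesis using z linear_map_closed[OF f] by (simp add: cycles_def)
  qed
  have f_bdry: "f n w \<in> boundaries L n" if "w \<in> boundaries K n" for w
    using that linear_map_closed[OF f, of _ "Suc n"] comm by (auto simp: boundaries_def)
  show map_class: "homology_map L f n (homology_class K n z) = homology_class L n (f n z)"
    if z: "z \<in> cycles K n" for z
  proof -
    have "z \<in> homology_class K n z"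
      using kspace_laws.add_zero[OF K.chains_laws K.cycles_carrier[OF z]] K.boundaries_subspace(2)
      by (force simp: homology_class_def coset_def)
    then have "(SOME z'. z' \<in> homology_class K n z) \<in> homology_class K n z" by (rule someI)
    then obtain w where w: "w \<in> boundaries K n"
        "(SOME z'. z' \<in> homology_class K n z) = vadd (chains K n) z w"
      by (auto simp: homology_class_def coset_def)
    then show ?thesis
      using z K.cycles_carrier linear_map_closed[OF f]
      by (simp add: homology_map_def linear_map_add[OF f] K.boundaries_carrier L.homology_class_shift f_bdry)
  qed
  note simps = K.homology_add L.homology_add K.homology_scale L.homology_scale K.cycles_carrier map_class
    K.cycles_subspace linear_map_add[OF f] linear_map_scale[OF f] linear_map_closed[OF f]
  show "linear_map (homology K n) (homology L n) (homology_map L f n)"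
    by (rule linear_mapI) (auto simp: K.homology_carrier L.homology_carrier simps f_cycle)
qed

section \<open>The Hochschild complex and the total complex of Tsygan's bicomplex\<close>

definition linear_cyclic :: "('k::field, 'v) cyclic_data \<Rightarrow> bool" where
  "linear_cyclic M \<longleftrightarrow> (\<forall>n. kspace_laws (level M n)) \<and>
     (\<forall>n i. i \<le> Suc n \<longrightarrow> linear_map (level M (Suc n)) (level M n) (face M (Suc n) i)) \<and>
     (\<forall>n. linear_map (level M n) (level M n) (cyc M n))"

lemma linear_map_alt_faces:
  assumes "linear_cyclic M" and "m \<le> Suc (Suc n)"
  shows "linear_map (level M (Suc n)) (level M n) (alt_faces M (Suc n) m)"
  unfolding alt_faces_def[abs_def] using assms
  by (simp add: linear_cyclic_def linear_map_vsum_fun linear_map_scale_fun)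

lemma linear_map_signed_cyc: "linear_cyclic M \<Longrightarrow> linear_map (level M n) (level M n) (signed_cyc M n)"
  unfolding signed_cyc_def[abs_def] by (simp add: linear_cyclic_def linear_map_scale_fun)

lemma linear_map_one_minus_cyc: "linear_cyclic M \<Longrightarrow> linear_map (level M n) (level M n) (one_minus_cyc M n)"
  unfolding one_minus_cyc_def[abs_def]
  by (simp add: linear_map_add_fun linear_map_ident linear_map_scale_fun linear_map_signed_cyc linear_cyclic_def)

lemma linear_map_cyc_norm: "linear_cyclic M \<Longrightarrow> linear_map (level M n) (level M n) (cyc_norm M n)"
  unfolding cyc_norm_def[abs_def]
  by (intro linear_map_vsum_fun linear_map_funpow linear_map_signed_cyc) (simp_all add: linear_cyclic_def)

context
  fixes M :: "('k::field, 'v) cyclic_data" and N :: "('k, 'w) cyclic_data" and f :: "nat \<Rightarrow> 'v \<Rightarrow> 'w"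
  assumes M: "linear_cyclic M" and N: "linear_cyclic N" and f: "cyclic_morphism M N f"
begin

lemma level_laws: "kspace_laws (level M n)" "kspace_laws (level N n)"
  and morphism_linear: "linear_map (level M n) (level N n) (f n)"
  using M N f by (simp_all add: linear_cyclic_def cyclic_morphism_def)

text \<open>Stated for any number \<open>m\<close> of faces so that it serves both b and b', which
  in degree n + 1 take n + 2 and n + 1 faces.\<close>

lemma alt_faces_commute:
  assumes x: "x \<in> vcarrier (level M (Suc n))" and m: "m \<le> Suc (Suc n)"
  shows "f n (alt_faces M (Suc n) m x) = alt_faces N (Suc n) m (f (Suc n) x)"
proof -
  have face: "face M (Suc n) i x \<in> vcarrier (level M n)"
    and comm: "f n (face M (Suc n) i x) = face N (Suc n) i (f (Suc n) x)" if "i < m" for i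
  proof -
    have i: "i \<le> Suc n" using that m by simp
    show "face M (Suc n) i x \<in> vcarrier (level M n)"
      using M i x linear_map_closed by (fastforce simp: linear_cyclic_def)
    have "\<forall>n i. \<forall>x\<in>vcarrier (level M n). 1 \<le> n \<longrightarrow> i \<le> n \<longrightarrow>
        f (n - 1) (face M n i x) = face N n i (f n x)"
      using f by (simp add: cyclic_morphism_def)
    from this[rule_format, OF x, of i] i
    show "f n (face M (Suc n) i x) = face N (Suc n) i (f (Suc n) x)" by simp
  qed
  then show ?thesis
    unfolding alt_faces_def diff_Suc_1
    using linear_map_vsum[OF level_laws morphism_linear, of m "\<lambda>i. vscale (level M n) ((- 1) ^ i) (face M (Suc n) i x)" n]
    by (simp add: kspace_laws.scale_closed[OF level_laws(1)] linear_map_scale[OF morphism_linear] cong: vsum_cong)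
qed

lemma signed_cyc_commute:
  assumes x: "x \<in> vcarrier (level M n)"
  shows "f n (signed_cyc M n x) = signed_cyc N n (f n x)"
proof -
  have "cyc M n x \<in> vcarrier (level M n)"
    using M x linear_map_closed by (fastforce simp: linear_cyclic_def)
  then show ?thesis
    using f x by (simp add: signed_cyc_def linear_map_scale[OF morphism_linear] cyclic_morphism_def)
qed

lemma one_minus_cyc_commute:
  assumes x: "x \<in> vcarrier (level M n)"
  shows "f n (one_minus_cyc M n x) = one_minus_cyc N n (f n x)"
  using x linear_map_closed[OF linear_map_signed_cyc[OF M] x]
  by (simp add: one_minus_cyc_def linear_map_add[OF morphism_linear] linear_map_scale[OF morphism_linear]
      kspace_laws.scale_closed[OF level_laws(1)] signed_cyc_commute)

lemma cyc_norm_commute: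
  assumes x: "x \<in> vcarrier (level M n)"
  shows "f n (cyc_norm M n x) = cyc_norm N n (f n x)"
proof -
  have pow: "(signed_cyc M n ^^ i) x \<in> vcarrier (level M n)" for i
    by (rule linear_map_closed[OF linear_map_funpow[OF linear_map_signed_cyc[OF M]] x])
  have "f n ((signed_cyc M n ^^ i) x) = (signed_cyc N n ^^ i) (f n x)" for i
    by (induction i) (simp_all add: signed_cyc_commute pow)
  then show ?thesis
    unfolding cyc_norm_def
    using linear_map_vsum[OF level_laws morphism_linear, of "n + 1" "\<lambda>i. (signed_cyc M n ^^ i) x" n] pow
    by simp
qed

lemma hochschild_induced:
  "induces_on_homology (hochschild_complex M) (hochschild_complex N) f"
  by (intro induces_on_homologyI linear_complex.intro)
    (simp_all add: hochschild_complex_def level_laws morphism_linear linear_map_alt_faces M N alt_faces_commute)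

end

lemma kspace_laws_cyclic_chains:
  assumes M: "linear_cyclic M"
  shows "kspace_laws (cyclic_chains M n)"
proof -
  have L: "kspace_laws (level M q)" for q using M by (simp add: linear_cyclic_def)
  note laws = kspace_laws.closed[OF L] kspace_laws.add_zero[OF L] kspace_laws.add_minus[OF L]
    kspace_laws.scale_zero[OF L] kspace_laws.scale_scale[OF L] kspace_laws.scale_add[OF L]
  show ?thesis
  proof
    fix x y z
    assume xyz: "x \<in> vcarrier (cyclic_chains M n)" "y \<in> vcarrier (cyclic_chains M n)"
    show "vadd (cyclic_chains M n) x y = vadd (cyclic_chains M n) y x"
      using xyz kspace_laws.add_commute[OF L] by (auto simp: cyclic_chains_def PiE_iff intro!: restrict_ext)
    assume "z \<in> vcarrier (cyclic_chains M n)"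
    with xyz show "vadd (cyclic_chains M n) (vadd (cyclic_chains M n) x y) z =
        vadd (cyclic_chains M n) x (vadd (cyclic_chains M n) y z)"
      using kspace_laws.add_assoc[OF L] by (auto simp: cyclic_chains_def PiE_iff intro!: restrict_ext)
  next
    fix x
    assume "x \<in> vcarrier (cyclic_chains M n)"
    \<comment> \<open>Elements of the extensional product are \<open>undefined\<close> beyond row
      \<open>n\<close>, and so is the restricted sum.\<close>
    then show "vadd (cyclic_chains M n) x (vzero (cyclic_chains M n)) = x"
      by (auto simp: cyclic_chains_def PiE_iff laws extensional_def fun_eq_iff)
  qed (auto simp: cyclic_chains_def PiE_iff laws intro!: restrict_ext)
qed

lemma linear_map_cyclic_bd:
  assumes M: "linear_cyclic M"
  shows "linear_map (cyclic_chains M (Suc n)) (cyclic_chains M n) (cyclic_bd M (Suc n))"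
proof -
  have L: "kspace_laws (level M q)" for q using M by (simp add: linear_cyclic_def)
  \<comment> \<open>The entry in row q of the total boundary out of degree n + 1. Its column is n -
    q, which decides between b with 1 - t and -b' with the norm.\<close>
  define e where "e q = (\<lambda>x. if even (n - q)
     then vadd (level M q) (alt_faces M (q + 1) (q + 2) (x (q + 1))) (one_minus_cyc M q (x q))
     else vadd (level M q) (vscale (level M q) (-1) (alt_faces M (q + 1) (q + 1) (x (q + 1))))
            (cyc_norm M q (x q)))" for q
  have proj: "linear_map (cyclic_chains M (Suc n)) (level M q) (\<lambda>x. x q)" if "q \<le> Suc n" for q
    using that by (auto intro!: linear_mapI simp: cyclic_chains_def)
  have e: "linear_map (cyclic_chains M (Suc n)) (level M q) (e q)" if q: "q \<le> n" for q
  proof -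
    have faces: "linear_map (cyclic_chains M (Suc n)) (level M q) (\<lambda>x. alt_faces M (q + 1) m (x (q + 1)))"
      if "m \<le> q + 2" for m
      using linear_map_comp[OF proj[of "Suc q"] linear_map_alt_faces[OF M, of m q]] q that by simp
    show ?thesis
      unfolding e_def
      using q faces linear_map_comp[OF proj linear_map_one_minus_cyc[OF M], of q]
        linear_map_comp[OF proj linear_map_cyc_norm[OF M], of q]
      by (cases "even (n - q)") (simp_all add: linear_map_add_fun linear_map_scale_fun L)
  qed
  have "cyclic_bd M (Suc n) = (\<lambda>x. \<lambda>q\<in>{..n}. e q x)"
    by (simp add: cyclic_bd_def[abs_def] e_def)
  then show ?thesis
    by (intro linear_mapI)
      (auto simp: cyclic_chains_def[of _ n] linear_map_closed[OF e] linear_map_add[OF e] linear_map_scale[OF e]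
        intro!: restrict_ext)
qed

text \<open>All four differentials b, -b', 1 - t and the norm are linear expressions in faces and t,
  so the rowwise map commutes with the total boundary.\<close>

lemma cyclic_induced:
  assumes M: "linear_cyclic M" and N: "linear_cyclic N" and f: "cyclic_morphism M N f"
  shows "induces_on_homology (cyclic_complex M) (cyclic_complex N) (total_map f)"
proof (rule induces_on_homologyI)
  note linear = morphism_linear[OF M N f] and laws = level_laws[OF M N f]
  show "linear_map (chains (cyclic_complex M) n) (chains (cyclic_complex N) n) (total_map f n)" for n
    unfolding cyclic_complex_def complex_data.simps
    by (intro linear_mapI)
      (auto simp: total_map_def cyclic_chains_def PiE_iff linear_map_closed[OF linear]
        linear_map_add[OF linear] linear_map_scale[OF linear] intro!: restrict_ext)
  fix n x
  assume "x \<in> vcarrier (chains (cyclic_complex M) (Suc n))"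
  then have x: "x q \<in> vcarrier (level M q)" if "q \<le> Suc n" for q
    using that by (auto simp: cyclic_complex_def cyclic_chains_def)
  have faces: "alt_faces M (Suc q) m (x (Suc q)) \<in> vcarrier (level M q)"
    if "q \<le> n" "m \<le> Suc (Suc q)" for q m
    using that by (intro linear_map_closed[OF linear_map_alt_faces[OF M]] x) simp_all
  have "f q (cyclic_bd M (Suc n) x q) = cyclic_bd N (Suc n) (total_map f (Suc n) x) q" if q: "q \<le> n" for q
    using q x[of q] x[of "Suc q"] faces[of q]
      linear_map_closed[OF linear_map_one_minus_cyc[OF M], of "x q" q]
      linear_map_closed[OF linear_map_cyc_norm[OF M], of "x q" q]
    by (simp add: cyclic_bd_def total_map_def linear_map_add[OF linear] linear_map_scale[OF linear]
        kspace_laws.scale_closed[OF laws(1)] alt_faces_commute[OF M N f] one_minus_cyc_commute[OF M N f]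
        cyc_norm_commute[OF M N f])
  then show "total_map f n (bd (cyclic_complex M) (Suc n) x) =
      bd (cyclic_complex N) (Suc n) (total_map f (Suc n) x)"
    by (simp add: cyclic_complex_def total_map_def[of f n])
      (auto simp: fun_eq_iff cyclic_bd_def)
qed (intro linear_complex.intro; simp add: cyclic_complex_def kspace_laws_cyclic_chains linear_map_cyclic_bd M N)+

section \<open>Maps induced on the chain spaces\<close>

lemma keys_subspace: "free.subspace {r :: 'x \<Rightarrow>\<^sub>0 'k::field. Poly_Mapping.keys r \<subseteq> B}"
  unfolding free.subspace_def
proof (intro conjI ballI allI)
  show "x + y \<in> {r. Poly_Mapping.keys r \<subseteq> B}" if "x \<in> {r. Poly_Mapping.keys r \<subseteq> B}" "y \<in> {r. Poly_Mapping.keys r \<subseteq> B}"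
    for x y :: "'x \<Rightarrow>\<^sub>0 'k"
    using that keys_add[of x y] by auto
  show "fscale c x \<in> {r. Poly_Mapping.keys r \<subseteq> B}" if "x \<in> {r. Poly_Mapping.keys r \<subseteq> B}"
    for c and x :: "'x \<Rightarrow>\<^sub>0 'k"
    using that keys_fscale[of c x] by auto
qed simp

lemma keys_lin_ext:
  assumes "\<And>x. x \<in> Poly_Mapping.keys r \<Longrightarrow> Poly_Mapping.keys (g x) \<subseteq> B"
  shows "Poly_Mapping.keys (lin_ext fscale g r) \<subseteq> B"
proof -
  have "lin_ext fscale g r \<in> {r. Poly_Mapping.keys r \<subseteq> B}"
    unfolding lin_ext_def
    by (intro free.subspace_sum free.subspace_scale keys_subspace) (simp add: assms)
  then show ?thesis by simp
qed

lemma keys_closed: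
  fixes r r' :: "'x \<Rightarrow>\<^sub>0 'k::field"
  assumes "Poly_Mapping.keys r \<subseteq> B"
  shows "Poly_Mapping.keys r' \<subseteq> B \<Longrightarrow> Poly_Mapping.keys (r + r') \<subseteq> B"
    and "Poly_Mapping.keys r' \<subseteq> B \<Longrightarrow> Poly_Mapping.keys (r - r') \<subseteq> B"
    and "Poly_Mapping.keys (fscale c r) \<subseteq> B"
  using assms free.subspace_add[OF keys_subspace, of r B r'] free.subspace_diff[OF keys_subspace, of r B r']
    free.subspace_scale[OF keys_subspace, of r B c]
  by simp_all

lemma kspace_laws_quotient:
  fixes W :: "('x \<Rightarrow>\<^sub>0 'k::field) set"
  assumes W: "free.subspace W"
  shows "kspace_laws (quotient_space (free_space B) W)"
proof -
  define S where "S = {r :: 'x \<Rightarrow>\<^sub>0 'k. Poly_Mapping.keys r \<subseteq> B}"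
  have S: "free.subspace S" unfolding S_def by (rule keys_subspace)
  have carrier: "vcarrier (quotient_space (free_space B) W) = cls W ` S"
    by (simp add: quotient_carrier S_def)
  show ?thesis
    by unfold_locales
      (auto simp: carrier quotient_add[OF W] quotient_scale[OF W] quotient_zero
          free.scale_right_distrib add_ac
        intro!: imageI free.subspace_add[OF S] free.subspace_scale[OF S] free.subspace_0[OF S])
qed

lemma fspan_keys:
  "(\<And>g. g \<in> G \<Longrightarrow> Poly_Mapping.keys g \<subseteq> B) \<Longrightarrow> r \<in> fspan G \<Longrightarrow> Poly_Mapping.keys r \<subseteq> B"
  using free.span_minimal[OF _ keys_subspace, of G B] by blast

text \<open>The relations are supported on \<open>B\<close>, so even the representative chosen by
  \<open>SOME\<close> is. For chain spaces this guarantees lists of the right length, without which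
  \<open>hd\<close>, \<open>!\<close> and \<open>map2\<close> would not have their intended
  meaning.\<close>

lemma quotient_rep:
  assumes W: "free.subspace W" "\<And>w. w \<in> W \<Longrightarrow> Poly_Mapping.keys w \<subseteq> B"
    and X: "X \<in> vcarrier (quotient_space (free_space B) W)"
  shows "Poly_Mapping.keys (SOME r. r \<in> X) \<subseteq> B" and "X \<in> range (cls W)"
proof -
  obtain r where r: "X = cls W r" "Poly_Mapping.keys r \<subseteq> B" using X by (auto simp: quotient_carrier)
  show "X \<in> range (cls W)" using r by simp
  have "r \<in> X" using r W by (simp add: mem_clsI free.subspace_0)
  then have "(SOME r. r \<in> X) \<in> X" by (rule someI)
  then obtain w where "w \<in> W" "(SOME r. r \<in> X) = r + w" by (auto simp: r(1) cls_eq)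
  then show "Poly_Mapping.keys (SOME r. r \<in> X) \<subseteq> B"
    using W(2) keys_closed(1)[OF r(2)] by simp
qed

lemma ev_induced:
  "\<lbrakk>free.subspace W'; annihilates W' f\<rbrakk> \<Longrightarrow> ev (cls W' (sw X g)) f = ev X (\<lambda>x. pairing (g x) f)"
  by (simp add: ev_cls pairing_sw)

text \<open>Dual criterion for descent: if pullback preserves annihilating forms, two
  representatives of a coset have the same value under every form on the target and hence the same
  image.\<close>

lemma linear_map_induced:
  assumes W: "free.subspace W" "\<And>w. w \<in> W \<Longrightarrow> Poly_Mapping.keys w \<subseteq> B" and W': "free.subspace W'"
    and keys: "\<And>x. x \<in> B \<Longrightarrow> Poly_Mapping.keys (g x) \<subseteq> B'"
    and g: "\<And>f. annihilates W' f \<Longrightarrow> annihilates W (\<lambda>x. pairing (g x) f)"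
  shows "linear_map (quotient_space (free_space B) W) (quotient_space (free_space B') W') (\<lambda>X. cls W' (sw X g))"
proof (rule linear_mapI)
  fix X Y c
  assume X: "X \<in> vcarrier (quotient_space (free_space B) W)"
  have "Poly_Mapping.keys (sw X g) \<subseteq> B'"
    unfolding sweedler_def using quotient_rep(1)[OF W X] by (intro keys_lin_ext keys) blast
  then show "cls W' (sw X g) \<in> vcarrier (quotient_space (free_space B') W')"
    by (auto simp: quotient_carrier)
  obtain r where r: "X = cls W r" using quotient_rep(2)[OF W X] by blast
  show "cls W' (sw (vscale (quotient_space (free_space B) W) c X) g) =
      vscale (quotient_space (free_space B') W') c (cls W' (sw X g))"
    unfolding quotient_scale[OF W'] r quotient_scale[OF W(1)]
    by (rule cls_eqI[OF W']) (simp add: pairing_sw ev_cls[OF W(1) g])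
  assume Y: "Y \<in> vcarrier (quotient_space (free_space B) W)"
  obtain r' where r': "Y = cls W r'" using quotient_rep(2)[OF W Y] by blast
  show "cls W' (sw (vadd (quotient_space (free_space B) W) X Y) g) =
      vadd (quotient_space (free_space B') W') (cls W' (sw X g)) (cls W' (sw Y g))"
    unfolding quotient_add[OF W'] r r' quotient_add[OF W(1)]
    by (rule cls_eqI[OF W']) (simp add: pairing_sw ev_cls[OF W(1) g])
qed

lemma keys_multilin_rels:
  assumes "g \<in> multilin_rels sp su n"
  shows "Poly_Mapping.keys g \<subseteq> {(p, us). length us = n}"
  using assms unfolding multilin_rels_def
  by (elim UnE CollectE exE conjE) ((simp only:), (intro keys_closed; simp))+

lemma keys_rel_C:
  assumes "w \<in> rel_C H P n"
  shows "Poly_Mapping.keys w \<subseteq> {(p, us). length us = n}"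
proof (rule fspan_keys[OF _ assms[unfolded rel_C_def]])
  fix g
  assume "g \<in> multilin_rels (psc P) (usc H) n \<union>
     {gen (ract P p (tgt H a), [u] @ us) - gen (p, [tgt H a * u] @ us) | p a u us. 1 + length us = n} \<union>
     {gen (p, vs @ [u * tgt H a, v] @ ws) - gen (p, vs @ [u, tgt H a * v] @ ws)
        | p vs u a v ws. length vs + 2 + length ws = n}"
  then consider "g \<in> multilin_rels (psc P) (usc H) n"
    | p a u us where "g = gen (ract P p (tgt H a), [u] @ us) - gen (p, [tgt H a * u] @ us)" "1 + length us = n"
    | p vs u a v ws where "g = gen (p, vs @ [u * tgt H a, v] @ ws) - gen (p, vs @ [u, tgt H a * v] @ ws)"
        "length vs + 2 + length ws = n"
    by blast
  then show "Poly_Mapping.keys g \<subseteq> {(p, us). length us = n}"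
  proof cases
    case 1
    then show ?thesis by (rule keys_multilin_rels)
  qed ((simp only:), (intro keys_closed; simp))+
qed

lemma keys_plus_minus: "Poly_Mapping.keys (plus_minus H us) \<subseteq> {(vs, m). length vs = length us}"
proof (induction us)
  case (Cons u us)
  show ?case
    unfolding plus_minus.simps sweedler_def case_prod_unfold
    by (intro keys_lin_ext) (auto dest!: subsetD[OF Cons])
qed simp

lemma keys_cyc_gen:
  assumes us: "length us = n"
  shows "Poly_Mapping.keys (cyc_gen H P n (p, us)) \<subseteq> {(p, us). length us = n}"
proof (cases "n = 0")
  case False
  then show ?thesis
    unfolding cyc_gen_def sweedler_def case_prod_unfold using keys_plus_minus[of H us] us
    by (auto intro!: keys_lin_ext simp del: keys_single) auto
qed (use us in \<open>auto simp: cyc_gen_def\<close>)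

lemma length_face_gen:
  "\<lbrakk>length us = Suc n; i \<le> Suc n\<rbrakk> \<Longrightarrow> length (snd (face_gen H P (Suc n) i (p, us))) = n"
  by (auto simp: face_gen_def)

lemma keys_iter_coact_rep: "Poly_Mapping.keys (iter_coact_rep D n y) \<subseteq> {(z, xs). length xs = n}"
proof (induction n arbitrary: y)
  case (Suc n)
  show ?case
    unfolding iter_coact_rep.simps sweedler_def case_prod_unfold
    by (intro keys_lin_ext) (auto dest!: subsetD[OF Suc])
qed simp

text \<open>Ensures that \<open>map2\<close> in \<open>Omega_gen\<close> does not truncate the list
  of entries.\<close>

lemma keys_iter_coact:
  assumes "(z, xs) \<in> Poly_Mapping.keys (SOME r. r \<in> iter_coact C D n y)"
  shows "length xs = n"
proof -
  let ?B = "{(z, xs). length xs = n}" and ?W = "fspan (multilin_rels (dsc D) (csc C) n)"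
  have "Poly_Mapping.keys (SOME r. r \<in> iter_coact C D n y) \<subseteq> ?B"
  proof (rule quotient_rep(1)[where W = ?W])
    show "Poly_Mapping.keys w \<subseteq> ?B" if "w \<in> ?W" for w
      using keys_multilin_rels that by (rule fspan_keys)
    show "iter_coact C D n y \<in> vcarrier (quotient_space (free_space ?B) ?W)"
      using keys_iter_coact_rep[of D n y] by (auto simp: quotient_carrier iter_coact_def)
  qed simp
  then show ?thesis using assms by auto
qed

lemma C_space_rep:
  assumes "X \<in> vcarrier (C_space H P n)"
  shows "X \<in> range (cls (rel_C H P n))"
    and "(\<And>p us. length us = n \<Longrightarrow> f (p, us) = g (p, us)) \<Longrightarrow> ev X f = ev X g"
proof -
  note rep = quotient_rep[OF subspace_rel_C keys_rel_C[where H = H and P = P] assms[unfolded C_space_def]]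
  show "X \<in> range (cls (rel_C H P n))" by (rule rep(2))
  show "ev X f = ev X g" if "\<And>p us. length us = n \<Longrightarrow> f (p, us) = g (p, us)"
    unfolding sweedler_def using rep(1) that by (intro pairing_cong) auto
qed

section \<open>Linearity of the operators of the cyclic module\<close>

context hopf_module
begin

lemma annihilates_face:
  assumes "annihilates (rel_C H P (n - 1)) f" and "1 \<le> n" and "i \<le> n"
  shows "annihilates (rel_C H P n) (\<lambda>x. f (face_gen H P n i x))"
  using chain_form_face[of n "\<lambda>p us. f (p, us)" i] assms by (simp add: annihilates_rel_C)

lemma annihilates_degen:
  assumes "annihilates (rel_C H P (n + 1)) f" and "i \<le> n"
  shows "annihilates (rel_C H P n) (\<lambda>x. f (degen_gen n i x))"
  using chain_form_degen[of n "\<lambda>p us. f (p, us)" i] assms by (simp add: annihilates_rel_C)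

lemma annihilates_cyc:
  assumes "annihilates (rel_C H P n) f"
  shows "annihilates (rel_C H P n) (\<lambda>x. pairing (cyc_gen H P n x) f)"
proof -
  let ?b = "\<lambda>p us. f (p, us)"
  have "chain_form H P n (\<lambda>p us. pairing (cyc_gen H P n (p, us)) f) \<longleftrightarrow>
      chain_form H P n (cyc_pullback H P n ?b)"
    using pairing_cyc_gen[where b = ?b and n = n] by (intro chain_form_cong) simp
  then show ?thesis
    using assms chain_form_cyc[of n ?b] by (simp add: annihilates_rel_C)
qed

lemma linear_cyclic_hopf: "linear_cyclic (hopf_cyclic H P)"
  unfolding linear_cyclic_def
proof (intro conjI allI impI)
  show "kspace_laws (level (hopf_cyclic H P) n)" for n
    by (simp add: hopf_cyclic_def C_space_def kspace_laws_quotient)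
  show "linear_map (level (hopf_cyclic H P) n) (level (hopf_cyclic H P) n) (cyc (hopf_cyclic H P) n)" for n
    unfolding hopf_cyclic_def cyclic_data.simps C_space_def
  proof (rule linear_map_induced[OF subspace_rel_C _ subspace_rel_C])
    show "Poly_Mapping.keys w \<subseteq> {(p, us). length us = n}" if "w \<in> rel_C H P n" for w
      by (rule keys_rel_C[OF that])
    show "Poly_Mapping.keys (cyc_gen H P n x) \<subseteq> {(p, us). length us = n}"
      if "x \<in> {(p, us). length us = n}" for x
      using that keys_cyc_gen[of "snd x" n H P "fst x"] by auto
  qed (rule annihilates_cyc)
  show "linear_map (level (hopf_cyclic H P) (Suc n)) (level (hopf_cyclic H P) n) (face (hopf_cyclic H P) (Suc n) i)"
    if "i \<le> Suc n" for n i
    unfolding hopf_cyclic_def cyclic_data.simps C_space_def diff_Suc_1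
  proof (rule linear_map_induced[OF subspace_rel_C _ subspace_rel_C])
    show "Poly_Mapping.keys w \<subseteq> {(p, us). length us = Suc n}" if "w \<in> rel_C H P (Suc n)" for w
      by (rule keys_rel_C[OF that])
    show "Poly_Mapping.keys (gen (face_gen H P (Suc n) i x) :: _ \<Rightarrow>\<^sub>0 'k) \<subseteq> {(p, us). length us = n}"
      if "x \<in> {(p, us). length us = Suc n}" for x
      using that length_face_gen[of "snd x" n i H P "fst x"] \<open>i \<le> Suc n\<close> by (auto simp: case_prod_unfold)
    show "annihilates (rel_C H P (Suc n)) (\<lambda>x. pairing (gen (face_gen H P (Suc n) i x)) f)"
      if "annihilates (rel_C H P n) f" for f
      using annihilates_face[of "Suc n" f i] that \<open>i \<le> Suc n\<close> by simp
  qed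
qed

end

section \<open>The measured map as a morphism of cyclic modules\<close>

context measured_hopf_modules
begin

text \<open>Bridge from the Sweedler sum that defines the map to the recursion \<open>mlist\<close>;
  the second version admits any representative of the iterated coaction.\<close>

lemma pairing_Omega:
  assumes f: "annihilates (rel_C H' P' n) f" and us: "length us = n"
  shows "pairing (sw (iter_coact C D n y) (\<lambda>z. gen (Omega_gen Om Psi (p, us) z))) f =
      Om_pullback y (\<lambda>p us. f (p, us)) p us" (is ?ev)
    and "r \<in> iter_coact C D n y \<Longrightarrow>
      pairing (lin_ext fscale (\<lambda>z. gen (Omega_gen Om Psi (p, us) z)) r) f = Om_pullback y (\<lambda>p us. f (p, us)) p us"
      (is "_ \<Longrightarrow> ?rep")
proof -
  have b: "chain_form H' P' n (\<lambda>p us. f (p, us))" using f by (simp add: annihilates_rel_C)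
  note iter = ev_iter_coact[OF family_form_Om[OF b] us]
  show ?ev
    using iter(2)[of y p] by (simp add: pairing_sw Omega_gen_def Om_pullback_def case_prod_unfold)
  show ?rep if "r \<in> iter_coact C D n y"
    using iter(1)[OF that, of p] by (simp add: pairing_lin_ext Omega_gen_def Om_pullback_def case_prod_unfold)
qed

lemma annihilates_Omega:
  assumes f: "annihilates (rel_C H' P' n) f"
  shows "annihilates (rel_C H P n)
    (\<lambda>x. pairing (sw (iter_coact C D n y) (\<lambda>z. gen (Omega_gen Om Psi x z))) f)"
proof -
  let ?b = "\<lambda>p us. f (p, us)"
  have "chain_form H P n (\<lambda>p us. pairing (sw (iter_coact C D n y) (\<lambda>z. gen (Omega_gen Om Psi (p, us) z))) f) \<longleftrightarrow>
      chain_form H P n (Om_pullback y ?b)"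
    by (intro chain_form_cong pairing_Omega(1)[OF f])
  then show ?thesis
    using f chain_form_Om[of n ?b y] by (simp add: annihilates_rel_C)
qed

lemma ev_Omega_map:
  assumes f: "annihilates (rel_C H' P' n) f"
  shows "ev (Omega_map C D H' P' Psi Om y n X) f =
    ev X (\<lambda>x. pairing (sw (iter_coact C D n y) (\<lambda>z. gen (Omega_gen Om Psi x z))) f)"
  unfolding Omega_map_def by (rule ev_induced[OF subspace_rel_C f])

lemma Omega_map_gen:
  assumes us: "length us = n" and r: "r \<in> iter_coact C D n y"
  shows "Omega_map C D H' P' Psi Om y n (cls (rel_C H P n) (gen (p, us))) =
    cls (rel_C H' P' n) (lin_ext fscale (\<lambda>z. gen (Omega_gen Om Psi (p, us) z)) r)"
  unfolding Omega_map_def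
proof (rule cls_eqI[OF subspace_rel_C])
  fix f :: "'p2 \<times> 'u2 list \<Rightarrow> 'k"
  assume f: "annihilates (rel_C H' P' n) f"
  then show "pairing (sw (cls (rel_C H P n) (gen (p, us)))
        (\<lambda>x. sw (iter_coact C D n y) (\<lambda>z. gen (Omega_gen Om Psi x z)))) f =
      pairing (lin_ext fscale (\<lambda>z. gen (Omega_gen Om Psi (p, us) z)) r) f"
    using us r
    by (simp add: pairing_sw[where X = "cls _ _"] ev_cls[OF subspace_rel_C annihilates_Omega[OF f]] pairing_Omega)
qed

lemma linear_map_Omega:
  "linear_map (C_space H P n) (C_space H' P' n) (Omega_map C D H' P' Psi Om y n)"
  unfolding C_space_def Omega_map_def[abs_def]
proof (rule linear_map_induced[OF subspace_rel_C _ subspace_rel_C])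
  show "Poly_Mapping.keys w \<subseteq> {(p, us). length us = n}" if "w \<in> rel_C H P n" for w
    by (rule keys_rel_C[OF that])
  fix x :: "'p \<times> 'u list"
  assume "x \<in> {(p, us). length us = n}"
  then show "Poly_Mapping.keys (sw (iter_coact C D n y) (\<lambda>z. gen (Omega_gen Om Psi x z)) :: _ \<Rightarrow>\<^sub>0 'k) \<subseteq> {(p, us). length us = n}"
    unfolding sweedler_def using keys_iter_coact[of _ _ C D n y]
    by (intro keys_lin_ext) (auto simp: Omega_gen_def)
qed (rule annihilates_Omega)

text \<open>Common argument for faces, degeneracies and the cyclic operator: tested against a form,
  both composites become \<open>ev X\<close> of functions on generators, and those are compared on
  lists of length \<open>n\<close>.\<close>

lemma Omega_commute:
  assumes X: "X \<in> vcarrier (C_space H P n)"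
    and g: "\<And>f. annihilates (rel_C H' P' m) f \<Longrightarrow> annihilates (rel_C H' P' n) (\<lambda>x. pairing (g' x) f)"
    and comm: "\<And>f p us. \<lbrakk>annihilates (rel_C H' P' m) f; length us = n\<rbrakk> \<Longrightarrow>
      pairing (g (p, us)) (\<lambda>x. pairing (sw (iter_coact C D m y) (\<lambda>z. gen (Omega_gen Om Psi x z))) f) =
      Om_pullback y (\<lambda>p us. pairing (g' (p, us)) f) p us"
  shows "Omega_map C D H' P' Psi Om y m (cls (rel_C H P m) (sw X g)) =
    cls (rel_C H' P' m) (sw (Omega_map C D H' P' Psi Om y n X) g')"
proof (rule cls_eq_clsI[OF subspace_rel_C])
  fix f :: "'p2 \<times> 'u2 list \<Rightarrow> 'k"
  assume f: "annihilates (rel_C H' P' m) f"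
  have "ev X (\<lambda>x. pairing (g x) (\<lambda>x. pairing (sw (iter_coact C D m y) (\<lambda>z. gen (Omega_gen Om Psi x z))) f)) =
      ev X (\<lambda>x. pairing (sw (iter_coact C D n y) (\<lambda>z. gen (Omega_gen Om Psi x z))) (\<lambda>x. pairing (g' x) f))"
    by (rule C_space_rep(2)[OF X]) (simp only: comm[OF f] pairing_Omega(1)[OF g[OF f]])
  then show "ev (Omega_map C D H' P' Psi Om y m (cls (rel_C H P m) (sw X g))) f =
      ev (cls (rel_C H' P' m) (sw (Omega_map C D H' P' Psi Om y n X) g')) f"
    unfolding ev_Omega_map[OF f] ev_induced[OF subspace_rel_C annihilates_Omega[OF f]]
      ev_induced[OF subspace_rel_C f] ev_Omega_map[OF g[OF f]] .
qed (simp_all add: Omega_map_def)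

lemma cyclic_morphism_Omega:
  "cyclic_morphism (hopf_cyclic H P) (hopf_cyclic H' P') (Omega_map C D H' P' Psi Om y)"
  unfolding cyclic_morphism_def hopf_cyclic_def cyclic_data.simps
proof (intro conjI allI ballI impI)
  show "linear_map (C_space H P n) (C_space H' P' n) (Omega_map C D H' P' Psi Om y n)" for n
    by (rule linear_map_Omega)
next
  fix n i X
  assume X: "X \<in> vcarrier (C_space H P n)" and n: "1 \<le> n" and i: "i \<le> n"
  show "Omega_map C D H' P' Psi Om y (n - 1) (cls (rel_C H P (n - 1)) (sw X (\<lambda>x. gen (face_gen H P n i x)))) =
      cls (rel_C H' P' (n - 1)) (sw (Omega_map C D H' P' Psi Om y n X) (\<lambda>x. gen (face_gen H' P' n i x)))"
  proof (rule Omega_commute[OF X])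
    fix f :: "'p2 \<times> 'u2 list \<Rightarrow> 'k" and p :: 'p and us :: "'u list"
    assume f: "annihilates (rel_C H' P' (n - 1)) f"
    then show "annihilates (rel_C H' P' n) (\<lambda>x. pairing (gen (face_gen H' P' n i x)) f)"
      using cod.annihilates_face[OF f n i] by simp
    assume us: "length us = n"
    obtain p' us' where face: "face_gen H P n i (p, us) = (p', us')" by (cases "face_gen H P n i (p, us)")
    then have "length us' = n - 1" using length_face_gen[of us "n - 1" i H P p] us n i by simp
    then show "pairing (gen (face_gen H P n i (p, us)))
          (\<lambda>x. pairing (sw (iter_coact C D (n - 1) y) (\<lambda>z. gen (Omega_gen Om Psi x z))) f) =
        Om_pullback y (\<lambda>p us. pairing (gen (face_gen H' P' n i (p, us))) f) p us"
      using Om_pullback_face[OF _ us n i, where b = "\<lambda>p us. f (p, us)" and p = p and y = y] f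
      by (simp add: face pairing_Omega(1)[OF f, simplified] annihilates_rel_C)
  qed
next
  fix n i X
  assume X: "X \<in> vcarrier (C_space H P n)" and i: "i \<le> n"
  show "Omega_map C D H' P' Psi Om y (n + 1) (cls (rel_C H P (n + 1)) (sw X (\<lambda>x. gen (degen_gen n i x)))) =
      cls (rel_C H' P' (n + 1)) (sw (Omega_map C D H' P' Psi Om y n X) (\<lambda>x. gen (degen_gen n i x)))"
  proof (rule Omega_commute[OF X])
    fix f :: "'p2 \<times> 'u2 list \<Rightarrow> 'k" and p :: 'p and us :: "'u list"
    assume f: "annihilates (rel_C H' P' (n + 1)) f"
    then show "annihilates (rel_C H' P' n) (\<lambda>x. pairing (gen (degen_gen n i x)) f)"
      using cod.annihilates_degen[OF f i] by simp
    assume us: "length us = n"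
    obtain us' where degen: "degen_gen n i (p, us) = (p, us')" "length us' = n + 1"
      using us by (simp add: degen_gen_def)
    then show "pairing (gen (degen_gen n i (p, us)))
          (\<lambda>x. pairing (sw (iter_coact C D (n + 1) y) (\<lambda>z. gen (Omega_gen Om Psi x z))) f) =
        Om_pullback y (\<lambda>p us. pairing (gen (degen_gen n i (p, us))) f) p us"
      using Om_pullback_degen[OF _ us, where b = "\<lambda>p us. f (p, us)" and i = i and p = p and y = y] f
      by (simp add: pairing_Omega(1)[OF f, simplified] annihilates_rel_C)
  qed
next
  fix n X
  assume X: "X \<in> vcarrier (C_space H P n)"
  show "Omega_map C D H' P' Psi Om y n (cls (rel_C H P n) (sw X (cyc_gen H P n))) =
      cls (rel_C H' P' n) (sw (Omega_map C D H' P' Psi Om y n X) (cyc_gen H' P' n))"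
  proof (rule Omega_commute[OF X])
    fix f :: "'p2 \<times> 'u2 list \<Rightarrow> 'k" and p :: 'p and us :: "'u list"
    assume f: "annihilates (rel_C H' P' n) f"
    then show "annihilates (rel_C H' P' n) (\<lambda>x. pairing (cyc_gen H' P' n x) f)"
      by (rule cod.annihilates_cyc)
    assume us: "length us = n"
    have b: "chain_form H' P' n (\<lambda>p us. f (p, us))" using f by (simp add: annihilates_rel_C)
    have "pairing (cyc_gen H P n (p, us)) (\<lambda>x. pairing (sw (iter_coact C D n y) (\<lambda>z. gen (Omega_gen Om Psi x z))) f) =
        pairing (cyc_gen H P n (p, us)) (\<lambda>(p, us). Om_pullback y (\<lambda>p us. f (p, us)) p us)"
      using subsetD[OF keys_cyc_gen[OF us, of H P p]]
      by (intro pairing_cong) (auto intro!: pairing_Omega(1)[OF f])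
    also have "\<dots> = Om_pullback y (cyc_pullback H' P' n (\<lambda>p us. f (p, us))) p us"
      by (simp add: pairing_cyc_gen[OF us] Om_pullback_cyc[OF b us])
    also have "\<dots> = Om_pullback y (\<lambda>p us. pairing (cyc_gen H' P' n (p, us)) f) p us"
      unfolding Om_pullback_def
      using us pairing_cyc_gen[where b = "\<lambda>p us. f (p, us)" and n = n and H = H' and P = P']
      by (intro mlist_cong) simp
    finally show "pairing (cyc_gen H P n (p, us))
          (\<lambda>x. pairing (sw (iter_coact C D n y) (\<lambda>z. gen (Omega_gen Om Psi x z))) f) =
        Om_pullback y (\<lambda>p us. pairing (cyc_gen H' P' n (p, us)) f) p us" .
  qed
qed

end

theorem proposition6p2:
  fixes H :: "('k::field, 'u::{ring,monoid_mult}, 'a::{ring,monoid_mult}) hopf_algebroid_data"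
    and H' :: "('k, 'u2::{ring,monoid_mult}, 'a2::{ring,monoid_mult}) hopf_algebroid_data"
    and P :: "('k, 'u, 'a, 'p::ab_group_add) sayd_data"
    and P' :: "('k, 'u2, 'a2, 'p2::ab_group_add) sayd_data"
    and C :: "('k, 'c::ab_group_add) coalgebra_data"
    and D :: "('k, 'c, 'd::ab_group_add) comodule_data"
    and Psi :: "'c \<Rightarrow> 'u \<Rightarrow> 'u2"
    and psi :: "'c \<Rightarrow> 'a \<Rightarrow> 'a2"
    and Om :: "'d \<Rightarrow> 'p \<Rightarrow> 'p2"
    and y :: 'd
  assumes "hopf_algebroid H" and "hopf_algebroid H'"
    and "sayd_module H P" and "sayd_module H' P'"
    and "cocommutative_coalgebra C"
    and "hopf_measuring C H H' Psi psi"
    and "comodule_measuring C H' P P' Psi D Om"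
  shows
    "(\<forall>n p us. \<forall>r\<in>iter_coact C D n y. length us = n \<longrightarrow>
        Omega_map C D H' P' Psi Om y n (cls (rel_C H P n) (gen (p, us))) =
        cls (rel_C H' P' n) (lin_ext fscale (\<lambda>z. gen (Omega_gen Om Psi (p, us) z)) r)) \<and>
     cyclic_morphism (hopf_cyclic H P) (hopf_cyclic H' P')
       (Omega_map C D H' P' Psi Om y) \<and>
     induces_on_homology (hochschild_complex (hopf_cyclic H P))
       (hochschild_complex (hopf_cyclic H' P'))
       (Omega_map C D H' P' Psi Om y) \<and>
     induces_on_homology (cyclic_complex (hopf_cyclic H P))
       (cyclic_complex (hopf_cyclic H' P'))
       (total_map (Omega_map C D H' P' Psi Om y))"
proof -
  interpret measured_hopf_modules H P H' P' C Psi psi D Om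
    using assms by (intro measured_hopf_modules.intro hopf_module.intro)
  note morphism = dom.linear_cyclic_hopf cod.linear_cyclic_hopf cyclic_morphism_Omega
  show ?thesis
    using Omega_map_gen cyclic_morphism_Omega hochschild_induced[OF morphism] cyclic_induced[OF morphism]
    by blast
qed

end
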